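(* Let $\phi^t$ be a reparametrized linear flow (in the sense of the context) with angle $\alpha$ and stopping points $\mathbf p$ and $\mathbf q$, and let $p_n/q_n$ be the convergents of $\alpha$. If $\mathbf p$ and $\mathbf q$ lie on the same orbit of the linear flow, and if there exist $C>0$ and $\gamma>0$ such that $q_n\ge C\exp(n^{2+\gamma})$ for every $n$, then $\phi^t$ has a unique physical measure; this measure attracts Lebesgue almost every point (i.e. its basin has full $\lambda^2$-measure) and it is equal to $\mu_\infty$.
   Context: For irrational $\alpha=[a_0;a_1,a_2,\dots]$ (continued fraction), $p_n/q_n=[a_0;a_1,\dots,a_n]$ is the $n$-th convergent in lowest terms, $q_n>0$. Let $\mathbb T^2=\mathbb R^2/\mathbb Z^2$, and let $\lambda^2$ be Lebesgue (Haar) measure on $\mathbb T^2$. A reparametrized linear flow with angle $\alpha$ and stopping points at $\mathbf p$ and $\mathbf q$ is the flow $\phi^t$ on $\mathbb T^2$ generated by a vector field $X=\varphi X_0$ such that: $X_0=(1,\alpha)$ with $\alpha\in\mathbb R$ irrational; $\varphi:\mathbb T^2\to[0,\infty)$ is of class $C^3$; $\varphi$ vanishes at two distinct points $\mathbf p,\mathbf q$ and is positive elsewhere; the Hessians $D^2\varphi(\mathbf p)$ and $D^2\varphi(\mathbf q)$ are positive definite. The points $\mathbf p,\mathbf q$ lie on the same orbit if $\mathbf q=\mathbf p+r(1,\alpha)\bmod\mathbb Z^2$ for some $r\in\mathbb R$. Put $d_{\mathbf p}=\det D^2\varphi(\mathbf p)$, $d_{\mathbf q}=\det D^2\varphi(\mathbf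 q)$ and $$\mu_\infty=\frac{\sqrt{d_{\mathbf q}}}{\sqrt{d_{\mathbf p}}+\sqrt{d_{\mathbf q}}}\delta_{\mathbf p}+\frac{\sqrt{d_{\mathbf p}}}{\sqrt{d_{\mathbf p}}+\sqrt{d_{\mathbf q}}}\delta_{\mathbf q}.$$ For $\mathbf x\in\mathbb T^2$ and $t>0$ the empirical measure $\mu^t_{\mathbf x}$ is the Borel probability with $\int f\,d\mu^t_{\mathbf x}=\frac1t\int_0^t f(\phi^s(\mathbf x))\,ds$ for continuous $f$, and $p\omega(\mathbf x)=\bigcap_{T>0}\overline{\{\mu^t_{\mathbf x}:t\ge T\}}$ (weak-* closure). The basin of a probability measure $\mu$ is $\{\mathbf x:p\omega(\mathbf x)=\{\mu\}\}$, and $\mu$ is physical if its basin has positive $\lambda^2$-measure. *)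

theory Defs
  imports "HOL-Probability.Probability"
begin

text \<open>The torus as the set of cosets of the integer lattice, with the quotient topology.
  The projection from the plane is \<open>abs_torus\<close>; \<open>rep_torus\<close> chooses a representative.\<close>

quotient_type torus = "real^2" / "\<lambda>x y. \<forall>i. x $ i - y $ i \<in> \<int>"
proof (rule equivpI)
  show "reflp (\<lambda>x y :: real^2. \<forall>i. x $ i - y $ i \<in> \<int>)"
    by (simp add: reflp_def)
  show "symp (\<lambda>x y :: real^2. \<forall>i. x $ i - y $ i \<in> \<int>)"
    unfolding symp_def by (metis Ints_minus minus_diff_eq)
  show "transp (\<lambda>x y :: real^2. \<forall>i. x $ i - y $ i \<in> \<int>)"
    unfolding transp_def
  proof (intro allI impI)
    fix x y z :: "real^2" and i
    assume "\<forall>i. x $ i - y $ i \<in> \<int>" "\<forall>i. y $ i - z $ i \<in> \<int>"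
    then have "(x $ i - y $ i) + (y $ i - z $ i) \<in> \<int>"
      by (intro Ints_add) auto
    then show "x $ i - z $ i \<in> \<int>" by simp
  qed
qed

instantiation torus :: topological_space
begin

definition open_torus :: "torus set \<Rightarrow> bool" where
  "open_torus U \<longleftrightarrow> open (abs_torus -` U)"

instance
  by standard (auto simp: open_torus_def vimage_Union open_Int)

end

definition torus_lebesgue :: "torus measure" where
  "torus_lebesgue =
     completion
       (distr (restrict_space lborel {x :: real^2. \<forall>i. 0 \<le> x $ i \<and> x $ i < 1}) borel abs_torus)"

primrec class_C :: "nat \<Rightarrow> ('a::euclidean_space \<Rightarrow> real) \<Rightarrow> bool" where
  "class_C 0 f \<longleftrightarrow> continuous_on UNIV f"
| "class_C (Suc k) f \<longleftrightarrow>
     (\<forall>x. f differentiable at x) \<and> (\<forall>v. class_C k (\<lambda>x. frechet_derivative f (at x) v))"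

definition hessian :: "(real^'n \<Rightarrow> real) \<Rightarrow> real^'n \<Rightarrow> real^'n^'n" where
  "hessian f x = (\<chi> i j.
     frechet_derivative (\<lambda>y. frechet_derivative f (at y) (axis j 1)) (at x) (axis i 1))"

definition positive_definite :: "real^'n^'n \<Rightarrow> bool" where
  "positive_definite A \<longleftrightarrow> transpose A = A \<and> (\<forall>v. v \<noteq> 0 \<longrightarrow> v \<bullet> (A *v v) > 0)"

text \<open>Functions on the torus are differentiated through their periodic lift to the plane; by
  periodicity the Hessian does not depend on the representative.\<close>

definition torus_class_C :: "nat \<Rightarrow> (torus \<Rightarrow> real) \<Rightarrow> bool" where
  "torus_class_C k f \<longleftrightarrow> class_C k (\<lambda>x. f (abs_torus x))"

definition torus_hessian :: "(torus \<Rightarrow> real) \<Rightarrow> torus \<Rightarrow> real^2^2" where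
  "torus_hessian f p = hessian (\<lambda>x. f (abs_torus x)) (rep_torus p)"

text \<open>The tangent bundle of the torus is identified with the product of the torus with the
  plane, and every integral curve is given by its lift to the plane.\<close>

definition flow_generated_by :: "(torus \<Rightarrow> real^2) \<Rightarrow> (real \<Rightarrow> torus \<Rightarrow> torus) \<Rightarrow> bool" where
  "flow_generated_by X \<Phi> \<longleftrightarrow>
     (\<forall>x. \<exists>c. c 0 = x \<and>
        (\<forall>t. (c has_vector_derivative X (abs_torus (c t))) (at t)) \<and>
        (\<forall>t. \<Phi> t (abs_torus x) = abs_torus (c t)))"

definition linear_field :: "real \<Rightarrow> real^2" where
  "linear_field \<alpha> = vector [1, \<alpha>]"

definition reparametrized_linear_flow ::
  "real \<Rightarrow> (torus \<Rightarrow> real) \<Rightarrow> torus \<Rightarrow> torus \<Rightarrow> (real \<Rightarrow> torus \<Rightarrow> torus) \<Rightarrow> bool" where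
  "reparametrized_linear_flow \<alpha> \<phi> p q \<Phi> \<longleftrightarrow>
     \<alpha> \<notin> \<rat> \<and> torus_class_C 3 \<phi> \<and>
     p \<noteq> q \<and> \<phi> p = 0 \<and> \<phi> q = 0 \<and> (\<forall>x. x \<noteq> p \<and> x \<noteq> q \<longrightarrow> \<phi> x > 0) \<and>
     positive_definite (torus_hessian \<phi> p) \<and> positive_definite (torus_hessian \<phi> q) \<and>
     flow_generated_by (\<lambda>x. \<phi> x *\<^sub>R linear_field \<alpha>) \<Phi>"

definition same_linear_orbit :: "real \<Rightarrow> torus \<Rightarrow> torus \<Rightarrow> bool" where
  "same_linear_orbit \<alpha> p q \<longleftrightarrow>
     (\<exists>x r. p = abs_torus x \<and> q = abs_torus (x + r *\<^sub>R linear_field \<alpha>))"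

primrec complete_quotient :: "real \<Rightarrow> nat \<Rightarrow> real" where
  "complete_quotient \<alpha> 0 = \<alpha>"
| "complete_quotient \<alpha> (Suc n) = 1 / frac (complete_quotient \<alpha> n)"

definition partial_quotient :: "real \<Rightarrow> nat \<Rightarrow> int" where
  "partial_quotient \<alpha> n = \<lfloor>complete_quotient \<alpha> n\<rfloor>"

fun finite_cfrac :: "int list \<Rightarrow> rat" where
  "finite_cfrac [] = 0"
| "finite_cfrac [a] = of_int a"
| "finite_cfrac (a # b # as) = of_int a + 1 / finite_cfrac (b # as)"

definition convergent_cfrac :: "real \<Rightarrow> nat \<Rightarrow> rat" where
  "convergent_cfrac \<alpha> n = finite_cfrac (map (partial_quotient \<alpha>) [0..<Suc n])"

text \<open>\<open>quotient_of\<close> yields numerator and denominator in lowest terms, the latter positive.\<close>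

definition convergent_denom :: "real \<Rightarrow> nat \<Rightarrow> int" where
  "convergent_denom \<alpha> n = snd (quotient_of (convergent_cfrac \<alpha> n))"

definition borel_probs :: "'a::topological_space measure set" where
  "borel_probs = {\<mu>. sets \<mu> = sets borel \<and> prob_space \<mu>}"

text \<open>The coarsest topology making integration against each continuous function continuous;
  on the compact torus, continuous functions are automatically bounded.  Taking \<open>U = UNIV\<close> shows
  that the underlying set is \<open>borel_probs\<close>.\<close>

definition weak_star_topology :: "torus measure topology" where
  "weak_star_topology = topology_generated_by
     {{\<mu> \<in> borel_probs. (\<integral>x. f x \<partial>\<mu>) \<in> U} | (f :: torus \<Rightarrow> real) U. continuous_on UNIV f \<and> open U}"

definition empirical_measure :: "(real \<Rightarrow> torus \<Rightarrow> torus) \<Rightarrow> torus \<Rightarrow> real \<Rightarrow> torus measure" where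
  "empirical_measure \<Phi> x t =
     (THE \<mu>. \<mu> \<in> borel_probs \<and>
        (\<forall>f :: torus \<Rightarrow> real. continuous_on UNIV f \<longrightarrow>
           (\<integral>y. f y \<partial>\<mu>) = (1 / t) * integral {0..t} (\<lambda>s. f (\<Phi> s x))))"

definition p_omega :: "(real \<Rightarrow> torus \<Rightarrow> torus) \<Rightarrow> torus \<Rightarrow> torus measure set" where
  "p_omega \<Phi> x =
     (\<Inter>T\<in>{0<..}. weak_star_topology closure_of {empirical_measure \<Phi> x t | t. t \<ge> T})"

definition basin :: "(real \<Rightarrow> torus \<Rightarrow> torus) \<Rightarrow> torus measure \<Rightarrow> torus set" where
  "basin \<Phi> \<mu> = {x. p_omega \<Phi> x = {\<mu>}}"

definition physical_measure :: "(real \<Rightarrow> torus \<Rightarrow> torus) \<Rightarrow> torus measure \<Rightarrow> bool" where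
  "physical_measure \<Phi> \<mu> \<longleftrightarrow>
     \<mu> \<in> borel_probs \<and> emeasure torus_lebesgue (basin \<Phi> \<mu>) > 0"

definition mu_infinity :: "(torus \<Rightarrow> real) \<Rightarrow> torus \<Rightarrow> torus \<Rightarrow> torus measure" where
  "mu_infinity \<phi> p q =
     (let dp = det (torus_hessian \<phi> p); dq = det (torus_hessian \<phi> q) in
      measure_of UNIV (sets borel) (\<lambda>A.
        ennreal (sqrt dq / (sqrt dp + sqrt dq)) * emeasure (return borel p) A +
        ennreal (sqrt dp / (sqrt dp + sqrt dq)) * emeasure (return borel q) A))"

end

theory Submission
  imports Defs "HOL-Real_Asymp.Real_Asymp"
begin

text \<open>On a linear orbit that avoids the stopping points, the time spent near a point is the integral
  of \<open>1 / \<phi>\<close> along the orbit. A passage at transversal distance \<open>s\<close> from \<open>p\<close> lasts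
  \<open>2\<pi> / (sqrt d\<^sub>p \<bar>s\<bar>)\<close> up to a factor tending to one, because \<open>\<phi>\<close> is close to half its Hessian form there;
  likewise for \<open>q\<close>. As \<open>p\<close> and \<open>q\<close> lie on one orbit, the successive distances
  \<open>\<parallel>\<beta> + k\<alpha>\<parallel>\<close> are the same for both. So both occupation times are asymptotic to a constant times
  \<open>S\<^sub>N = \<Sum>\<^bsub>k \<le> N\<^esub> 1 / \<parallel>\<beta> + k\<alpha>\<parallel>\<close>, whose ratio is the one in \<open>\<mu>\<^sub>\<infinity>\<close>, provided that
  \<open>N = o(S\<^sub>N)\<close> (the rest of the torus is negligible) and that no single term is comparable with the
  sum, \<open>1 / \<parallel>\<beta> + (N + 1)\<alpha>\<parallel> = o(S\<^sub>N)\<close>. The points \<open>k\<alpha>\<close>, \<open>k \<le> q\<^sub>n\<close>, are almost equidistributed, so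
  \<open>S\<^sub>N \<ge> N (log q\<^sub>n - 1) / 2\<close> for \<open>N \<ge> q\<^sub>n\<close>. With \<open>L = log q\<^sub>n\<close> and suitable \<open>\<tau> < 1\<close>, the set of \<open>\<beta>\<close>
  with \<open>\<parallel>\<beta> + k\<alpha>\<parallel> < 1 / (k L\<^sup>\<tau>)\<close> for some \<open>k\<close> in \<open>(q\<^sub>n, q\<^sub>n\<^sub>+\<^sub>1]\<close> has measure of order \<open>L\<^sup>-\<^sup>\<tau>\<^sup>/\<^sup>2\<close>; the growth
  hypothesis makes this summable, and Borel--Cantelli applies.\<close>

section \<open>Convergents\<close>

text \<open>A passage integral is known only up to an error \<open>o(1 / |s|) + O(1)\<close>. The
  bounded parts add up to \<open>O(N)\<close>, which is why \<open>N\<close> must be negligible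
  against the sum. The average may also stop in the middle of a passage, and the passages near the
  two points are out of phase by a bounded amount, so a bounded number of extra terms must not
  change the sum noticeably.

  The obstacle is the measure estimate. A plain union bound over k in (q_n, q_{n+1}] costs a factor
  log (q_{n+1} / q_n), and no upper bound on q_{n+1} is available. Overlaps remove this factor: with
  \<eta> = L^(-\<tau>), the times k \<le> \<theta> q_{n+1} cost \<eta> + \<theta>, the later ones
  \<eta> / \<theta>, and \<theta> = sqrt \<eta> balances the two. As L grows at least like
  n^(2+\<gamma>), summability asks for (2 + \<gamma>) \<tau> / 2 > 1 with \<tau> < 1; this is where
  the exponent 2 of the hypothesis comes from. In turn \<tau> < 1 makes the newest term, of order at
  most N L^\<tau>, negligible against N L.\<close>

fun real_cfrac :: "real list \<Rightarrow> real" where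
  "real_cfrac [] = 0"
| "real_cfrac [a] = a"
| "real_cfrac (a # b # as) = a + 1 / real_cfrac (b # as)"

text \<open>Indices are shifted by one: the \<open>n\<close>-th convergent is
  \<open>cfrac_num a (Suc n) / cfrac_den a (Suc n)\<close>.\<close>

fun cfrac_num :: "(nat \<Rightarrow> int) \<Rightarrow> nat \<Rightarrow> int" where
  "cfrac_num a 0 = 1"
| "cfrac_num a (Suc 0) = a 0"
| "cfrac_num a (Suc (Suc n)) = a (Suc n) * cfrac_num a (Suc n) + cfrac_num a n"

fun cfrac_den :: "(nat \<Rightarrow> int) \<Rightarrow> nat \<Rightarrow> int" where
  "cfrac_den a 0 = 0"
| "cfrac_den a (Suc 0) = 1"
| "cfrac_den a (Suc (Suc n)) = a (Suc n) * cfrac_den a (Suc n) + cfrac_den a n"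

text \<open>Entries are real because the tail of the expansion of \<open>\<alpha>\<close> is
  irrational. Merging the last two entries lets an expansion change at its far end, where the
  recurrences for numerators and denominators act, whereas \<open>real_cfrac\<close> recurses at the
  front.\<close>

lemma real_cfrac_append: "real_cfrac (xs @ [a, b]) = real_cfrac (xs @ [a + 1 / b])"
proof (induction xs rule: real_cfrac.induct)
  case (3 x y xs)
  then show ?case by simp
qed auto

lemma of_rat_finite_cfrac: "of_rat (finite_cfrac xs) = real_cfrac (map real_of_int xs)"
  by (induction xs rule: finite_cfrac.induct) (auto simp: of_rat_add of_rat_divide)

lemma cfrac_den_pos:
  assumes "\<And>n. n > 0 \<Longrightarrow> a n \<ge> 1"
  shows "cfrac_den a n \<ge> 0" "cfrac_den a (Suc n) \<ge> 1"
proof (induction n)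
  case (Suc n)
  { case 1 show ?case using Suc by simp }
  { case 2 show ?case using Suc assms[of "Suc n"]
    by simp (smt (verit) mult_le_cancel_right1) }
qed auto

lemma cfrac_den_mono:
  assumes "\<And>n. n > 0 \<Longrightarrow> a n \<ge> 1"
  shows "cfrac_den a (Suc n) \<le> cfrac_den a (Suc (Suc n))"
  using cfrac_den_pos[of a n, OF assms] assms[of "Suc n"]
  by simp (smt (verit) mult_le_cancel_right1)

lemma cfrac_det: "cfrac_num a (Suc n) * cfrac_den a n - cfrac_num a n * cfrac_den a (Suc n) = (-1) ^ Suc n"
  by (induction n) (auto simp: algebra_simps)

text \<open>Induction with the tail \<open>z\<close> left arbitrary: the last two entries
  \<open>a (Suc n)\<close> and \<open>z\<close> merge into a tail \<open>z'\<close>, and multiplying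
  numerator and denominator of the formula for \<open>z'\<close> by \<open>z\<close> produces the
  recurrences one step further. Positivity of the tail keeps the denominators nonzero.\<close>

lemma real_cfrac_eq:
  assumes "\<And>n. n > 0 \<Longrightarrow> a n \<ge> 1" and "z > 0"
  shows "real_cfrac (map (\<lambda>i. real_of_int (a i)) [0..<Suc n] @ [z])
    = (z * cfrac_num a (Suc n) + cfrac_num a n) / (z * cfrac_den a (Suc n) + cfrac_den a n)"
  using assms(2)
proof (induction n arbitrary: z)
  case 0
  then show ?case by (simp add: field_simps)
next
  case (Suc n)
  define z' where "z' = a (Suc n) + 1 / z"
  have z': "z' > 0" using Suc.prems assms(1)[of "Suc n"] by (simp add: z'_def add_pos_pos)
  have d: "real_of_int (cfrac_den a n) \<ge> 0" "real_of_int (cfrac_den a (Suc n)) \<ge> 1"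
    using cfrac_den_pos[of a n, OF assms(1)] by auto
  have p1: "z' * cfrac_den a (Suc n) + cfrac_den a n > 0"
    using z' d by (intro add_pos_nonneg) auto
  have zz: "z * z' = z * a (Suc n) + 1" using Suc.prems by (simp add: z'_def field_simps)
  have "real_cfrac (map (\<lambda>i. real_of_int (a i)) [0..<Suc (Suc n)] @ [z])
     = real_cfrac (map (\<lambda>i. real_of_int (a i)) [0..<Suc n] @ [z'])"
    using real_cfrac_append[of "map (\<lambda>i. real_of_int (a i)) [0..<Suc n]"] by (simp add: z'_def)
  also have "\<dots> = (z' * cfrac_num a (Suc n) + cfrac_num a n) / (z' * cfrac_den a (Suc n) + cfrac_den a n)"
    by (rule Suc.IH[OF z'])
  also have "\<dots> = (z * (z' * cfrac_num a (Suc n) + cfrac_num a n)) / (z * (z' * cfrac_den a (Suc n)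
      + cfrac_den a n))"
    using Suc.prems by simp
  also have "z * (z' * cfrac_num a (Suc n) + cfrac_num a n) = z * cfrac_num a (Suc (Suc n))
      + cfrac_num a (Suc n)"
    using zz by (simp add: distrib_left mult.assoc[symmetric]) (simp add: algebra_simps)
  also have "z * (z' * cfrac_den a (Suc n) + cfrac_den a n) = z * cfrac_den a (Suc (Suc n))
      + cfrac_den a (Suc n)"
    using zz by (simp add: distrib_left mult.assoc[symmetric]) (simp add: algebra_simps)
  finally show ?case .
qed

lemma real_cfrac_int_eq:
  assumes "\<And>n. n > 0 \<Longrightarrow> a n \<ge> 1"
  shows "real_cfrac (map (\<lambda>i. real_of_int (a i)) [0..<Suc n]) = cfrac_num a (Suc n) / cfrac_den a (Suc n)"
proof (cases n)
  case (Suc m)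
  then show ?thesis using real_cfrac_eq[where a = a and n = m and z
      = "a (Suc m)", OF assms] assms[of "Suc m"] by (simp)
qed simp

locale irrational_cfrac =
  fixes \<alpha> :: real
  assumes irrational: "\<alpha> \<notin> \<rat>"
begin

abbreviation "cnum \<equiv> cfrac_num (partial_quotient \<alpha>)"
abbreviation "cden \<equiv> cfrac_den (partial_quotient \<alpha>)"

lemma complete_quotient_irrational: "complete_quotient \<alpha> n \<notin> \<rat>"
proof (induction n)
  case (Suc n)
  show ?case
  proof
    assume "complete_quotient \<alpha> (Suc n) \<in> \<rat>"
    from Rats_divide[OF Rats_1 this] have "frac (complete_quotient \<alpha> n) \<in> \<rat>" by simp
    then have "frac (complete_quotient \<alpha> n) + of_int \<lfloor>complete_quotient \<alpha> n\<rfloor> \<in> \<rat>" by (intro Rats_add) auto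
    then show False using Suc by (simp add: frac_def)
  qed
qed (simp add: irrational)

lemma frac_complete_quotient: "0 < frac (complete_quotient \<alpha> n)" "frac (complete_quotient \<alpha> n) < 1"
  using complete_quotient_irrational[of n] Ints_subset_Rats
  by (auto simp: frac_lt_1 frac_gt_0_iff)

lemma complete_quotient_gt_1: "complete_quotient \<alpha> (Suc n) > 1"
  using frac_complete_quotient[of n] by simp

lemma partial_quotient_ge_1: "n > 0 \<Longrightarrow> partial_quotient \<alpha> n \<ge> 1"
  using complete_quotient_gt_1[of "n - 1"]
      by (auto simp: partial_quotient_def simp del: complete_quotient.simps)

lemma complete_quotient_step: "complete_quotient \<alpha> n = partial_quotient \<alpha> n + 1 / complete_quotient \<alpha> (Suc n)"
  by (simp add: partial_quotient_def frac_def)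

lemma alpha_eq_real_cfrac:
  "\<alpha> = real_cfrac (map (\<lambda>i. real_of_int (partial_quotient \<alpha> i)) [0..<n] @ [complete_quotient \<alpha> n])"
proof (induction n)
  case (Suc n)
  show ?case
    using real_cfrac_append[of "map (\<lambda>i. real_of_int (partial_quotient \<alpha> i)) [0..<n]"
      "partial_quotient \<alpha> n" "complete_quotient \<alpha> (Suc n)"] Suc complete_quotient_step[of n]
    by (simp del: complete_quotient.simps)
qed simp

lemma coprime_cnum_cden: "coprime (cnum n) (cden n)"
proof (rule coprimeI)
  fix c assume "c dvd cnum n" "c dvd cden n"
  then have "c dvd cnum (Suc n) * cden n - cnum n * cden (Suc n)" by simp
  then show "is_unit c" unfolding cfrac_det using dvd_trans[of c "(-1) ^ Suc n" 1] by (simp del: power_Suc)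
qed

lemma cden_pos: "cden (Suc n) \<ge> 1"
  by (rule cfrac_den_pos[OF partial_quotient_ge_1])

text \<open>The determinant identity \<open>cfrac_det\<close> makes the recursive numerator and
  denominator coprime, and the denominator is positive, so \<open>quotient_of\<close> returns
  exactly this pair.\<close>

lemma convergent_denom_eq: "convergent_denom \<alpha> n = cden (Suc n)"
proof -
  have "real_of_rat (convergent_cfrac \<alpha> n) = real_of_rat (of_int (cnum (Suc n)) / of_int (cden (Suc n)))"
    unfolding convergent_cfrac_def of_rat_finite_cfrac
    using real_cfrac_int_eq[of "partial_quotient \<alpha>" n, OF partial_quotient_ge_1]
    by (simp add: of_rat_divide comp_def)
  then have "convergent_cfrac \<alpha> n = of_int (cnum (Suc n)) / of_int (cden (Suc n))"
      by (simp only: of_rat_eq_iff)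
  then have "quotient_of (convergent_cfrac \<alpha> n) = (cnum (Suc n), cden (Suc n))"
    using coprime_cnum_cden[of "Suc n"] cden_pos[of n]
    by (simp add: Fract_of_int_quotient[symmetric] quotient_of_Fract normalize_stable)
  then show ?thesis by (simp add: convergent_denom_def)
qed

text \<open>With the complete quotient \<open>z\<close> as last entry of the expansion of
  \<open>\<alpha>\<close>, the determinant identity gives the error exactly: in absolute value it is
  1 / (z q_n + q_{n-1}). Since \<open>z\<close> is at least its integer part, that denominator is at
  least q_{n+1}.\<close>

lemma convergent_error: "\<bar>convergent_denom \<alpha> n * \<alpha> - cnum (Suc n)\<bar> \<le> 1 / convergent_denom \<alpha> (Suc n)"
proof -
  define z where "z = complete_quotient \<alpha> (Suc n)"
  have z: "z > 1" "z \<ge> partial_quotient \<alpha> (Suc n)"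
    using complete_quotient_gt_1[of n] by (auto simp: z_def partial_quotient_def simp del:
        complete_quotient.simps)
  define A where "A = z * cden (Suc n) + cden n"
  have d: "cden n \<ge> 0" "cden (Suc n) \<ge> 1" using cfrac_den_pos[OF partial_quotient_ge_1] by auto
  have A: "A \<ge> cden (Suc (Suc n))"
    using z d by (auto simp: A_def intro!: mult_right_mono)
  have p: "cden (Suc (Suc n)) \<ge> 1" by (rule cden_pos)
  then have A0: "A > 0" using A by (smt (verit) of_int_1_le_iff)
  have "\<alpha> = (z * cnum (Suc n) + cnum n) / A"
    using alpha_eq_real_cfrac[of "Suc n"]
      real_cfrac_eq[where a = "partial_quotient \<alpha>" and n = n and z = z, OF partial_quotient_ge_1] z
          by (simp add: z_def A_def del: complete_quotient.simps)
  then have Aa: "A * \<alpha> = z * cnum (Suc n) + cnum n" using A0 by (simp add: field_simps)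
  have "cden (Suc n) * \<alpha> - cnum (Suc n) = (cden (Suc n) * (A * \<alpha>) - cnum (Suc n) * A) / A"
    using A0 by (simp add: field_simps)
  also have "\<dots> = (cden (Suc n) * (z * cnum (Suc n) + cnum n) - cnum (Suc n) * A) / A"
    unfolding Aa ..
  also have "cden (Suc n) * (z * cnum (Suc n) + cnum n) - cnum (Suc n) * A
      = - of_int (cnum (Suc n) * cden n - cnum n * cden (Suc n))"
    by (simp add: A_def algebra_simps)
  also have "\<dots> = - ((-1) ^ Suc n)" unfolding cfrac_det by simp
  finally have "\<bar>cden (Suc n) * \<alpha> - cnum (Suc n)\<bar> = 1 / A" using A0 by simp
  also have "\<dots> \<le> 1 / cden (Suc (Suc n))" using A A0 p
    by (intro divide_left_mono mult_pos_pos) (auto simp del: cfrac_den.simps)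
  finally show ?thesis by (simp add: convergent_denom_eq)
qed

lemma convergent_denom_pos: "convergent_denom \<alpha> n \<ge> 1"
  and convergent_denom_mono: "convergent_denom \<alpha> n \<le> convergent_denom \<alpha> (Suc n)"
  and convergent_coprime: "coprime (cnum (Suc n)) (convergent_denom \<alpha> n)"
  using cden_pos cfrac_den_mono[OF partial_quotient_ge_1] coprime_cnum_cden
  by (simp_all add: convergent_denom_eq)

end

section \<open>Birkhoff sums of the reciprocal distance to the integers\<close>

definition dist_int :: "real \<Rightarrow> real" where
  "dist_int x = \<bar>x - of_int (round x)\<bar>"

lemma dist_int_le: "dist_int x \<le> \<bar>x - of_int m\<bar>"
  unfolding dist_int_def using round_diff_minimal[of x m] by (simp add: abs_minus_commute)

lemma dist_int_nonneg [simp]: "dist_int x \<ge> 0"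
  by (simp add: dist_int_def)

lemma dist_int_pos_iff: "dist_int x > 0 \<longleftrightarrow> x \<notin> \<int>"
proof -
  have "x = of_int (round x)" if "x \<in> \<int>"
    using that by (auto elim!: Ints_cases)
  then have "x \<in> \<int> \<longleftrightarrow> x = of_int (round x)" using Ints_of_int by metis
  then show ?thesis by (auto simp: dist_int_def)
qed

definition recip_sum :: "real \<Rightarrow> real \<Rightarrow> nat \<Rightarrow> real" where
  "recip_sum \<alpha> \<beta> N = (\<Sum>k = 1..N. 1 / dist_int (\<beta> + real k * \<alpha>))"

lemma recip_sum_Suc: "recip_sum \<alpha> \<beta> (Suc N) = recip_sum \<alpha> \<beta> N + 1 / dist_int (\<beta> + real (Suc N) * \<alpha>)"
  by (simp add: recip_sum_def)

lemma recip_sum_mono: "M \<le> N \<Longrightarrow> recip_sum \<alpha> \<beta> M \<le> recip_sum \<alpha> \<beta> N"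
  unfolding recip_sum_def by (intro sum_mono2) auto

lemma recip_sum_nonneg: "recip_sum \<alpha> \<beta> N \<ge> 0"
  unfolding recip_sum_def by (intro sum_nonneg) auto

lemma recip_sum_add: "recip_sum \<alpha> \<beta> (M + N) = recip_sum \<alpha> \<beta> M + recip_sum \<alpha> (\<beta> + M * \<alpha>) N"
proof (induction N)
  case (Suc N)
  then show ?case by (simp add: recip_sum_Suc algebra_simps)
qed (simp add: recip_sum_def)

text \<open>Multiplied by \<open>q\<close>, the orbit points nearly follow the residues
  \<open>i + k * p\<close>, which run through all classes modulo \<open>q\<close> since
  \<open>p\<close> is a unit. Point \<open>k\<close> lies within \<open>(j k + 2) / q\<close> of an
  integer: one unit is lost by rounding \<open>\<theta> * q\<close> down, another because
  \<open>k * |q * \<alpha> - p| \<le> 1\<close>. Summing \<open>q / (j + 2)\<close> over all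
  residues gives a harmonic sum without its first term, the origin of the
  \<open>- 1\<close>.\<close>

lemma recip_sum_block:
  fixes q :: nat and p :: int and \<alpha> \<theta> :: real
  assumes q: "q > 0" and cop: "coprime p (int q)" and app: "\<bar>q * \<alpha> - p\<bar> \<le> 1 / q"
    and nz: "\<And>k. dist_int (\<theta> + real k * \<alpha>) > 0"
  shows "recip_sum \<alpha> \<theta> q \<ge> q * (ln q - 1)"
proof -
  define i where "i = \<lfloor>\<theta> * q\<rfloor>"
  define j where "j k = nat ((i + int k * p) mod int q)" for k :: nat
  have inj: "inj_on j {1..q}"
  proof (rule inj_onI)
    fix k k' assume k: "k \<in> {1..q}" "k' \<in> {1..q}" and e: "j k = j k'"
    have "(i + int k * p) mod int q = (i + int k' * p) mod int q"
      using e q by (simp add: j_def eq_nat_nat_iff)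
    then have "int q dvd (i + int k * p) - (i + int k' * p)" by (simp add: mod_eq_dvd_iff)
    also have "(i + int k * p) - (i + int k' * p) = (int k - int k') * p" by (simp add: algebra_simps)
    finally have "int q dvd int k - int k'"
      using cop by (simp add: coprime_dvd_mult_left_iff coprime_commute)
    moreover have "\<bar>int k - int k'\<bar> < int q" using k by auto
    ultimately show "k = k'" using dvd_imp_le_int[of "int k - int k'" "int q"] by fastforce
  qed
  have "j ` {1..q} \<subseteq> {..<q}" using q by (auto simp: j_def nat_less_iff)
  moreover have "card (j ` {1..q}) = card {..<q}" using card_image[OF inj] by simp
  ultimately have img: "j ` {1..q} = {..<q}" by (intro card_subset_eq) auto
  have bound: "dist_int (\<theta> + real k * \<alpha>) \<le> (real (j k) + 2) / q" if k: "k \<in> {1..q}" for k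
  proof -
    define m where "m = (i + int k * p) div int q"
    have jm: "real (j k) = real_of_int i + real k * p - m * q"
    proof -
      have "int (j k) = (i + int k * p) mod int q" using q by (simp add: j_def)
      also have "\<dots> = i + int k * p - m * int q" by (simp add: m_def minus_div_mult_eq_mod)
      finally have "real_of_int (int (j k)) = real_of_int (i + int k * p - m * int q)" by simp
      then show ?thesis by simp
    qed
    have i: "real_of_int i \<le> \<theta> * q" "\<theta> * q < i + 1" by (auto simp: i_def)
    have "\<bar>real k * (q * \<alpha> - p)\<bar> \<le> q * (1 / q)"
      unfolding abs_mult using k app by (intro mult_mono) auto
    then have e: "\<bar>real k * (q * \<alpha> - p)\<bar> \<le> 1" using q by simp
    have "q * (\<theta> + real k * \<alpha> - m) = real (j k) + (\<theta> * q - i) + real k * (q * \<alpha> - p)"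
      unfolding jm by (simp add: algebra_simps)
    then have "\<bar>q * (\<theta> + real k * \<alpha> - m)\<bar> \<le> real (j k) + 2" using i e by linarith
    then have "\<bar>\<theta> + real k * \<alpha> - m\<bar> \<le> (real (j k) + 2) / q"
      using q by (simp add: abs_mult pos_le_divide_eq mult.commute)
    then show ?thesis using dist_int_le[of "\<theta> + real k * \<alpha>" m] by linarith
  qed
  have "ln q - 1 \<le> ln (real (Suc q) + 1) - 1" using q by simp
  also have "\<dots> \<le> harm (Suc q) - 1" using ln_le_harm[of "Suc q"] by simp
  also have "\<dots> = (\<Sum>j<q. 1 / (real j + 2))"
    unfolding harm_altdef sum.lessThan_Suc_shift by (simp add: inverse_eq_divide add.commute)
  finally have "q * (ln q - 1) \<le> q * (\<Sum>j<q. 1 / (real j + 2))" by (intro mult_left_mono) auto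
  also have "\<dots> = (\<Sum>j\<in>j ` {1..q}. q / (real j + 2))" unfolding img by (simp add: sum_distrib_left)
  also have "\<dots> = (\<Sum>k = 1..q. q / (real (j k) + 2))" using inj by (simp add: sum.reindex)
  also have "\<dots> \<le> recip_sum \<alpha> \<theta> q"
    unfolding recip_sum_def
  proof (intro sum_mono)
    fix k assume k: "k \<in> {1..q}"
    have "q / (real (j k) + 2) = 1 / ((real (j k) + 2) / q)" by simp
    also have "\<dots> \<le> 1 / dist_int (\<theta> + real k * \<alpha>)"
      using bound[OF k] nz[of k] q by (intro divide_left_mono mult_pos_pos) auto
    finally show "q / (real (j k) + 2) \<le> 1 / dist_int (\<theta> + real k * \<alpha>)" .
  qed
  finally show ?thesis .
qed

text \<open>The block estimate is uniform in the starting point, so it applies to each of the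
  \<open>N div q\<close> consecutive full blocks. The incomplete last block is dropped, which loses
  at most half of the indices.\<close>

lemma recip_sum_lower:
  fixes q :: nat and p :: int and \<alpha> \<beta> :: real
  assumes q: "q > 0" and cop: "coprime p (int q)" and app: "\<bar>q * \<alpha> - p\<bar> \<le> 1 / q"
    and nz: "\<And>k. dist_int (\<beta> + real k * \<alpha>) > 0" and N: "q \<le> N" and ln: "ln q \<ge> 1"
  shows "recip_sum \<alpha> \<beta> N \<ge> N / 2 * (ln q - 1)"
proof -
  have *: "recip_sum \<alpha> \<beta> (m * q) \<ge> real (m * q) * (ln q - 1)" for m
  proof (induction m)
    case (Suc m)
    have "recip_sum \<alpha> (\<beta> + real (m * q) * \<alpha>) q \<ge> q * (ln q - 1)"
    proof (rule recip_sum_block[OF q cop app])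
      fix k show "dist_int (\<beta> + real (m * q) * \<alpha> + real k * \<alpha>) > 0"
        using nz[of "m * q + k"] by (simp add: algebra_simps)
    qed
    then show ?case using Suc recip_sum_add[of \<alpha> \<beta> "m * q" q] by (simp add: algebra_simps)
  qed (simp add: recip_sum_def)
  define m where "m = N div q"
  have m1: "m \<ge> 1" using N q by (simp add: m_def div_greater_zero_iff Suc_le_eq)
  have "N = m * q + N mod q" by (simp add: m_def)
  moreover have "N mod q < q" using q by simp
  moreover have "q \<le> m * q" using m1 by simp
  ultimately have "N \<le> 2 * (m * q)" by linarith
  then have "real N \<le> real (2 * (m * q))" by (rule of_nat_mono)
  then have "N / 2 * (ln q - 1) \<le> real (m * q) * (ln q - 1)"
    using ln by (intro mult_right_mono) auto
  also have "\<dots> \<le> recip_sum \<alpha> \<beta> (m * q)" by (rule *)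
  also have "\<dots> \<le> recip_sum \<alpha> \<beta> N" by (rule recip_sum_mono) (simp add: m_def)
  finally show ?thesis .
qed

section \<open>Measure of the shifts with unusually close approaches\<close>

definition near_int :: "int \<Rightarrow> real \<Rightarrow> real \<Rightarrow> real set" where
  "near_int l x \<rho> = {\<beta> \<in> {of_int l..of_int l + 1}. \<exists>m::int. \<bar>\<beta> + x - of_int m\<bar> < \<rho>}"

lemma near_intI: "\<beta> \<in> {of_int l..of_int l + 1} \<Longrightarrow> dist_int (\<beta> + x) < \<rho> \<Longrightarrow> \<beta> \<in> near_int l x \<rho>"
  by (auto simp: near_int_def dist_int_def)

lemma near_int_eq: "near_int l x \<rho> = {of_int l..of_int l + 1} \<inter> (\<Union>m::int. {of_int m - x - \<rho><..<of_int m - x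
    + \<rho>})"
  by (auto simp: near_int_def abs_less_iff algebra_simps)

lemma near_int_measurable [measurable]: "near_int l x \<rho> \<in> sets borel"
  unfolding near_int_eq by measurable

text \<open>Shifts are confined to a unit interval to keep measures finite; countably many
  \<open>l\<close> recover the line. For \<open>\<rho> \<le> 1 / 2\<close> only three integers can
  be approached from there, each through an interval of length \<open>2 * \<rho>\<close>; for larger
  \<open>\<rho>\<close> the whole interval has measure 1, which is below the bound.\<close>

lemma measure_near_int:
  assumes "\<rho> \<ge> 0"
  shows "measure lborel (near_int l x \<rho>) \<le> 6 * \<rho>"
proof (cases "\<rho> \<le> 1 / 2")
  case False
  have "measure lborel (near_int l x \<rho>) \<le> measure lborel {real_of_int l..of_int l + 1}"
    by (intro measure_mono_fmeasurable) (auto simp: near_int_def fmeasurable_def)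
  then show ?thesis using False by simp
next
  case True
  define f where "f = \<lfloor>of_int l + x\<rfloor>"
  define I where "I m = {real_of_int m - x - \<rho><..<of_int m - x + \<rho>}" for m :: int
  have f: "of_int f \<le> of_int l + x" "of_int l + x < of_int f + 1" by (auto simp: f_def)
  have "near_int l x \<rho> \<subseteq> (\<Union>m\<in>{f, f + 1, f + 2}. I m)"
  proof
    fix \<beta> assume "\<beta> \<in> near_int l x \<rho>"
    then obtain m where b: "of_int l \<le> \<beta>" "\<beta> \<le> of_int l + 1" "\<bar>\<beta> + x - of_int m\<bar> < \<rho>"
      by (auto simp: near_int_def)
    have "real_of_int m > of_int f - 1 / 2" "real_of_int m < of_int f + 5 / 2" using b f True by linarith+
    then have "real_of_int m > real_of_int (f - 1)" "real_of_int m < real_of_int (f + 3)" by linarith+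
    then have "m \<in> {f, f + 1, f + 2}" by (simp only: of_int_less_iff) auto
    moreover have "\<beta> \<in> I m" using b by (auto simp: I_def)
    ultimately show "\<beta> \<in> (\<Union>m\<in>{f, f + 1, f + 2}. I m)" by blast
  qed
  then have "measure lborel (near_int l x \<rho>) \<le> measure lborel (\<Union>m\<in>{f, f + 1, f + 2}. I m)"
    by (intro measure_mono_fmeasurable fmeasurable.finite_UN) (use assms in \<open>auto simp: I_def
        fmeasurable_def\<close>)
  also have "\<dots> \<le> (\<Sum>m\<in>{f, f + 1, f + 2}. measure lborel (I m))"
    by (intro measure_UNION_le) (auto simp: I_def)
  also have "\<dots> = 6 * \<rho>" using assms by (simp add: I_def)
  finally show ?thesis .
qed

lemma fmeasurable_near_int: "near_int l x \<rho> \<in> fmeasurable lborel"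
proof (rule fmeasurableI2)
  show "near_int l x \<rho> \<subseteq> {of_int l..of_int l + 1}" by (auto simp: near_int_def)
qed (auto simp: fmeasurable_def)

lemma measure_UN_near_int:
  fixes \<rho> :: real
  assumes "finite K" "(\<rho> :: real) \<ge> 0"
  shows "measure lborel (\<Union>k\<in>K. near_int l (x k) \<rho>) \<le> card K * (6 * \<rho>)"
proof -
  have "measure lborel (\<Union>k\<in>K. near_int l (x k) \<rho>) \<le> (\<Sum>k\<in>K. measure lborel (near_int l (x k) \<rho>))"
    by (rule measure_UNION_le[OF assms(1)]) auto
  also have "\<dots> \<le> (\<Sum>k\<in>K. 6 * \<rho>)" by (intro sum_mono measure_near_int assms)
  finally show ?thesis by simp
qed

text \<open>Up to time \<open>\<theta> * q'\<close> the orbit stays \<open>\<theta> / q\<close>-close to its first \<open>q\<close> points, so the early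
  neighbourhoods overlap; the later ones have tiny radius, so counting them suffices.\<close>

lemma measure_close_approaches:
  fixes q q' :: nat and p :: int and \<alpha> \<theta> \<eta> :: real
  assumes q: "0 < q" "0 < q'" and app: "\<bar>q * \<alpha> - p\<bar> \<le> 1 / q'" and pos: "\<theta> > 0" "\<eta> > 0"
  shows "measure lborel (\<Union>k\<in>{q<..q'}. near_int l (k * \<alpha>) (\<eta> / k)) \<le> 6 * (\<eta> + \<theta> + \<eta> / \<theta>)"
proof -
  define U where "U = (\<Union>j\<in>{1..q}. near_int l (real j * \<alpha>) ((\<eta> + \<theta>) / q))"
  define V where "V = (\<Union>k\<in>{1..q'}. near_int l (real k * \<alpha>) (\<eta> / (\<theta> * q')))"
  have fm: "U \<in> fmeasurable lborel" "V \<in> fmeasurable lborel"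
    unfolding U_def V_def by (intro fmeasurable.finite_UN fmeasurable_near_int; simp)+
  have "(\<Union>k\<in>{q<..q'}. near_int l (k * \<alpha>) (\<eta> / k)) \<subseteq> U \<union> V"
  proof
    fix \<beta> assume "\<beta> \<in> (\<Union>k\<in>{q<..q'}. near_int l (k * \<alpha>) (\<eta> / k))"
    then obtain k m where k: "q < k" "k \<le> q'" and bl: "\<beta> \<in> {of_int l..of_int l + 1}"
      and m: "\<bar>\<beta> + k * \<alpha> - of_int m\<bar> < \<eta> / k" by (auto simp: near_int_def)
    show "\<beta> \<in> U \<union> V"
    proof (cases "k \<le> \<theta> * q'")
      case True
      \<comment> \<open>Dividing \<open>k - 1\<close> instead of \<open>k\<close> puts the index
        \<open>j\<close> into \<open>{1..q}\<close>. After \<open>n\<close> rounds of length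
        \<open>q\<close> the orbit has drifted by \<open>n * |q * \<alpha> - p|\<close>, at most
        \<open>n / q'\<close>, and \<open>n * q \<le> k \<le> \<theta> * q'\<close> turns this into
        \<open>\<theta> / q\<close>.\<close>
      define n where "n = (k - 1) div q"
      define j where "j = (k - 1) mod q + 1"
      have kk: "k = j + n * q" using k by (simp add: n_def j_def)
      have j: "j \<in> {1..q}" using q by (auto simp: j_def Suc_le_eq)
      have "\<bar>real n * (q * \<alpha> - p)\<bar> \<le> real n * (1 / q')"
        unfolding abs_mult using app by (intro mult_mono) auto
      also have "\<dots> \<le> \<theta> / q"
      proof -
        have "real n * q \<le> k" unfolding kk by simp
        also have "\<dots> \<le> \<theta> * q'" by (rule True)
        finally show ?thesis using q by (simp add: field_simps)
      qed
      finally have 1: "\<bar>real n * (q * \<alpha> - p)\<bar> \<le> \<theta> / q" .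
      have 2: "\<eta> / k \<le> \<eta> / q" using k q pos by (intro divide_left_mono) auto
      have "\<beta> + j * \<alpha> - of_int (m - n * p) = (\<beta> + k * \<alpha> - of_int m) - real n * (q * \<alpha> - p)"
        unfolding kk by (simp add: algebra_simps)
      then have "\<bar>\<beta> + j * \<alpha> - of_int (m - n * p)\<bar> < (\<eta> + \<theta>) / q"
        using 1 2 m unfolding add_divide_distrib by linarith
      then have "\<beta> \<in> near_int l (real j * \<alpha>) ((\<eta> + \<theta>) / q)" using bl unfolding near_int_def by blast
      then show ?thesis using j unfolding U_def by blast
    next
      case False
      then have "\<eta> / k \<le> \<eta> / (\<theta> * q')" using k q pos by (intro divide_left_mono) auto
      then have "\<beta> \<in> near_int l (real k * \<alpha>) (\<eta> / (\<theta> * q'))" using m bl unfolding near_int_def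
          by (auto intro: less_le_trans)
      moreover have "k \<in> {1..q'}" using k by auto
      ultimately show ?thesis unfolding V_def by blast
    qed
  qed
  then have "measure lborel (\<Union>k\<in>{q<..q'}. near_int l (k * \<alpha>) (\<eta> / k)) \<le> measure lborel (U \<union> V)"
    using fm by (intro measure_mono_fmeasurable) auto
  also have "\<dots> \<le> measure lborel U + measure lborel V" using fm by (intro measure_Un_le) auto
  also have "\<dots> \<le> card {1..q} * (6 * ((\<eta> + \<theta>) / q)) + card {1..q'} * (6 * (\<eta> / (\<theta> * q')))"
    unfolding U_def V_def using pos by (intro add_mono measure_UN_near_int) auto
  also have "\<dots> = 6 * (\<eta> + \<theta> + \<eta> / \<theta>)" using q pos by (simp add: field_simps)
  finally show ?thesis .
qed

text \<open>The first clause includes negative \<open>k\<close> because antiderivatives are taken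
  along the whole two-sided line, which must avoid the stopping points; the other clauses concern
  forward time only. The last one compares the newest term with the sum of all earlier ones.\<close>

definition trimmed_shift :: "real \<Rightarrow> real \<Rightarrow> bool" where
  "trimmed_shift \<alpha> \<beta> \<longleftrightarrow> (\<forall>k::int. dist_int (\<beta> + of_int k * \<alpha>) > 0) \<and>
     (\<lambda>N. real N / recip_sum \<alpha> \<beta> N) \<longlonglongrightarrow> 0 \<and>
     (\<lambda>N. 1 / dist_int (\<beta> + real (Suc N) * \<alpha>) / recip_sum \<alpha> \<beta> N) \<longlonglongrightarrow> 0"

lemma nat_between_consecutive:
  fixes D :: "nat \<Rightarrow> nat"
  assumes "filterlim D at_top sequentially" "D n0 \<le> N"
  obtains n where "n \<ge> n0" "D n \<le> N" "N < D (Suc n)"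
proof -
  from assms(1) have "eventually (\<lambda>n. Suc N \<le> D n) sequentially"
    unfolding filterlim_at_top by blast
  then obtain n1 where "\<And>n. n \<ge> n1 \<Longrightarrow> N < D n"
    unfolding eventually_sequentially by (auto simp: Suc_le_eq)
  then have ex: "N < D (n0 + n1)" by simp
  define m where "m = (LEAST m. N < D (n0 + m))"
  have m: "N < D (n0 + m)" unfolding m_def by (rule LeastI[of _ n1]) (rule ex)
  have "m \<noteq> 0" using m assms(2) by (cases m) auto
  then obtain m' where m': "m = Suc m'" by (cases m) auto
  have "\<not> N < D (n0 + m')" using not_less_Least[of m' "\<lambda>m. N < D (n0 + m)"] m' by (simp add: m_def[symmetric])
  then show ?thesis using m m' that[of "n0 + m'"] by auto
qed

lemma AE_off_orbit: "AE \<beta> in lborel. \<forall>k::int. dist_int (\<beta> + of_int k * \<alpha>) > 0"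
proof -
  have "AE \<beta> in lborel. \<beta> \<noteq> of_int m - of_int k * \<alpha>" for k m :: int
    by (rule AE_lborel_singleton)
  then have "AE \<beta> in lborel. \<forall>k m :: int. \<beta> \<noteq> of_int m - of_int k * \<alpha>"
    by (simp add: AE_all_countable)
  then show ?thesis
  proof eventually_elim
    case (elim \<beta>)
    show ?case unfolding dist_int_pos_iff
    proof (intro allI notI)
      fix k :: int assume "\<beta> + of_int k * \<alpha> \<in> \<int>"
      then obtain m where "\<beta> + of_int k * \<alpha> = of_int m" by (auto elim: Ints_cases)
      then show False using elim by (auto simp: algebra_simps)
    qed
  qed
qed

lemma trimmed_shift_AE:
  fixes D :: "nat \<Rightarrow> nat" and A :: "nat \<Rightarrow> int" and C \<gamma> \<alpha> :: real
  assumes pos: "\<And>n. D n > 0" and mono: "\<And>n. D n \<le> D (Suc n)"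
    and cop: "\<And>n. coprime (A n) (int (D n))"
    and app: "\<And>n. \<bar>D n * \<alpha> - A n\<bar> \<le> 1 / D (Suc n)"
    and C: "C > 0" and \<gamma>: "\<gamma> > 0"
    and growth: "\<And>n. D n \<ge> C * exp (real n powr (2 + \<gamma>))"
  shows "AE \<beta> in lborel. trimmed_shift \<alpha> \<beta>"
proof -
  define L where "L n = ln (real (D n))" for n
  \<comment> \<open>The midpoint between \<open>2 / (2 + \<gamma>)\<close> and 1. Above the lower
    end the measures of the bad sets are summable; below the upper end
    \<open>L n powr (\<tau> - 1)\<close> tends to 0.\<close>
  define \<tau> where "\<tau> = (4 + \<gamma>) / (4 + 2 * \<gamma>)"
  have \<tau>: "0 < \<tau>" "\<tau> < 1" "(2 + \<gamma>) * (\<tau> / 2) = 1 + \<gamma> / 4"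
    using \<gamma> unfolding \<tau>_def by (simp_all add: divide_simps) (simp add: algebra_simps)?
  have app': "\<bar>D n * \<alpha> - A n\<bar> \<le> 1 / D n" for n
  proof -
    have "1 / real (D (Suc n)) \<le> 1 / D n" using pos[of n] mono[of n] by (intro divide_left_mono) auto
    then show ?thesis using app[of n] by linarith
  qed
  have "filterlim (\<lambda>n. real n powr (2 + \<gamma>)) at_top sequentially"
    using \<gamma> by real_asymp
  \<comment> \<open>For \<open>x \<ge> - 2 * ln C\<close> one has
    \<open>ln C + x \<ge> x / 2\<close>, which absorbs the constant of the growth hypothesis;
    \<open>x \<ge> 2\<close> then gives \<open>L n \<ge> 1\<close>.\<close>
  then have "eventually (\<lambda>n. real n powr (2 + \<gamma>) \<ge> max (- 2 * ln C) 2) sequentially"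
    unfolding filterlim_at_top by blast
  then have ev1: "eventually (\<lambda>n. L n \<ge> 1 / 2 * real n powr (2 + \<gamma>) \<and> L n \<ge> 1) sequentially"
  proof eventually_elim
    case (elim n)
    have "ln (C * exp (real n powr (2 + \<gamma>))) \<le> L n"
      unfolding L_def using growth[of n] C pos[of n] by (subst ln_le_cancel_iff) auto
    then have "ln C + real n powr (2 + \<gamma>) \<le> L n" using C by (simp add: ln_mult)
    then show ?case using elim by auto
  qed
  have Ltop: "filterlim L at_top sequentially"
  proof (rule filterlim_at_top_mono)
    show "filterlim (\<lambda>n. 1 / 2 * real n powr (2 + \<gamma>)) at_top sequentially"
      using \<gamma> by real_asymp
    show "\<forall>\<^sub>F n in sequentially. 1 / 2 * real n powr (2 + \<gamma>) \<le> L n"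
      using ev1 by (rule eventually_mono) simp
  qed
  have Dtop: "filterlim D at_top sequentially"
  proof -
    have "filterlim (\<lambda>n. real (D n)) at_top sequentially"
    proof (rule filterlim_at_top_mono[OF Ltop])
      show "\<forall>\<^sub>F n in sequentially. L n \<le> real (D n)"
      proof (intro always_eventually allI)
        fix n show "L n \<le> real (D n)"
          using ln_le_minus_one[of "real (D n)"] pos[of n] by (simp add: L_def)
      qed
    qed
    then show ?thesis by (rule filterlim_sequentially_iff_filterlim_real[THEN iffD2])
  qed
  define B where "B l n = (\<Union>k\<in>{D n<..D (Suc n)}. near_int l (k * \<alpha>) (L n powr - \<tau> / k))" for l n
  have Bm: "B l n \<in> fmeasurable lborel" for l n
    unfolding B_def by (intro fmeasurable.finite_UN fmeasurable_near_int) auto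
  have meas: "\<forall>\<^sub>F n in sequentially. norm (measure lborel (B l n)) \<le> 18 * 2 powr (\<tau> / 2) * real n powr (- (1
      + \<gamma> / 4))" for l
    using ev1 eventually_gt_at_top[of 0]
  proof eventually_elim
    case (elim n)
    \<comment> \<open>The square root of \<open>L n powr - \<tau>\<close>, for which the two
      competing terms \<open>\<theta>\<close> and \<open>L n powr - \<tau> / \<theta>\<close>
      coincide.\<close>
    define \<theta> where "\<theta> = L n powr (- \<tau> / 2)"
    have L1: "L n \<ge> 1" using elim by simp
    have th: "\<theta> > 0" "L n powr - \<tau> = \<theta> * \<theta>" "\<theta> \<le> 1"
      using L1 \<tau> powr_mono[of "- \<tau> / 2" 0 "L n"] by (simp_all add: \<theta>_def powr_add[symmetric])
    have "measure lborel (B l n) \<le> 6 * (L n powr - \<tau> + \<theta> + L n powr - \<tau> / \<theta>)"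
      unfolding B_def using measure_close_approaches[OF pos pos app, of \<theta> "L n powr - \<tau>"] th(1) L1 by simp
    also have "\<dots> \<le> 18 * \<theta>" using th mult_left_mono[of \<theta> 1 \<theta>] by simp
    also have "\<theta> \<le> (1 / 2 * real n powr (2 + \<gamma>)) powr (- \<tau> / 2)"
      unfolding \<theta>_def using elim \<tau> by (intro powr_mono2') auto
    also have "\<dots> = (1 / 2) powr (- \<tau> / 2) * (real n powr (2 + \<gamma>)) powr (- \<tau> / 2)"
      by (rule powr_mult)
    also have "(real n powr (2 + \<gamma>)) powr (- \<tau> / 2) = real n powr (- (1 + \<gamma> / 4))"
      unfolding powr_powr \<tau>(3)[symmetric] by simp
    also have "(1 / 2) powr (- \<tau> / 2) = (2::real) powr (\<tau> / 2)" by (simp add: powr_divide powr_minus_divide)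
    finally show ?case by simp
  qed
  have summ: "summable (\<lambda>n. measure lborel (B l n))" for l
  proof (rule summable_comparison_test_ev[OF meas])
    show "summable (\<lambda>n. 18 * 2 powr (\<tau> / 2) * real n powr (- (1 + \<gamma> / 4)))"
      using \<gamma> by (intro summable_mult) (simp add: summable_real_powr_iff)
  qed
  have "AE \<beta> in lborel. eventually (\<lambda>n. \<beta> \<in> space lborel - B l n) sequentially" for l
    using Bm by (intro borel_cantelli_AE1 summ) (auto simp: fmeasurable_def)
  then have "AE \<beta> in lborel. \<forall>l. eventually (\<lambda>n. \<beta> \<notin> B l n) sequentially"
    by (simp add: AE_all_countable)
  with AE_off_orbit[of \<alpha>] show ?thesis
  proof eventually_elim
    case (elim \<beta>)
    have nz: "dist_int (\<beta> + real k * \<alpha>) > 0" for k :: nat using elim(1)[rule_format, of "int k"] by simp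
    have L2: "\<forall>\<^sub>F n in sequentially. 2 \<le> L n" using Ltop unfolding filterlim_at_top by blast
    have "eventually (\<lambda>n. \<beta> \<notin> B \<lfloor>\<beta>\<rfloor> n) sequentially" using elim by blast
    then have key: "\<forall>\<^sub>F n in sequentially. \<forall>N. D n \<le> N \<and> N < D (Suc n) \<longrightarrow>
       real N / recip_sum \<alpha> \<beta> N \<le> 4 / L n \<and>
       1 / dist_int (\<beta> + real (Suc N) * \<alpha>) / recip_sum \<alpha> \<beta> N \<le> 8 * L n powr (\<tau> - 1)"
      using L2
    proof eventually_elim
      case (elim n)
      show ?case
      proof (intro allI impI)
        fix N assume N': "D n \<le> N \<and> N < D (Suc n)"
        then have N: "D n \<le> N" "N < D (Suc n)" by auto
        have N0: "N > 0" using N pos[of n] by linarith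
        have "N / 2 * (L n - 1) \<le> recip_sum \<alpha> \<beta> N"
          using recip_sum_lower[OF pos cop app' nz N(1)] elim by (simp add: L_def)
        moreover have "N / 2 * (L n / 2) \<le> N / 2 * (L n - 1)" using elim by (intro mult_left_mono) auto
        ultimately have S: "N * L n / 4 \<le> recip_sum \<alpha> \<beta> N" by linarith
        have S0: "N * L n / 4 > 0" using N0 elim by simp
        have "N / recip_sum \<alpha> \<beta> N \<le> N / (N * L n / 4)" using S S0 by (intro divide_left_mono) auto
        then have 1: "N / recip_sum \<alpha> \<beta> N \<le> 4 / L n" using N0 by simp
        have "\<beta> \<in> {of_int \<lfloor>\<beta>\<rfloor>..of_int \<lfloor>\<beta>\<rfloor> + 1}" by auto
        \<comment> \<open>The term to be controlled has the next index \<open>Suc N\<close>, and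
          \<open>D n \<le> N < D (Suc n)\<close> places \<open>Suc N\<close> in the window
          \<open>{D n<..D (Suc n)}\<close>; this is why the windows in \<open>B\<close> are open on
          the left.\<close>
        moreover have "\<beta> \<notin> near_int \<lfloor>\<beta>\<rfloor> (Suc N * \<alpha>) (L n powr - \<tau> / Suc N)"
        proof -
          have "Suc N \<in> {D n<..D (Suc n)}" using N by auto
          then show ?thesis using elim(1) unfolding B_def by blast
        qed
        ultimately have d: "dist_int (\<beta> + Suc N * \<alpha>) \<ge> L n powr - \<tau> / Suc N"
          using near_intI by (meson not_le)
        have "1 / dist_int (\<beta> + Suc N * \<alpha>) \<le> 1 / (L n powr - \<tau> / Suc N)"
          using d elim nz[of "Suc N"] by (intro divide_left_mono) auto
        also have "\<dots> = Suc N * L n powr \<tau>" using elim by (simp add: powr_minus field_simps)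
        also have "\<dots> \<le> (2 * N) * L n powr \<tau>" using N0 by (intro mult_right_mono) auto
        finally have "1 / dist_int (\<beta> + Suc N * \<alpha>) / recip_sum \<alpha> \<beta> N \<le> (2 * N) * L n powr \<tau> / (N * L n / 4)"
          using S S0 by (intro frac_le) auto
        also have "\<dots> = 8 * (L n powr \<tau> / L n)" using N0 by (simp add: field_simps)
        also have "L n powr \<tau> / L n = L n powr (\<tau> - 1)" using elim by (simp add: powr_diff)
        finally show "real N / recip_sum \<alpha> \<beta> N \<le> 4 / L n \<and>
         1 / dist_int (\<beta> + real (Suc N) * \<alpha>) / recip_sum \<alpha> \<beta> N \<le> 8 * L n powr (\<tau> - 1)"
          using 1 by simp
      qed
    qed
    \<comment> \<open>Both ratios are bounded on the whole block of \<open>N\<close> from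
      \<open>D n\<close> up to \<open>D (Suc n)\<close> by a quantity depending on \<open>n\<close>
      alone. These blocks cover all large \<open>N\<close>, so convergence in \<open>n\<close>
      passes to \<open>N\<close>.\<close>
    have lim: "f \<longlonglongrightarrow> 0"
      if r: "r \<longlonglongrightarrow> 0" and f0: "\<And>N. f N \<ge> 0"
        and fr: "\<forall>\<^sub>F n in sequentially. \<forall>N. D n \<le> N \<and> N < D (Suc n) \<longrightarrow> f N \<le> r n" for f r :: "nat \<Rightarrow> real"
    proof (rule LIMSEQ_I)
      fix e :: real assume "e > 0"
      then have "eventually (\<lambda>n. r n < e) sequentially" using r by (simp add: order_tendsto_iff)
      then have "\<forall>\<^sub>F n in sequentially. \<forall>N. D n \<le> N \<and> N < D (Suc n) \<longrightarrow> f N < e"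
        using fr by eventually_elim fastforce
      then obtain n0 where n0: "\<And>n N. n \<ge> n0 \<Longrightarrow> D n \<le> N \<Longrightarrow> N < D (Suc n) \<Longrightarrow> f N < e"
        unfolding eventually_sequentially by blast
      show "\<exists>no. \<forall>N\<ge>no. norm (f N - 0) < e"
      proof (intro exI[of _ "D n0"] allI impI)
        fix N assume "N \<ge> D n0"
        then obtain n where "n \<ge> n0" "D n \<le> N" "N < D (Suc n)"
          using nat_between_consecutive[OF Dtop, of n0 N] by blast
        then show "norm (f N - 0) < e" using n0[of n N] f0[of N] by simp
      qed
    qed
    have r1: "(\<lambda>n. 4 / L n) \<longlonglongrightarrow> 0"
      by (rule tendsto_divide_0[OF tendsto_const filterlim_at_top_imp_at_infinity[OF Ltop]])
    have r2: "(\<lambda>n. 8 * L n powr (\<tau> - 1)) \<longlonglongrightarrow> 0"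
      using tendsto_mult_right_zero[OF tendsto_neg_powr[OF _ Ltop, of "\<tau> - 1"], of 8] \<tau> by simp
    have l1: "(\<lambda>N. real N / recip_sum \<alpha> \<beta> N) \<longlonglongrightarrow> 0"
      by (rule lim[OF r1 _ eventually_mono[OF key]]) (simp_all add: recip_sum_nonneg)
    have l2: "(\<lambda>N. 1 / dist_int (\<beta> + real (Suc N) * \<alpha>) / recip_sum \<alpha> \<beta> N) \<longlonglongrightarrow> 0"
      by (rule lim[OF r2 _ eventually_mono[OF key]]) (simp_all add: recip_sum_nonneg)
    show ?case using elim(1) l1 l2 unfolding trimmed_shift_def by blast
  qed
qed

section \<open>Passage times near a nondegenerate minimum\<close>

locale definite_form =
  fixes A B C :: real
  assumes A_pos: "A > 0" and disc_pos: "A * C - B\<^sup>2 > 0"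
begin

definition form :: "real \<Rightarrow> real \<Rightarrow> real" where
  "form w s = A * w\<^sup>2 + 2 * B * w * s + C * s\<^sup>2"

definition root_disc :: real where
  "root_disc = sqrt (A * C - B\<^sup>2)"

lemma root_disc_pos: "root_disc > 0"
  using disc_pos by (simp add: root_disc_def)

text \<open>Completing the square in \<open>w\<close>: for fixed \<open>s\<close> the reciprocal of
  the form has an arctangent primitive with scale \<open>root_disc * |s|\<close>.\<close>

lemma form_eq: "A * form w s = (A * w + B * s)\<^sup>2 + (root_disc * \<bar>s\<bar>)\<^sup>2"
proof -
  have "root_disc\<^sup>2 = A * C - B\<^sup>2" using disc_pos by (simp add: root_disc_def)
  then have "(root_disc * \<bar>s\<bar>)\<^sup>2 = (A * C - B\<^sup>2) * s\<^sup>2" by (simp add: power_mult_distrib)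
  then show ?thesis by (simp add: form_def algebra_simps power2_eq_square)
qed

lemma form_pos:
  assumes "w \<noteq> 0 \<or> s \<noteq> 0"
  shows "form w s > 0"
proof -
  have "A * form w s > 0"
  proof (cases "s = 0")
    case True then show ?thesis unfolding form_eq using assms A_pos by simp
  next
    case False then show ?thesis unfolding form_eq using root_disc_pos by (intro add_nonneg_pos) auto
  qed
  then show ?thesis using A_pos zero_less_mult_pos by blast
qed

text \<open>Closed form of the integral of \<open>1 / form w s\<close> over \<open>w\<close> in
  \<open>{-1/2..1/2}\<close>. As \<open>s\<close> tends to 0 both arctangents tend to
  \<open>pi / 2\<close>, leaving \<open>pi / (root_disc * |s|)\<close>.\<close>

definition form_int :: "real \<Rightarrow> real" where
  "form_int s = (arctan ((A / 2 + B * s) / (root_disc * \<bar>s\<bar>)) + arctan ((A / 2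
      - B * s) / (root_disc * \<bar>s\<bar>))) / (root_disc * \<bar>s\<bar>)"

lemma form_has_integral:
  assumes "s \<noteq> 0"
  shows "((\<lambda>w. 1 / form w s) has_integral form_int s) {-1/2..1/2}"
proof -
  define R where "R = root_disc * \<bar>s\<bar>"
  have R: "R > 0" using assms root_disc_pos by (simp add: R_def)
  have "((\<lambda>w. 1 / form w s) has_integral (arctan ((A * (1/2) + B * s) / R) / R - arctan ((A * (-1/2)
      + B * s) / R) / R)) {-1/2..1/2}"
  proof (rule fundamental_theorem_of_calculus)
    fix w :: real
    have "((\<lambda>w. arctan ((A * w + B * s) / R) / R) has_real_derivative (A / R) / (1 + ((A * w
        + B * s) / R)\<^sup>2) / R) (at w)"
      using R by (auto intro!: derivative_eq_intros simp: inverse_eq_divide)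
    also have "(A / R) / (1 + ((A * w + B * s) / R)\<^sup>2) / R = A / (R\<^sup>2 + (A * w + B * s)\<^sup>2)"
      using R by (simp add: power_divide power2_eq_square divide_simps)
    also have "R\<^sup>2 + (A * w + B * s)\<^sup>2 = A * form w s" by (simp add: form_eq R_def)
    also have "A / (A * form w s) = 1 / form w s" using A_pos by simp
    finally show "((\<lambda>w. arctan ((A * w + B * s) / R) / R) has_vector_derivative 1 / form w s) (at w within
        {-1/2..1/2})"
      by (simp add: has_real_derivative_iff_has_vector_derivative has_vector_derivative_at_within)
  qed simp
  moreover have "arctan ((A * (-1/2) + B * s) / R) = - arctan ((A / 2 - B * s) / R)"
  proof -
    have "(A * (-1/2) + B * s) / R = - ((A / 2 - B * s) / R)" using R by (simp add: field_simps)
    then show ?thesis by (simp only: arctan_minus)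
  qed
  ultimately show ?thesis by (simp add: form_int_def R_def[symmetric] add_divide_distrib)
qed

lemma form_int_le: "s \<noteq> 0 \<Longrightarrow> form_int s \<le> pi / root_disc / \<bar>s\<bar>"
  using arctan_ubound[of "(A / 2 + B * s) / (root_disc * \<bar>s\<bar>)"] arctan_ubound[of "(A / 2
      - B * s) / (root_disc * \<bar>s\<bar>)"]
    root_disc_pos by (simp add: form_int_def divide_right_mono)

lemma form_int_nonneg: "s \<noteq> 0 \<Longrightarrow> form_int s \<ge> 0"
  using has_integral_nonneg[OF form_has_integral[of s]] form_pos[of _ s] by (simp add: less_imp_le)

lemma form_int_asymp: "((\<lambda>s. form_int s * \<bar>s\<bar>) \<longlongrightarrow> pi / root_disc) (at 0)"
proof -
  have "((\<lambda>s. arctan ((A / 2 + b * s) / (root_disc * \<bar>s\<bar>))) \<longlongrightarrow> pi / 2) (at 0)" for b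
  proof (rule filterlim_compose[OF tendsto_arctan_at_top LIM_at_top_divide])
    show "((\<lambda>s. A / 2 + b * s) \<longlongrightarrow> A / 2) (at 0)" by (auto intro!: tendsto_eq_intros)
    show "((\<lambda>s. root_disc * \<bar>s\<bar>) \<longlongrightarrow> 0) (at 0)" by (auto intro!: tendsto_eq_intros)
    show "\<forall>\<^sub>F s in at 0. 0 < root_disc * \<bar>s\<bar>" using root_disc_pos by (simp add: eventually_at_filter)
  qed (use A_pos in simp)
  from this[of B] this[of "- B"]
  have "((\<lambda>s. (arctan ((A / 2 + B * s) / (root_disc * \<bar>s\<bar>)) + arctan ((A / 2
      - B * s) / (root_disc * \<bar>s\<bar>))) / root_disc) \<longlongrightarrow> (pi / 2 + pi / 2) / root_disc) (at 0)"
    using root_disc_pos by (intro tendsto_intros) auto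
  then show ?thesis
    by (rule Lim_transform_eventually[THEN tendsto_eq_rhs]) (auto simp: eventually_at_filter form_int_def)
qed

text \<open>The limit at 0 is turned into a bound valid for all \<open>s\<close>: it applies as long
  as \<open>|s| < d\<close>, and beyond that both terms lie between 0 and
  \<open>pi / root_disc / d\<close>, a constant that goes into \<open>M\<close>.\<close>

lemma form_int_close:
  assumes "e > 0"
  obtains M where "\<And>s. s \<noteq> 0 \<Longrightarrow> \<bar>form_int s - pi / root_disc / \<bar>s\<bar>\<bar> \<le> e / \<bar>s\<bar> + M"
proof -
  have ev: "\<forall>\<^sub>F s in at 0. dist (form_int s * \<bar>s\<bar>) (pi / root_disc) < e"
    using form_int_asymp assms by (rule tendstoD)
  obtain d where d: "d > 0" "\<And>s. s \<noteq> 0 \<Longrightarrow> \<bar>s\<bar> < d \<Longrightarrow> \<bar>form_int s * \<bar>s\<bar> - pi / root_disc\<bar> < e"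
  proof -
    obtain d where "d > 0" "\<forall>s\<in>UNIV. s \<noteq> 0 \<and> dist s 0 < d \<longrightarrow> dist (form_int s * \<bar>s\<bar>) (pi / root_disc) < e"
      using ev unfolding eventually_at by blast
    then show ?thesis using that[of d] by (simp add: dist_real_def)
  qed
  show ?thesis
  proof (rule that[of "pi / root_disc / d"])
    fix s :: real assume s: "s \<noteq> 0"
    show "\<bar>form_int s - pi / root_disc / \<bar>s\<bar>\<bar> \<le> e / \<bar>s\<bar> + pi / root_disc / d"
    proof (cases "\<bar>s\<bar> < d")
      case True
      have "form_int s - pi / root_disc / \<bar>s\<bar> = (form_int s * \<bar>s\<bar> - pi / root_disc) / \<bar>s\<bar>"
        using s by (simp add: diff_divide_distrib)
      then have "\<bar>form_int s - pi / root_disc / \<bar>s\<bar>\<bar> = \<bar>form_int s * \<bar>s\<bar> - pi / root_disc\<bar> / \<bar>s\<bar>"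
        by (simp only: abs_divide abs_abs)
      also have "\<dots> \<le> e / \<bar>s\<bar>" using d(2)[OF s True] by (intro divide_right_mono) auto
      moreover have "pi / root_disc / d \<ge> 0" using root_disc_pos d(1) by simp
      ultimately show ?thesis by linarith
    next
      case False
      then have "pi / root_disc / \<bar>s\<bar> \<le> pi / root_disc / d"
        using d(1) root_disc_pos s by (intro divide_left_mono) auto
      moreover have "e / \<bar>s\<bar> \<ge> 0" using assms by simp
      ultimately show ?thesis using form_int_le[OF s] form_int_nonneg[OF s] by linarith
    qed
  qed
qed

text \<open>\<open>K\<close> stands for an integrand \<open>f / \<phi>\<close> with its singularity
  at the origin. Near the origin it differs from \<open>\<kappa> / form\<close> by at most
  \<open>e1 / form\<close>; on the rest of the square both are continuous, so their difference is
  bounded by compactness. What matters about \<open>M\<close> is that it does not depend on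
  \<open>s\<close>.\<close>

lemma passage_integral:
  fixes K :: "real \<Rightarrow> real \<Rightarrow> real" and \<kappa> e :: real
  assumes cont: "continuous_on ({-1/2..1/2} \<times> {-1/2..1/2} - {(0, 0)}) (\<lambda>(w, s). K w s)"
    and lim: "((\<lambda>(w, s). K w s * form w s) \<longlongrightarrow> \<kappa>) (at (0, 0))"
    and e: "e > 0"
  obtains M where "\<And>s. s \<in> {-1/2..1/2} \<Longrightarrow> s \<noteq> 0 \<Longrightarrow>
    \<bar>integral {-1/2..1/2} (\<lambda>w. K w s) - \<kappa> * pi / root_disc / \<bar>s\<bar>\<bar> \<le> e / \<bar>s\<bar> + M"
proof -
  define Sq where "Sq = {-1/2..1/2::real} \<times> {-1/2..1/2::real}"
  \<comment> \<open>Half of the error is spent on replacing \<open>K\<close> by the model, as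
    \<open>e1 * pi / root_disc = e / 2\<close>, and half on the asymptotics of the model, as
    \<open>|\<kappa>| * e2 \<le> e / 2\<close>; the \<open>+ 1\<close> in \<open>e2\<close> covers
    \<open>\<kappa> = 0\<close>.\<close>
  define e1 where "e1 = e * root_disc / (2 * pi)"
  have e1: "e1 > 0" using e root_disc_pos by (simp add: e1_def)
  define e2 where "e2 = e / (2 * (\<bar>\<kappa>\<bar> + 1))"
  have e2: "e2 > 0" using e by (simp add: e2_def add_nonneg_pos)
  obtain d where d: "d > 0"
    "\<And>w s. (w, s) \<noteq> (0, 0) \<Longrightarrow> dist (w, s) (0, 0) < d \<Longrightarrow> \<bar>K w s * form w s - \<kappa>\<bar> < e1"
  proof -
    obtain d where "d > 0" "\<forall>x\<in>UNIV. x \<noteq> (0, 0)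
        \<and> dist x (0, 0) < d \<longrightarrow> dist (case x of (w, s) \<Rightarrow> K w s * form w s) \<kappa> < e1"
      using tendstoD[OF lim e1] unfolding eventually_at by blast
    then show ?thesis using that[of d] by (simp only: dist_real_def split_paired_All Ball_def) simp
  qed
  have cf: "continuous_on X (\<lambda>(w, s). form w s)" for X
    unfolding form_def case_prod_beta by (intro continuous_intros)
  define Cp where "Cp = Sq - ball (0, 0) d"
  have "compact Cp" unfolding Cp_def Sq_def by (intro compact_diff compact_Times) auto
  moreover have "continuous_on Cp (\<lambda>x. (case x of (w, s) \<Rightarrow> K w s) - \<kappa> / (case x of (w, s) \<Rightarrow> form w s))"
  proof (intro continuous_intros cf continuous_on_subset[OF cont])
    show "Cp \<subseteq> {- 1 / 2..1 / 2} \<times> {- 1 / 2..1 / 2} - {(0, 0)}" using d(1)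
        by (auto simp: Cp_def Sq_def zero_prod_def)
    show "\<forall>x\<in>Cp. (case x of (w, s) \<Rightarrow> form w s) \<noteq> 0"
    proof
      fix x assume "x \<in> Cp"
      then have "x \<noteq> (0, 0)" using d(1) by (auto simp: Cp_def zero_prod_def)
      then have "form (fst x) (snd x) > 0" by (intro form_pos) (auto simp: prod_eq_iff)
      then show "(case x of (w, s) \<Rightarrow> form w s) \<noteq> 0" by (simp add: case_prod_beta)
    qed
  qed
  ultimately have bdd: "bounded ((\<lambda>x. (case x of (w, s) \<Rightarrow> K w s) - \<kappa> / (case x of (w, s) \<Rightarrow> form w s)) ` Cp)"
    by (intro compact_imp_bounded compact_continuous_image)
  then obtain M1 where M1: "M1 > 0" "\<And>w s. (w, s) \<in> Cp \<Longrightarrow> \<bar>K w s - \<kappa> / form w s\<bar> \<le> M1"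
  proof -
    obtain b where "b > 0" "\<forall>x\<in>Cp. norm ((case x of (w, s) \<Rightarrow> K w s) - \<kappa> / (case x of (w, s) \<Rightarrow> form w s)) \<le> b"
      using bdd unfolding bounded_pos by blast
    then show ?thesis using that[of b] by fastforce
  qed
  obtain M2 where M2: "\<And>s. s \<noteq> 0 \<Longrightarrow> \<bar>form_int s - pi / root_disc / \<bar>s\<bar>\<bar> \<le> e2 / \<bar>s\<bar> + M2"
    using form_int_close[OF e2] by blast
  show ?thesis
  proof (rule that[of "M1 + \<bar>\<kappa>\<bar> * M2"])
    fix s :: real assume s: "s \<in> {-1/2..1/2}" "s \<noteq> 0"
    have point: "norm (K w s - \<kappa> / form w s) \<le> e1 / form w s + M1" if w: "w \<in> {-1/2..1/2}" for w
    proof (cases "(w, s) \<in> Cp")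
      case True
      have "e1 / form w s \<ge> 0" using e1 form_pos[of w s] s by simp
      then show ?thesis using M1(2)[OF True] by simp
    next
      case False
      then have "dist (w, s) (0, 0) < d" using w s by (simp add: Cp_def Sq_def dist_commute zero_prod_def)
      then have b: "\<bar>K w s * form w s - \<kappa>\<bar> < e1" using d(2) s by blast
      have fp: "form w s > 0" using form_pos s by blast
      then have "K w s - \<kappa> / form w s = (K w s * form w s - \<kappa>) / form w s" by (simp add: diff_divide_distrib)
      then have "\<bar>K w s - \<kappa> / form w s\<bar> = \<bar>K w s * form w s - \<kappa>\<bar> / form w s" using fp by simp
      also have "\<dots> \<le> e1 / form w s" using b fp by (intro divide_right_mono) auto
      finally show ?thesis using M1(1) by simp
    qed
    have "continuous_on {-1/2..1/2} (\<lambda>w. case (w, s) of (w, s) \<Rightarrow> K w s)"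
      by (rule continuous_on_compose2[OF cont]) (use s in \<open>auto intro!: continuous_intros\<close>)
    then have Kint: "(\<lambda>w. K w s) integrable_on {-1/2..1/2}" by (intro integrable_continuous_interval) simp
    have 1: "((\<lambda>w. K w s - \<kappa> / form w s) has_integral integral {-1/2..1/2} (\<lambda>w. K w s)
        - \<kappa> * form_int s) {-1/2..1/2}"
      using has_integral_diff[OF integrable_integral[OF Kint] has_integral_mult_right[OF
          form_has_integral[OF s(2)], of \<kappa>]] by simp
    have 2: "((\<lambda>w. e1 / form w s + M1) has_integral e1 * form_int s + M1) {-1/2..1/2}"
      using has_integral_add[OF has_integral_mult_right[OF form_has_integral[OF s(2)], of e1]
          has_integral_const_real[of M1 "-1/2" "1/2"]] by simp
    have "norm (integral {-1/2..1/2} (\<lambda>w. K w s) - \<kappa> * form_int s) \<le> e1 * form_int s + M1"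
      using integral_norm_bound_integral[OF has_integral_integrable[OF 1] has_integral_integrable[OF 2] point]
      unfolding integral_unique[OF 1] integral_unique[OF 2] .
    also have "e1 * form_int s \<le> e1 * (pi / root_disc / \<bar>s\<bar>)"
      using e1 form_int_le[OF s(2)] by (intro mult_left_mono) auto
    also have "e1 * (pi / root_disc / \<bar>s\<bar>) = (e / 2) / \<bar>s\<bar>" using root_disc_pos by (simp add: e1_def)
    finally have 3: "\<bar>integral {-1/2..1/2} (\<lambda>w. K w s) - \<kappa> * form_int s\<bar> \<le> (e / 2) / \<bar>s\<bar> + M1" by simp
    have "\<kappa> * form_int s - \<kappa> * pi / root_disc / \<bar>s\<bar> = \<kappa> * (form_int s - pi / root_disc / \<bar>s\<bar>)"
      by (simp add: right_diff_distrib)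
    then have "\<bar>\<kappa> * form_int s - \<kappa> * pi / root_disc / \<bar>s\<bar>\<bar> = \<bar>\<kappa>\<bar> * \<bar>form_int s - pi / root_disc / \<bar>s\<bar>\<bar>"
      by (simp only: abs_mult)
    also have "\<dots> \<le> \<bar>\<kappa>\<bar> * (e2 / \<bar>s\<bar> + M2)" using M2[OF s(2)] by (intro mult_left_mono) auto
    also have "\<dots> = \<bar>\<kappa>\<bar> * e2 / \<bar>s\<bar> + \<bar>\<kappa>\<bar> * M2" by (simp add: distrib_left)
    also have "\<bar>\<kappa>\<bar> * e2 / \<bar>s\<bar> \<le> (e / 2) / \<bar>s\<bar>"
      using e by (intro divide_right_mono) (auto simp: e2_def field_simps)
    finally show "\<bar>integral {-1/2..1/2} (\<lambda>w. K w s) - \<kappa> * pi / root_disc / \<bar>s\<bar>\<bar> \<le> e / \<bar>s\<bar> + (M1 + \<bar>\<kappa>\<bar> * M2)"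
      using 3 by linarith
  qed
qed

end

section \<open>Growth of occupation times along a line\<close>

lemma filterlim_nat_floor_diff: "filterlim (\<lambda>w::real. nat \<lfloor>w - c\<rfloor>) sequentially at_top"
proof -
  have "filterlim (\<lambda>w::real. - c + w) at_top at_top"
    by (rule filterlim_tendsto_add_at_top[OF tendsto_const filterlim_ident])
  then have "filterlim (\<lambda>w::real. \<lfloor>- c + w\<rfloor>) at_top at_top"
    by (rule filterlim_compose[OF filterlim_floor_sequentially])
  from filterlim_compose[OF filterlim_nat_sequentially this] show ?thesis by simp
qed

locale trimmed_orbit =
  fixes \<alpha> \<beta> :: real
  assumes trimmed: "trimmed_shift \<alpha> \<beta>"
begin

abbreviation "S \<equiv> recip_sum \<alpha> \<beta>"

lemma shift_nonzero: "dist_int (\<beta> + real k * \<alpha>) > 0"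
  using trimmed unfolding trimmed_shift_def by (metis of_int_of_nat_eq)

lemma recip_sum_pos: "N \<ge> 1 \<Longrightarrow> S N > 0"
  using shift_nonzero unfolding recip_sum_def by (intro sum_pos) auto

lemma ratio_recip_sum: "(\<lambda>N. real N / S N) \<longlonglongrightarrow> 0"
  using trimmed by (simp add: trimmed_shift_def)

lemma recip_sum_at_top: "filterlim S at_top sequentially"
proof -
  have "eventually (\<lambda>N. real N / S N < 1) sequentially"
    using ratio_recip_sum by (simp add: order_tendsto_iff)
  then have "eventually (\<lambda>N. real N \<le> S N) sequentially"
    using eventually_ge_at_top[of 1] by eventually_elim (use recip_sum_pos in \<open>fastforce simp: divide_simps\<close>)
  then show ?thesis by (rule filterlim_at_top_mono[OF filterlim_real_sequentially])
qed

text \<open>For one step the quotient is 1 plus the newest term over the sum, and the last clause of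
  \<open>trimmed_shift\<close> sends that term to 0; several steps form a product of such
  quotients.\<close>

lemma recip_sum_step: "(\<lambda>N. S (N + m) / S N) \<longlonglongrightarrow> 1"
proof (induction m)
  case 0
  have "\<forall>\<^sub>F N in sequentially. 1 = S (N + 0) / S N"
    using eventually_ge_at_top[of 1] by eventually_elim (use recip_sum_pos in fastforce)
  then show ?case by (rule Lim_transform_eventually[OF tendsto_const])
next
  case (Suc m)
  have "(\<lambda>N. 1 + 1 / dist_int (\<beta> + real (Suc N) * \<alpha>) / S N) \<longlonglongrightarrow> 1 + 0"
    using trimmed unfolding trimmed_shift_def by (intro tendsto_intros) auto
  moreover have "\<forall>\<^sub>F N in sequentially. 1 + 1 / dist_int (\<beta> + real (Suc N) * \<alpha>) / S N = S (Suc N) / S N"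
    using eventually_ge_at_top[of 1]
  proof eventually_elim
    case (elim N)
    then show ?case using recip_sum_pos[of N] by (simp add: recip_sum_Suc add_divide_distrib)
  qed
  ultimately have one: "(\<lambda>N. S (Suc N) / S N) \<longlonglongrightarrow> 1" by (auto intro: Lim_transform_eventually)
  have "filterlim (\<lambda>N. N + m) sequentially sequentially" by (rule filterlim_add_const_nat_at_top)
  from filterlim_compose[OF one this] have "(\<lambda>N. S (Suc (N + m)) / S (N + m)) \<longlonglongrightarrow> 1" .
  from tendsto_mult[OF this Suc] have "(\<lambda>N. S (Suc (N + m)) / S (N + m) * (S (N + m) / S N)) \<longlonglongrightarrow> 1" by simp
  moreover have "\<forall>\<^sub>F N in sequentially. S (Suc (N + m)) / S (N + m) * (S (N + m) / S N) = S (N + Suc m) / S N"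
    using eventually_ge_at_top[of 1]
  proof eventually_elim
    case (elim N)
    then show ?case using recip_sum_pos[of "N + m"] by simp
  qed
  ultimately show ?case by (rule Lim_transform_eventually)
qed

text \<open>The stopping points are passed at positions that differ by a fixed real shift; this lets
  both be counted by the common \<open>S (nat \<lfloor>w\<rfloor>)\<close>. Monotonicity squeezes
  the ratio between sums whose indices differ by an integer \<open>m > |c|\<close>.\<close>

lemma recip_sum_floor_ratio: "((\<lambda>w::real. S (nat \<lfloor>w - (c :: real)\<rfloor>) / S (nat \<lfloor>w\<rfloor>)) \<longlongrightarrow> 1) at_top"
proof -
  define m where "m = nat \<lceil>\<bar>c\<bar>\<rceil> + 1"
  define a b where "a w = nat \<lfloor>w\<rfloor>" and "b w = nat \<lfloor>w - c\<rfloor>" for w :: real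
  have al: "filterlim a sequentially at_top" using filterlim_nat_floor_diff[of 0]
      by (simp add: a_def[abs_def])
  have bl: "filterlim b sequentially at_top" using filterlim_nat_floor_diff[of c]
      by (simp add: b_def[abs_def])
  have u: "((\<lambda>w. S (a w + m) / S (a w)) \<longlongrightarrow> 1) at_top"
    by (rule filterlim_compose[OF recip_sum_step al])
  have "((\<lambda>w. inverse (S (b w + m) / S (b w))) \<longlongrightarrow> inverse 1) at_top"
    by (intro tendsto_inverse filterlim_compose[OF recip_sum_step bl]) auto
  then have l: "((\<lambda>w. S (b w) / S (b w + m)) \<longlongrightarrow> 1) at_top" by simp
  have ev: "\<forall>\<^sub>F w in at_top. S (b w) / S (b w + m) \<le> S (b w) / S (a w) \<and> S (b w) / S (a w) \<le> S (a w
      + m) / S (a w)"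
    using eventually_ge_at_top[of "\<bar>c\<bar> + 1"]
  proof eventually_elim
    case (elim w)
    have "\<bar>c\<bar> \<le> real (nat \<lceil>\<bar>c\<bar>\<rceil>)" by linarith
    then have "a w \<le> b w + m" "b w \<le> a w + m" "a w \<ge> 1" unfolding a_def b_def m_def using elim by linarith+
    then show ?case using recip_sum_mono[of "a w" "b w + m" \<alpha> \<beta>] recip_sum_mono[of "b w" "a w
        + m" \<alpha> \<beta>] recip_sum_pos[of "a w"]
      recip_sum_nonneg[of \<alpha> \<beta> "b w"]
      by (auto intro!: divide_left_mono divide_right_mono mult_pos_pos)
  qed
  have "((\<lambda>w. S (b w) / S (a w)) \<longlongrightarrow> 1) at_top"
    by (rule tendsto_sandwich[OF _ _ l u]) (use ev in \<open>auto elim: eventually_mono\<close>)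
  then show ?thesis by (simp add: a_def b_def)
qed

text \<open>The line is cut into unit sections centred at \<open>c + k\<close>, each with one
  passage. The section estimates add up to \<open>\<kappa> * S N\<close> with error
  \<open>(e/2) * S N + M * N\<close>, whose second part is absorbed because \<open>N / S N\<close>
  tends to 0. Between the ends of sections \<open>F\<close> is controlled by monotonicity, hence the
  sign condition on \<open>h\<close>, and by the convergence of \<open>S (N + 1) / S N\<close> to
  1.\<close>

lemma line_growth:
  fixes F h G :: "real \<Rightarrow> real" and c \<kappa> :: real
  assumes F: "\<And>v. (F has_real_derivative h v) (at v)" and h: "\<And>v. h v \<ge> 0"
    and sec: "\<And>k::nat. F (c + real k + 1/2) - F (c + real k - 1/2) = G (\<beta> + real k * \<alpha> - round (\<beta>
        + real k * \<alpha>))"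
    and G: "\<And>e. e > 0 \<Longrightarrow> \<exists>M. \<forall>s\<in>{-1/2..1/2}. s \<noteq> 0 \<longrightarrow> \<bar>G s - \<kappa> / \<bar>s\<bar>\<bar> \<le> e / \<bar>s\<bar> + M"
  shows "((\<lambda>w. F w / S (nat \<lfloor>w\<rfloor>)) \<longlongrightarrow> \<kappa>) at_top"
proof -
  \<comment> \<open>The value at the end of section \<open>N\<close>. Differences from
    \<open>J 0\<close> leave out section 0, in accordance with \<open>recip_sum\<close>, which
    starts at index 1.\<close>
  define J where "J N = F (c + 1/2 + real N)" for N :: nat
  have sumJ: "J N - J 0 = (\<Sum>k = 1..N. G (\<beta> + real k * \<alpha> - round (\<beta> + real k * \<alpha>)))" for N
  proof (induction N)
    case (Suc N)
    have "J (Suc N) - J N = G (\<beta> + Suc N * \<alpha> - round (\<beta> + Suc N * \<alpha>))"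
      using sec[of "Suc N"] by (simp add: J_def add_ac)
    then show ?case using Suc by simp
  qed simp
  have "(\<lambda>N. (J N - J 0) / S N - \<kappa>) \<longlonglongrightarrow> 0"
  proof (rule LIMSEQ_I)
    fix e :: real assume e: "e > 0"
    obtain M0 where M0: "\<And>s. s \<in> {-1/2..1/2} \<Longrightarrow> s \<noteq> 0 \<Longrightarrow> \<bar>G s - \<kappa> / \<bar>s\<bar>\<bar> \<le> (e/2) / \<bar>s\<bar> + M0"
      using G[of "e/2"] e half_gt_zero by blast
    define M where "M = max M0 1"
    have M: "M > 0" by (simp add: M_def)
    have M2: "\<And>s. s \<in> {-1/2..1/2} \<Longrightarrow> s \<noteq> 0 \<Longrightarrow> \<bar>G s - \<kappa> / \<bar>s\<bar>\<bar> \<le> (e/2) / \<bar>s\<bar> + M"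
      unfolding M_def by (rule order_trans[OF M0]) auto
    have "eventually (\<lambda>N. real N / S N < e / (2 * M)) sequentially"
      using ratio_recip_sum e M by (simp add: order_tendsto_iff)
    then have "eventually (\<lambda>N. norm ((J N - J 0) / S N - \<kappa> - 0) < e) sequentially"
      using eventually_ge_at_top[of 1]
    proof eventually_elim
      case (elim N)
      have SN: "S N > 0" using elim recip_sum_pos by auto
      have "J N - J 0 - \<kappa> * S N = (\<Sum>k = 1..N. G (\<beta> + real k * \<alpha> - round (\<beta> + real k * \<alpha>)) - \<kappa> / dist_int (\<beta>
          + real k * \<alpha>))"
        unfolding sumJ recip_sum_def sum_distrib_left sum_subtractf by simp
      also have "\<bar>\<dots>\<bar> \<le> (\<Sum>k = 1..N. (e/2) / dist_int (\<beta> + real k * \<alpha>) + M)"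
      proof (rule order_trans[OF sum_abs], intro sum_mono)
        fix k
        define t where "t = \<beta> + real k * \<alpha> - round (\<beta> + real k * \<alpha>)"
        have "\<bar>t\<bar> \<le> 1/2" using of_int_round_abs_le[of "\<beta> + real k * \<alpha>"] by (simp add: t_def abs_minus_commute)
        moreover have "t \<noteq> 0" using shift_nonzero[of k] by (simp add: dist_int_def t_def)
        ultimately have "\<bar>G t - \<kappa> / \<bar>t\<bar>\<bar> \<le> (e/2) / \<bar>t\<bar> + M" by (intro M2) auto
        then show "\<bar>G (\<beta> + real k * \<alpha> - round (\<beta> + real k * \<alpha>)) - \<kappa> / dist_int (\<beta> + real k * \<alpha>)\<bar>
            \<le> (e/2) / dist_int (\<beta> + real k * \<alpha>) + M"
          by (simp add: dist_int_def t_def)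
      qed
      also have "\<dots> = (e/2) * S N + M * N" by (simp add: recip_sum_def sum.distrib sum_distrib_left)
      finally have "\<bar>J N - J 0 - \<kappa> * S N\<bar> \<le> (e/2) * S N + M * N" .
      moreover have "M * N < (e/2) * S N" using elim SN M by (simp add: field_simps)
      ultimately have "\<bar>J N - J 0 - \<kappa> * S N\<bar> < e * S N" by simp
      moreover have "(J N - J 0) / S N - \<kappa> = (J N - J 0 - \<kappa> * S N) / S N" using SN by (simp add: field_simps)
      ultimately show ?case using SN by (simp add: divide_less_eq)
    qed
    then show "\<exists>no. \<forall>N\<ge>no. norm ((J N - J 0) / S N - \<kappa> - 0) < e" by (simp add: eventually_sequentially)
  qed
  moreover have "(\<lambda>N. J 0 / S N) \<longlonglongrightarrow> 0"
    by (rule tendsto_divide_0[OF tendsto_const filterlim_at_top_imp_at_infinity[OF recip_sum_at_top]])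
  ultimately have "(\<lambda>N. ((J N - J 0) / S N - \<kappa>) + J 0 / S N + \<kappa>) \<longlonglongrightarrow> 0 + 0 + \<kappa>" by (intro tendsto_intros)
  then have J: "(\<lambda>N. J N / S N) \<longlonglongrightarrow> \<kappa>" by (simp add: diff_divide_distrib)
  have monoF: "F x \<le> F y" if "x \<le> y" for x y
    using DERIV_nonneg_imp_nondecreasing[OF that] F h by blast
  define b where "b w = nat \<lfloor>w - (c + 1/2)\<rfloor>" for w
  have bl: "filterlim b sequentially at_top"
    using filterlim_nat_floor_diff[of "c + 1/2"] by (simp add: b_def[abs_def])
  have l: "((\<lambda>w. J (b w) / S (b w)) \<longlongrightarrow> \<kappa>) at_top" by (rule filterlim_compose[OF J bl])
  have "(\<lambda>N. J (Suc N) / S (Suc N) * (S (N + 1) / S N)) \<longlonglongrightarrow> \<kappa> * 1"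
    by (intro tendsto_mult recip_sum_step LIMSEQ_Suc[OF J])
  from filterlim_compose[OF this bl]
  have u: "((\<lambda>w. J (Suc (b w)) / S (Suc (b w)) * (S (b w + 1) / S (b w))) \<longlongrightarrow> \<kappa>) at_top" by simp
  have ev: "\<forall>\<^sub>F w in at_top. J (b w) / S (b w) \<le> F w / S (b w) \<and>
      F w / S (b w) \<le> J (Suc (b w)) / S (Suc (b w)) * (S (b w + 1) / S (b w))"
    using eventually_ge_at_top[of "c + 3/2"]
  proof eventually_elim
    case (elim w)
    have 1: "b w \<ge> 1" "c + 1/2 + real (b w) \<le> w" "w \<le> c + 1/2 + real (Suc (b w))"
      unfolding b_def using elim by linarith+
    have "S (Suc (b w)) > 0" "S (b w) > 0" using recip_sum_pos 1 by auto
    moreover have "J (b w) \<le> F w" "F w \<le> J (Suc (b w))" unfolding J_def using 1 by (auto intro: monoF)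
    ultimately show ?case by (auto intro: divide_right_mono)
  qed
  have "((\<lambda>w. F w / S (b w)) \<longlongrightarrow> \<kappa>) at_top"
    by (rule tendsto_sandwich[OF _ _ l u]) (use ev in \<open>auto elim: eventually_mono\<close>)
  from tendsto_mult[OF this recip_sum_floor_ratio[of "c + 1/2"]]
  have "((\<lambda>w. F w / S (b w) * (S (b w) / S (nat \<lfloor>w\<rfloor>))) \<longlongrightarrow> \<kappa>) at_top" by (simp add: b_def)
  moreover have "\<forall>\<^sub>F w in at_top. F w / S (b w) * (S (b w) / S (nat \<lfloor>w\<rfloor>)) = F w / S (nat \<lfloor>w\<rfloor>)"
    using eventually_ge_at_top[of "c + 3/2"]
  proof eventually_elim
    case (elim w)
    have "b w \<ge> 1" unfolding b_def using elim by linarith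
    then show ?case using recip_sum_pos[of "b w"] by simp
  qed
  ultimately show ?thesis by (rule Lim_transform_eventually)
qed

end

section \<open>Second-order expansion at a stopping point, in coordinates along the flow\<close>

lemma vec2_expansion: "z = z $ 1 *\<^sub>R axis 1 1 + z $ 2 *\<^sub>R (axis 2 1 :: real^2)"
  by (simp add: vec_eq_iff forall_2 axis_def)

lemma linear_vec2:
  fixes f :: "real^2 \<Rightarrow> real"
  assumes "linear f"
  shows "f z = z $ 1 * f (axis 1 1) + z $ 2 * f (axis 2 1)"
proof -
  have "f z = f (z $ 1 *\<^sub>R axis 1 1 + z $ 2 *\<^sub>R axis 2 1)" by (rule arg_cong[OF vec2_expansion])
  also have "\<dots> = z $ 1 * f (axis 1 1) + z $ 2 * f (axis 2 1)"
    using assms by (simp add: linear_add linear_scale)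
  finally show ?thesis .
qed

lemma norm_vec2: "(norm (z :: real^2))\<^sup>2 = (z $ 1)\<^sup>2 + (z $ 2)\<^sup>2"
  by (simp add: norm_vec_def L2_set_def sum_2)

text \<open>At a minimum the gradient vanishes, and differentiability of the partial derivatives at
  \<open>P\<close> makes each of them at \<open>P + z\<close> linear in \<open>z\<close>, with
  Hessian coefficients, up to \<open>e / 2 * norm z\<close>. The mean value theorem for
  \<open>g\<close> minus its quadratic model on the segment from \<open>P\<close> to
  \<open>P + y\<close> carries this over to \<open>g\<close>.\<close>

lemma second_order_minimum:
  fixes g :: "real^2 \<Rightarrow> real"
  assumes C2: "class_C 2 g" and g0: "g P = 0" and gpos: "\<And>x. g x \<ge> 0" and e: "e > 0"
  obtains d where "d > 0" "\<And>y. norm y < d \<Longrightarrow> \<bar>g (P + y) - (y \<bullet> (hessian g P *v y)) / 2\<bar> \<le> e * (norm y)\<^sup>2"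
proof -
  define H where "H = hessian g P"
  define D where "D i x = frechet_derivative g (at x) (axis i 1)" for i :: 2 and x
  have C2': "\<And>x. g differentiable at x" "\<And>v x. (\<lambda>x. frechet_derivative g (at x) v) differentiable at x"
    using C2 by (auto simp: numeral_2_eq_2)
  have gd: "(g has_derivative frechet_derivative g (at x)) (at x)" for x
    using C2'(1) by (rule frechet_derivative_works[THEN iffD1])
  have fd0: "frechet_derivative g (at P) = (\<lambda>v. 0)"
    by (rule differential_zero_maxmin[OF UNIV_I open_UNIV gd]) (use g0 gpos in auto)
  have D0: "D i P = 0" for i by (simp add: D_def fd0)
  have Dd: "(D i has_derivative frechet_derivative (D i) (at P)) (at P)" for i
    unfolding D_def using C2'(2) by (rule frechet_derivative_works[THEN iffD1])
  have DH: "frechet_derivative (D i) (at P) z = z $ 1 * H $ 1 $ i + z $ 2 * H $ 2 $ i" for i z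
    unfolding linear_vec2[OF has_derivative_linear[OF Dd], where z = z]
        by (simp add: H_def hessian_def D_def[abs_def])
  have "\<exists>d>0. \<forall>z. norm z < d \<longrightarrow> \<bar>D i (P + z) - (z $ 1 * H $ 1 $ i + z $ 2 * H $ 2 $ i)\<bar> \<le> e / 2 * norm z" for i
  proof -
    obtain d where "d > 0" "\<forall>y. norm (y - P) < d \<longrightarrow> norm (D i y - D i P - frechet_derivative (D i) (at P) (y
        - P)) \<le> e / 2 * norm (y - P)"
      using Dd[of i, unfolded has_derivative_at_alt, THEN conjunct2, rule_format, OF half_gt_zero[OF e]]
          by blast
    then have "d > 0 \<and> (\<forall>z. norm z < d \<longrightarrow> \<bar>D i (P + z) - (z $ 1 * H $ 1 $ i + z $ 2 * H $ 2 $ i)\<bar>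
        \<le> e / 2 * norm z)"
      proof (intro conjI allI impI)
      fix z :: "real^2" assume "d > 0" and *: "\<forall>y. norm (y - P) < d \<longrightarrow> norm (D i y - D i P
          - frechet_derivative (D i) (at P) (y - P)) \<le> e / 2 * norm (y - P)"
        and z: "norm z < d"
      show "\<bar>D i (P + z) - (z $ 1 * H $ 1 $ i + z $ 2 * H $ 2 $ i)\<bar> \<le> e / 2 * norm z"
        using *[rule_format, of "P + z"] z by (simp add: DH D0)
    qed
    then show ?thesis ..
  qed
  then have "\<forall>i. \<exists>d. d > 0 \<and> (\<forall>z. norm z < d \<longrightarrow> \<bar>D i (P + z) - (z $ 1 * H $ 1 $ i + z $ 2 * H $ 2 $ i)\<bar>
      \<le> e / 2 * norm z)"
    by blast
  from choice[OF this] obtain d where d: "\<And>i. d i > 0"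
    "\<And>i z. norm z < d i \<Longrightarrow> \<bar>D i (P + z) - (z $ 1 * H $ 1 $ i + z $ 2 * H $ 2 $ i)\<bar> \<le> e / 2 * norm z"
    by blast
  show ?thesis
  proof (rule that[of "min (d 1) (d 2)"])
    show "min (d 1) (d 2) > 0" using d(1) by simp
    fix y :: "real^2" assume y: "norm y < min (d 1) (d 2)"
    define Q where "Q = y \<bullet> (H *v y)"
    have Q: "Q = y $ 1 * (y $ 1 * H $ 1 $ 1 + y $ 2 * H $ 2 $ 1) + y $ 2 * (y $ 1 * H $ 1 $ 2
        + y $ 2 * H $ 2 $ 2)"
      by (simp add: Q_def inner_vec_def matrix_vector_mult_def sum_2 algebra_simps)
    define \<psi> where "\<psi> t = g (P + t *\<^sub>R y) - t\<^sup>2 / 2 * Q" for t :: real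
    have \<psi>': "(\<psi> has_real_derivative (frechet_derivative g (at (P + t *\<^sub>R y)) y - t * Q)) (at t)" for t
    proof -
      have "((\<lambda>t. P + t *\<^sub>R y) has_derivative (\<lambda>h. h *\<^sub>R y)) (at t)"
        by (auto intro!: derivative_eq_intros)
      from has_derivative_compose[OF this gd]
      have "((\<lambda>t. g (P + t *\<^sub>R y)) has_derivative (\<lambda>h. frechet_derivative g (at (P
          + t *\<^sub>R y)) (h *\<^sub>R y))) (at t)" .
      also have "(\<lambda>h. frechet_derivative g (at (P + t *\<^sub>R y)) (h *\<^sub>R y)) = (*) (frechet_derivative g (at (P
          + t *\<^sub>R y)) y)"
        using linear_scale[OF has_derivative_linear[OF gd]] by auto
      finally have "((\<lambda>t. g (P + t *\<^sub>R y)) has_real_derivative frechet_derivative g (at (P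
          + t *\<^sub>R y)) y) (at t)"
        unfolding has_field_derivative_def .
      then show ?thesis unfolding \<psi>_def by (auto intro!: derivative_eq_intros)
    qed
    obtain t where t: "0 < t" "t < 1" "\<psi> 1 - \<psi> 0 = frechet_derivative g (at (P + t *\<^sub>R y)) y - t * Q"
      using MVT2[of 0 1 \<psi> "\<lambda>t. frechet_derivative g (at (P + t *\<^sub>R y)) y - t * Q"] \<psi>' by auto
    define r where "r i = D i (P + t *\<^sub>R y) - ((t *\<^sub>R y) $ 1 * H $ 1 $ i + (t *\<^sub>R y) $ 2 * H $ 2 $ i)" for i
    have ty: "norm (t *\<^sub>R y) \<le> norm y" using t by (simp add: mult_left_le_one_le)
    have r: "\<bar>r i\<bar> \<le> e / 2 * norm y" if "norm y < d i" for i
    proof -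
      have "\<bar>r i\<bar> \<le> e / 2 * norm (t *\<^sub>R y)" unfolding r_def using ty that by (intro d(2)) simp
      also have "\<dots> \<le> e / 2 * norm y" using ty e by (intro mult_left_mono) auto
      finally show ?thesis .
    qed
    have "\<psi> 1 - \<psi> 0 = y $ 1 * r 1 + y $ 2 * r 2"
      unfolding t(3) linear_vec2[OF has_derivative_linear[OF gd], where z = y] Q r_def D_def
          by (simp add: algebra_simps)
    also have "\<bar>\<dots>\<bar> \<le> \<bar>y $ 1\<bar> * \<bar>r 1\<bar> + \<bar>y $ 2\<bar> * \<bar>r 2\<bar>"
      unfolding abs_mult[symmetric] by (rule abs_triangle_ineq)
    also have "\<dots> \<le> norm y * (e / 2 * norm y) + norm y * (e / 2 * norm y)"
      using y r component_le_norm_cart[of y] by (intro add_mono mult_mono) auto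
    also have "\<dots> = e * (norm y)\<^sup>2" by (simp add: power2_eq_square)
    finally show "\<bar>g (P + y) - (y \<bullet> (hessian g P *v y)) / 2\<bar> \<le> e * (norm y)\<^sup>2"
      by (simp add: \<psi>_def g0 Q_def H_def)
  qed
qed

context definite_form begin

text \<open>Determinant over trace is a lower bound for the smaller eigenvalue. With
  \<open>l\<close> this quotient, completing the square in
  \<open>(A - l) * (form w s - l * (w^2 + s^2))\<close> leaves the coefficient \<open>l^2\<close> at
  \<open>s^2\<close>, because \<open>l * (A + C)\<close> cancels the determinant.\<close>

lemma form_lower: "form w s \<ge> (A * C - B\<^sup>2) / (A + C) * (w\<^sup>2 + s\<^sup>2)"
proof -
  have "A * C > 0" using disc_pos zero_le_power2[of B] by linarith
  then have C: "C > 0" using A_pos zero_less_mult_pos by blast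
  define l where "l = (A * C - B\<^sup>2) / (A + C)"
  have l: "l * (A + C) = A * C - B\<^sup>2" using A_pos C by (simp add: l_def)
  have "(A - l) * (A + C) = A\<^sup>2 + B\<^sup>2" unfolding left_diff_distrib l
      by (simp add: algebra_simps power2_eq_square)
  also have "\<dots> > 0" using A_pos by (intro add_pos_nonneg) auto
  finally have Al: "A - l > 0" using A_pos C by (simp add: zero_less_mult_iff)
  have "(A - l) * (form w s - l * (w\<^sup>2 + s\<^sup>2)) = ((A - l) * w + B * s)\<^sup>2 + ((A * C - B\<^sup>2 - l * (A + C))
      + l\<^sup>2) * s\<^sup>2"
    by (simp add: form_def algebra_simps power2_eq_square)
  also have "\<dots> \<ge> 0" unfolding l by simp
  finally show ?thesis using Al by (simp add: zero_le_mult_iff l_def)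
qed

end

text \<open>Coordinates adapted to the linear flow: the point is \<open>(0, s)\<close> plus
  \<open>w\<close> times \<open>(1, \<alpha>)\<close>, so a fixed \<open>s\<close> describes a
  linear orbit and \<open>w\<close> the position on it.\<close>

definition shear :: "real \<Rightarrow> real \<Rightarrow> real \<Rightarrow> real^2" where
  "shear \<alpha> w s = vector [w, s + \<alpha> * w]"

lemma shear_nth [simp]: "shear \<alpha> w s $ 1 = w" "shear \<alpha> w s $ 2 = s + \<alpha> * w"
  by (simp_all add: shear_def)

text \<open>The change of coordinates has determinant 1, so the discriminant of the pulled back form
  is \<open>det H\<close> itself. The leading term of a passage time therefore depends on the
  Hessian through its determinant and not on \<open>\<alpha>\<close>.\<close>

lemma sheared_hessian:
  fixes H :: "real^2^2" and \<alpha> :: real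
  assumes pd: "positive_definite H"
  defines "A \<equiv> H $ 1 $ 1 + 2 * \<alpha> * H $ 1 $ 2 + \<alpha>\<^sup>2 * H $ 2 $ 2" and "B \<equiv> H $ 1 $ 2 + \<alpha> * H $ 2 $ 2"
      and "C \<equiv> H $ 2 $ 2"
  shows "definite_form A B C" "definite_form.root_disc A B C = sqrt (det H)"
    "shear \<alpha> w s \<bullet> (H *v shear \<alpha> w s) = definite_form.form A B C w s"
proof -
  have sym: "H $ 2 $ 1 = H $ 1 $ 2"
  proof -
    have "transpose H $ 1 $ 2 = H $ 1 $ 2" using pd by (simp add: positive_definite_def)
    then show ?thesis by (simp add: transpose_def)
  qed
  have form: "shear \<alpha> w s \<bullet> (H *v shear \<alpha> w s) = A * w\<^sup>2 + 2 * B * w * s + C * s\<^sup>2" for w s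
    by (simp add: inner_vec_def matrix_vector_mult_def sum_2 A_def B_def C_def sym) (simp add: algebra_simps
        power2_eq_square)
  have pos: "A * w\<^sup>2 + 2 * B * w * s + C * s\<^sup>2 > 0" if "w \<noteq> 0 \<or> s \<noteq> 0" for w s
  proof -
    have "shear \<alpha> w s \<noteq> 0"
      using that by (metis add.right_neutral add_0 mult_zero_right shear_nth zero_index)
    then show ?thesis using pd unfolding form[symmetric] positive_definite_def by blast
  qed
  have A: "A > 0" using pos[of 1 0] by simp
  \<comment> \<open>This is the value of the form at \<open>w = - B\<close>, \<open>s = A\<close>,
    where it equals \<open>A\<close> times the discriminant.\<close>
  have "A * (A * C - B\<^sup>2) = A * (- B)\<^sup>2 + 2 * B * (- B) * A + C * A\<^sup>2"
      by (simp add: algebra_simps power2_eq_square)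
  also have "\<dots> > 0" using pos[of "- B" A] A by simp
  finally have D: "A * C - B\<^sup>2 > 0" using A zero_less_mult_pos by blast
  show df: "definite_form A B C" using A D by unfold_locales
  have det: "det H = A * C - B\<^sup>2" by (simp add: det_2 A_def B_def C_def sym algebra_simps power2_eq_square)
  show "definite_form.root_disc A B C = sqrt (det H)" by (simp add: definite_form.root_disc_def[OF df] det)
  show "shear \<alpha> w s \<bullet> (H *v shear \<alpha> w s) = definite_form.form A B C w s"
    by (simp add: definite_form.form_def[OF df] form)
qed

lemma hessian_asymptotics:
  fixes g :: "real^2 \<Rightarrow> real" and \<alpha> :: real
  assumes C2: "class_C 2 g" and g0: "g P = 0" and gpos: "\<And>x. g x \<ge> 0"
      and pd: "positive_definite (hessian g P)"
  obtains A B C where "definite_form A B C" "definite_form.root_disc A B C = sqrt (det (hessian g P))"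
    "((\<lambda>(w, s). g (P + shear \<alpha> w s) / definite_form.form A B C w s) \<longlongrightarrow> 1 / 2) (at (0, 0))"
proof -
  define H where "H = hessian g P"
  define A B C where "A = H $ 1 $ 1 + 2 * \<alpha> * H $ 1 $ 2 + \<alpha>\<^sup>2 * H $ 2 $ 2" and "B = H $ 1 $ 2
      + \<alpha> * H $ 2 $ 2" and "C = H $ 2 $ 2"
  note sh = sheared_hessian[where \<alpha> = \<alpha> and H = "hessian g P", OF pd, folded H_def, folded A_def B_def C_def]
  interpret definite_form A B C by (rule sh(1))
  have AC: "A + C > 0"
  proof -
    have "A * C > 0" using disc_pos zero_le_power2[of B] by linarith
    then have "C > 0" using A_pos zero_less_mult_pos by blast
    then show ?thesis using A_pos by simp
  qed
  define l where "l = (A * C - B\<^sup>2) / (A + C)"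
  have l: "l > 0" using disc_pos AC by (simp add: l_def)
  define K where "K = 2 + 2 * \<alpha>\<^sup>2"
  have K: "K > 0" by (simp add: K_def add_pos_nonneg)
  have norm_le: "(norm (shear \<alpha> w s))\<^sup>2 \<le> K * (w\<^sup>2 + s\<^sup>2)" for w s
  proof -
    have "K * (w\<^sup>2 + s\<^sup>2) - (w\<^sup>2 + (s + \<alpha> * w)\<^sup>2) = w\<^sup>2 + (s - \<alpha> * w)\<^sup>2 + 2 * (\<alpha> * s)\<^sup>2"
      by (simp add: K_def algebra_simps power2_eq_square)
    also have "\<dots> \<ge> 0" by simp
    finally show ?thesis by (simp add: norm_vec2)
  qed
  have "((\<lambda>x. g (P + shear \<alpha> (fst x) (snd x)) / form (fst x) (snd x)) \<longlongrightarrow> 1 / 2) (at (0, 0))"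
  proof (rule tendstoI)
    fix e :: real assume e: "e > 0"
    \<comment> \<open>\<open>K\<close> bounds the distortion of the squared norm by
      \<open>shear\<close>, and \<open>l\<close> bounds the form from below relative to
      \<open>w^2 + s^2\<close>; with this \<open>e'\<close> the Taylor error is at most
      \<open>e / 2\<close> times the form.\<close>
    define e' where "e' = e * l / (2 * K)"
    have e': "e' > 0" using e l K by (simp add: e'_def)
    obtain d where d: "d > 0" "\<And>y. norm y < d \<Longrightarrow> \<bar>g (P + y) - (y \<bullet> (hessian g P *v y)) / 2\<bar> \<le> e' * (norm y)\<^sup>2"
      using second_order_minimum[OF C2 g0 gpos e'] by blast
    have "((\<lambda>x. K * ((fst x)\<^sup>2 + (snd x)\<^sup>2)) \<longlongrightarrow> K * ((fst (0::real, 0::real))\<^sup>2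
        + (snd (0::real, 0::real))\<^sup>2)) (at (0::real, 0::real))"
      by (intro tendsto_intros)
    then have "\<forall>\<^sub>F x in at (0::real, 0::real). K * ((fst x)\<^sup>2 + (snd x)\<^sup>2) < d\<^sup>2"
      using d(1) by (intro order_tendstoD(2)) auto
    moreover have "\<forall>\<^sub>F x in at (0::real, 0::real). x \<noteq> (0, 0)" by (simp add: eventually_at_filter)
    ultimately show "\<forall>\<^sub>F x in at (0, 0). dist (g (P
        + shear \<alpha> (fst x) (snd x)) / form (fst x) (snd x)) (1 / 2) < e"
    proof eventually_elim
      case (elim x)
      obtain w s where x: "x = (w, s)" by (cases x)
      have ws: "w \<noteq> 0 \<or> s \<noteq> 0" using elim x by auto
      then have ws0: "w\<^sup>2 + s\<^sup>2 > 0" by (simp add: sum_power2_gt_zero_iff)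
      let ?y = "shear \<alpha> w s"
      have f: "form w s > 0" using form_pos ws by blast
      have "(norm ?y)\<^sup>2 < d\<^sup>2" using norm_le[of w s] elim x by simp
      then have "norm ?y < d" using d(1) by (simp add: power2_less_imp_less)
      from d(2)[OF this] have "\<bar>g (P + ?y) - form w s / 2\<bar> \<le> e' * (norm ?y)\<^sup>2"
        using sh(3)[of w s] by (simp add: H_def)
      also have "\<dots> \<le> e' * (K * (w\<^sup>2 + s\<^sup>2))" using norm_le e' by (intro mult_left_mono) auto
      also have "\<dots> = (e / 2) * (l * (w\<^sup>2 + s\<^sup>2))" using K by (simp add: e'_def)
      also have "\<dots> \<le> (e / 2) * form w s" using form_lower[of w s] e
          by (intro mult_left_mono) (auto simp: l_def)
      also have "\<dots> < e * form w s" using f e by simp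
      finally have "\<bar>g (P + ?y) - form w s / 2\<bar> / form w s < e" using f by (simp add: divide_less_eq)
      moreover have "g (P + ?y) / form w s - 1 / 2 = (g (P + ?y) - form w s / 2) / form w s"
        using f by (simp add: diff_divide_distrib)
      ultimately show ?case using f by (simp add: dist_real_def x)
    qed
  qed
  then have "((\<lambda>(w, s). g (P + shear \<alpha> w s) / form w s) \<longlongrightarrow> 1 / 2) (at (0, 0))"
    unfolding case_prod_unfold .
  then show ?thesis using that[OF sh(1)] sh(2) by (simp add: H_def)
qed

section \<open>Measures on the torus\<close>

lemma abs_torus_eq_iff: "abs_torus x = abs_torus y \<longleftrightarrow> (\<forall>i. x $ i - y $ i \<in> \<int>)"
  by (rule torus.abs_eq_iff)

lemma abs_rep_torus [simp]: "abs_torus (rep_torus y) = y"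
  by (rule Quotient3_abs_rep[OF Quotient3_torus])

lemma rep_abs_torus: "rep_torus (abs_torus x) $ i - x $ i \<in> \<int>"
  using abs_torus_eq_iff[of "rep_torus (abs_torus x)" x] by simp

lemma rep_torus_Ints_iff [simp]: "rep_torus (abs_torus x) $ i \<in> \<int> \<longleftrightarrow> x $ i \<in> \<int>"
  using rep_abs_torus[of x i] Ints_add Ints_diff
      by (metis diff_add_cancel diff_diff_eq2 add_diff_cancel_left')

lemma frac_rep_abs_torus [simp]: "frac (rep_torus (abs_torus x) $ i) = frac (x $ i)"
proof -
  obtain m where "rep_torus (abs_torus x) $ i - x $ i = of_int m" using rep_abs_torus
      by (blast elim: Ints_cases)
  then have "rep_torus (abs_torus x) $ i = x $ i + of_int m" by simp
  then show ?thesis by simp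
qed

lemma open_torus_iff: "open U \<longleftrightarrow> open (abs_torus -` U)"
  by (rule open_torus_def)

lemma continuous_abs_torus: "continuous_on A abs_torus"
  using continuous_on_subset[of UNIV abs_torus A] by (simp add: continuous_on_open_vimage open_torus_iff)

lemma continuous_on_torus_iff:
  "continuous_on UNIV (f :: torus \<Rightarrow> 'a::topological_space) \<longleftrightarrow> continuous_on UNIV (\<lambda>x. f (abs_torus x))"
  by (simp add: continuous_on_open_vimage open_torus_iff vimage_def)

lemma compact_UNIV_torus: "compact (UNIV :: torus set)"
proof -
  have "abs_torus ` cbox (vector [0, 0]) (vector [1, 1] :: real^2) = UNIV"
  proof (intro equalityI subsetI)
    fix y :: torus
    define x :: "real^2" where "x = vector [frac (rep_torus y $ 1), frac (rep_torus y $ 2)]"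
    have "abs_torus x = abs_torus (rep_torus y)"
      unfolding abs_torus_eq_iff by (simp add: x_def forall_2 frac_def)
    moreover have "x \<in> cbox (vector [0, 0]) (vector [1, 1])"
      by (simp add: mem_box_cart forall_2 x_def frac_lt_1 less_imp_le)
    ultimately show "y \<in> abs_torus ` cbox (vector [0, 0]) (vector [1, 1])" by force
  qed auto
  then show ?thesis using compact_continuous_image[OF continuous_abs_torus compact_cbox] by metis
qed

lemma continuous_torus_bounded:
  assumes "continuous_on UNIV (f :: torus \<Rightarrow> real)"
  obtains B where "B > 0" "\<And>y. \<bar>f y\<bar> \<le> B"
  using compact_imp_bounded[OF compact_continuous_image[OF assms compact_UNIV_torus]]
  unfolding bounded_pos by auto

text \<open>\<open>rep_torus\<close> is an arbitrary choice of representative, but the fractional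
  part of a coordinate does not depend on it. The set where it lies strictly between 0 and
  \<open>c\<close> is open in the torus; the jump at the integers sits on a closed set, treated
  separately.\<close>

lemma frac_rep_torus_measurable [measurable]: "(\<lambda>y :: torus. frac (rep_torus y $ i)) \<in> borel_measurable borel"
proof (rule borel_measurableI_less)
  fix c :: real
  define Z where "Z = {y :: torus. rep_torus y $ i \<in> \<int>}"
  define O' where "O' = {y :: torus. frac (rep_torus y $ i) \<in> {0<..<c}}"
  have "abs_torus -` (- Z) = - ((\<lambda>x. x $ i) -` \<int>)" by (auto simp: Z_def)
  moreover have "closed ((\<lambda>x :: real^2. x $ i) -` \<int>)"
    by (intro closed_vimage closed_Ints continuous_intros)
  ultimately have "open (- Z)" by (simp add: open_torus_iff open_Compl)
  then have Z: "Z \<in> sets borel" by (metis borel_comp borel_open double_complement)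
  have "abs_torus -` O' = (\<Union>m::int. (\<lambda>x. x $ i) -` {of_int m<..<of_int m + min c 1})"
  proof (intro equalityI subsetI)
    fix x assume "x \<in> abs_torus -` O'"
    then have "0 < frac (x $ i)" "frac (x $ i) < min c 1" by (auto simp: O'_def frac_lt_1)
    then have "x \<in> (\<lambda>x. x $ i) -` {of_int \<lfloor>x $ i\<rfloor><..<of_int \<lfloor>x $ i\<rfloor> + min c 1}" by (auto simp: frac_def)
    then show "x \<in> (\<Union>m::int. (\<lambda>x. x $ i) -` {of_int m<..<of_int m + min c 1})" by blast
  next
    fix x assume "x \<in> (\<Union>m::int. (\<lambda>x. x $ i) -` {of_int m<..<of_int m + min c 1})"
    then obtain m where m: "of_int m < x $ i" "x $ i < of_int m + min c 1" by auto
    then have "\<lfloor>x $ i\<rfloor> = m" by (intro floor_unique) auto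
    then have f: "frac (x $ i) = x $ i - of_int m" by (simp add: frac_def)
    have "frac (rep_torus (abs_torus x) $ i) \<in> {0<..<c}" unfolding frac_rep_abs_torus f using m by simp
    then show "x \<in> abs_torus -` O'" by (simp only: O'_def vimage_eq mem_Collect_eq)
  qed
  moreover have "open (\<Union>m::int. (\<lambda>x :: real^2. x $ i) -` {of_int m<..<of_int m + min c 1})"
    by (intro open_UN ballI open_vimage continuous_intros open_greaterThanLessThan)
  ultimately have "open O'" by (simp add: open_torus_iff)
  then have O: "O' \<in> sets borel" by simp
  show "{y \<in> space borel. frac (rep_torus y $ i) < c} \<in> sets borel"
  proof (cases "c > 0")
    case True
    have "frac r = 0 \<or> frac r > 0" for r :: real using frac_ge_0[of r] by linarith
    then have "{y \<in> space borel. frac (rep_torus y $ i) < c} = Z \<union> O'"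
      using True by (auto simp: Z_def O'_def frac_eq_0_iff[THEN iffD2])
    then show ?thesis using Z O by simp
  next
    case False
    then have "{y \<in> space borel. frac (rep_torus y $ i) < c} = {}"
      using frac_ge_0 by (auto simp: not_less intro: order_trans)
    then show ?thesis by simp
  qed
qed

lemma continuous_torus_integrable:
  assumes "\<mu> \<in> borel_probs" "continuous_on UNIV (f :: torus \<Rightarrow> real)"
  shows "integrable \<mu> f"
proof -
  interpret prob_space \<mu> using assms(1) by (simp add: borel_probs_def)
  obtain B where B: "\<And>y. \<bar>f y\<bar> \<le> B" using continuous_torus_bounded[OF assms(2)] by blast
  have "f \<in> borel_measurable \<mu>"
    using borel_measurable_continuous_onI[OF assms(2)] assms(1)
        by (simp add: borel_probs_def cong: measurable_cong_sets)
  then show ?thesis using B by (intro integrable_const_bound[of _ B]) auto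
qed

text \<open>The preimage of \<open>W\<close> is invariant under integer translations, hence so is
  the distance to it in the plane, and the function descends to the torus. It is the source of the
  continuous test functions below.\<close>

lemma continuous_infdist_torus: "continuous_on UNIV (\<lambda>y :: torus. infdist (rep_torus y) (abs_torus -` W))"
proof -
  define A where "A = abs_torus -` W"
  have "infdist (rep_torus (abs_torus x)) A = infdist x A" for x
  proof (cases "A = {}")
    case False
    define v where "v = rep_torus (abs_torus x) - x"
    have "v $ i \<in> \<int>" for i using rep_abs_torus[of x i] by (simp add: v_def)
    then have *: "abs_torus (a + v) = abs_torus a" "abs_torus (a - v) = abs_torus a" for a
      unfolding abs_torus_eq_iff by auto
    have img: "(\<lambda>a. a + v) ` A = A"
    proof (intro equalityI subsetI)
      fix a assume "a \<in> A"
      then have "a - v \<in> A" by (simp add: A_def *)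
      then show "a \<in> (\<lambda>a. a + v) ` A" by (rule rev_image_eqI) simp
    qed (auto simp: A_def *)
    have "infdist (x + v) A = Inf (dist (x + v) ` (\<lambda>a. a + v) ` A)" unfolding img using False
        by (simp add: infdist_def)
    also have "\<dots> = infdist x A" using False by (simp add: infdist_def image_image)
    finally show ?thesis by (simp add: v_def)
  qed (simp add: infdist_def)
  then show ?thesis unfolding continuous_on_torus_iff A_def[symmetric] by (simp add: continuous_intros)
qed

text \<open>Truncated multiples of the distance to the complement. The case \<open>U = UNIV\<close>
  is excluded because \<open>infdist\<close> to the empty set is 0 by convention, which would give
  the limit 0 instead of 1.\<close>

lemma open_torus_approx:
  assumes U: "open (U :: torus set)" "U \<noteq> UNIV"
  obtains f :: "nat \<Rightarrow> torus \<Rightarrow> real" where "\<And>n. continuous_on UNIV (f n)" "\<And>n y. \<bar>f n y\<bar> \<le> 1"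
    "\<And>y. (\<lambda>n. f n y) \<longlonglongrightarrow> indicator U y"
proof -
  define A where "A = - (abs_torus -` U)"
  obtain y0 where "y0 \<notin> U" using U(2) by blast
  then have "rep_torus y0 \<in> A" by (simp add: A_def)
  then have "A \<noteq> {}" by blast
  moreover have "closed A" using U(1) unfolding open_torus_iff A_def by (simp add: closed_Compl)
  ultimately have A: "closed A" "A \<noteq> {}" by blast+
  define f where "f n y = min 1 (real n * infdist (rep_torus y) A)" for n y
  show ?thesis
  proof (rule that[of f])
    show "continuous_on UNIV (f n)" for n
      unfolding f_def A_def vimage_Compl[symmetric] by (intro continuous_intros continuous_infdist_torus)
    show "\<bar>f n y\<bar> \<le> 1" for n y unfolding f_def
        by (auto simp: infdist_nonneg abs_le_iff intro: order_trans[of _ 0])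
    show "(\<lambda>n. f n y) \<longlonglongrightarrow> indicator U y" for y
    proof (cases "y \<in> U")
      case True
      then have "infdist (rep_torus y) A > 0"
        using infdist_pos_not_in_closed[OF A(1) A(2), of "rep_torus y"] by (simp add: A_def)
      then have "filterlim (\<lambda>n. infdist (rep_torus y) A * real n) at_top sequentially"
        by (intro filterlim_tendsto_pos_mult_at_top[OF tendsto_const] filterlim_real_sequentially)
      then have "eventually (\<lambda>n. infdist (rep_torus y) A * real n \<ge> 1) sequentially" unfolding
          filterlim_at_top by blast
      then have "eventually (\<lambda>n. 1 = f n y) sequentially"
        by (rule eventually_mono) (simp add: f_def mult.commute)
      then show ?thesis using True by (auto intro: Lim_transform_eventually)
    next
      case False
      then have "f n y = 0" for n by (simp add: f_def A_def)
      then show ?thesis using False by simp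
    qed
  qed
qed

lemma borel_probs_eqI:
  assumes \<mu>: "\<mu> \<in> borel_probs" and \<nu>: "\<nu> \<in> borel_probs"
    and eq: "\<And>f :: torus \<Rightarrow> real. continuous_on UNIV f \<Longrightarrow> (\<integral>x. f x \<partial>\<mu>) = (\<integral>x. f x \<partial>\<nu>)"
  shows "\<mu> = \<nu>"
proof -
  interpret \<mu>: prob_space \<mu> using \<mu> by (simp add: borel_probs_def)
  interpret \<nu>: prob_space \<nu> using \<nu> by (simp add: borel_probs_def)
  have sets: "sets \<mu> = sets borel" "sets \<nu> = sets borel" using \<mu> \<nu> by (auto simp: borel_probs_def)
  have space: "space \<mu> = UNIV" "space \<nu> = UNIV" using sets by (auto dest: sets_eq_imp_space_eq)
  have borel: "sets (borel :: torus measure) = sigma_sets UNIV {U. open U}" by (simp add: borel_def)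
  have conv: "(\<lambda>n. \<integral>x. f n x \<partial>M) \<longlonglongrightarrow> measure M U"
    if "open U" "\<And>n. continuous_on UNIV (f n)" "\<And>n y. \<bar>f n y\<bar> \<le> 1" "\<And>y. (\<lambda>n. f n y) \<longlonglongrightarrow> indicator U y"
      and M: "M \<in> borel_probs" for U :: "torus set" and f :: "nat \<Rightarrow> torus \<Rightarrow> real" and M
  proof -
    interpret M: prob_space M using M by (simp add: borel_probs_def)
    have sM: "sets M = sets borel" using M by (simp add: borel_probs_def)
    have Um: "U \<in> sets M" using that(1) sM by simp
    have "(\<lambda>n. \<integral>x. f n x \<partial>M) \<longlonglongrightarrow> (\<integral>x. indicator U x \<partial>M)"
    proof (rule integral_dominated_convergence[where w = "\<lambda>_. 1"])
      show "f n \<in> borel_measurable M" for n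
        using continuous_torus_integrable[OF M that(2)] by (rule borel_measurable_integrable)
    qed (use that(3,4) Um in auto)
    then show ?thesis using Um by simp
  qed
  have open_eq: "emeasure \<mu> U = emeasure \<nu> U" if U: "open U" for U
  proof (cases "U = UNIV")
    case True
    then show ?thesis using \<mu>.emeasure_space_1 \<nu>.emeasure_space_1 space by simp
  next
    case False
    obtain f :: "nat \<Rightarrow> torus \<Rightarrow> real" where f: "\<And>n. continuous_on UNIV (f n)" "\<And>n y. \<bar>f n y\<bar> \<le> 1"
      "\<And>y. (\<lambda>n. f n y) \<longlonglongrightarrow> indicator U y" using open_torus_approx[OF U False] by blast
    have "measure \<mu> U = measure \<nu> U"
      using LIMSEQ_unique[OF conv[OF U f \<mu>]] conv[OF U f \<nu>] eq[OF f(1)] by simp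
    then show ?thesis by (simp add: \<mu>.emeasure_eq_measure \<nu>.emeasure_eq_measure)
  qed
  show ?thesis
  proof (rule measure_eqI_generator_eq[where E = "{U. open U}" and \<Omega> = UNIV and A = "\<lambda>_. UNIV"])
    show "Int_stable {U :: torus set. open U}" by (auto simp: Int_stable_def)
    show "sets \<mu> = sigma_sets UNIV {U. open U}" "sets \<nu> = sigma_sets UNIV {U. open U}" using sets borel
        by auto
  qed (use open_eq in auto)
qed

text \<open>The image of the uniform distribution on \<open>{0..t}\<close> under the orbit map has
  the required integrals, and \<open>borel_probs_eqI\<close> makes it the only such measure, so the
  definite description denotes it.\<close>

lemma empirical_measure:
  fixes \<Phi> :: "real \<Rightarrow> torus \<Rightarrow> torus"
  assumes cont: "continuous_on UNIV (\<lambda>s. \<Phi> s x)" and t: "t > 0"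
  shows "empirical_measure \<Phi> x t \<in> borel_probs"
    and "continuous_on UNIV f \<Longrightarrow> (\<integral>y. f y \<partial>empirical_measure \<Phi> x t)
        = (1 / t) * integral {0..t} (\<lambda>s. f (\<Phi> s x))"
proof -
  have meas: "(\<lambda>s. \<Phi> s x) \<in> borel_measurable borel" using cont by (rule borel_measurable_continuous_onI)
  define U where "U = density lborel (\<lambda>s. ennreal (indicator {0..t} s / t))"
  have sU: "sets U = sets borel" by (simp add: U_def)
  have measU: "(\<lambda>s. \<Phi> s x) \<in> measurable U borel" using meas by (simp add: sU cong: measurable_cong_sets)
  have "emeasure U (space U) = (\<integral>\<^sup>+ s. ennreal (1 / t) * indicator {0..t} s \<partial>lborel)"
    using t by (subst U_def, subst emeasure_density)
      (auto simp: U_def intro!: nn_integral_cong simp: indicator_def)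
  also have "\<dots> = ennreal (1 / t) * ennreal t" using t by (simp add: nn_integral_cmult_indicator)
  also have "\<dots> = 1" using t by (simp add: ennreal_mult[symmetric])
  finally have "prob_space U" by (rule prob_spaceI)
  define \<mu> where "\<mu> = distr U borel (\<lambda>s. \<Phi> s x)"
  have "prob_space \<mu>" unfolding \<mu>_def using \<open>prob_space U\<close> measU by (rule prob_space.prob_space_distr)
  then have \<mu>: "\<mu> \<in> borel_probs" by (simp add: borel_probs_def \<mu>_def)
  have int: "(\<integral>y. g y \<partial>\<mu>) = (1 / t) * integral {0..t} (\<lambda>s. g (\<Phi> s x))"
    if g: "continuous_on UNIV (g :: torus \<Rightarrow> real)" for g
  proof -
    have cg: "continuous_on UNIV (\<lambda>s. g (\<Phi> s x))"
      by (rule continuous_on_compose2[OF g cont]) simp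
    have "(\<integral>y. g y \<partial>\<mu>) = (\<integral>s. g (\<Phi> s x) \<partial>U)"
      unfolding \<mu>_def using measU borel_measurable_continuous_onI[OF g] by (rule integral_distr)
    also have "\<dots> = (\<integral>s. (indicator {0..t} s / t) *\<^sub>R g (\<Phi> s x) \<partial>lborel)"
      unfolding U_def using t borel_measurable_continuous_onI[OF cg] by (intro integral_density) auto
    also have "\<dots> = (1 / t) * (LINT s:{0..t}|lborel. g (\<Phi> s x))"
      unfolding set_lebesgue_integral_def by (subst integral_mult_right_zero[symmetric]) simp
    also have "(LINT s:{0..t}|lborel. g (\<Phi> s x)) = integral {0..t} (\<lambda>s. g (\<Phi> s x))"
      by (intro set_borel_integral_eq_integral borel_integrable_atLeastAtMost' continuous_on_subset[OF cg]
          subset_UNIV)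
    finally show ?thesis .
  qed
  have "empirical_measure \<Phi> x t = \<mu>"
    unfolding empirical_measure_def
    by (rule the_equality) (auto simp: \<mu> int intro: borel_probs_eqI[OF _ \<mu>])
  then show "empirical_measure \<Phi> x t \<in> borel_probs"
    "continuous_on UNIV f \<Longrightarrow> (\<integral>y. f y \<partial>empirical_measure \<Phi> x t) = (1 / t) * integral {0..t} (\<lambda>s. f (\<Phi> s x))"
    using \<mu> int by auto
qed

section \<open>Weak-* topology and limit sets of empirical measures\<close>

lemma topspace_weak_star: "topspace weak_star_topology = borel_probs"
proof -
  have "{\<mu> \<in> borel_probs. (\<integral>x. (0::real) \<partial>\<mu>) \<in> UNIV} \<in>
    {{\<mu> \<in> borel_probs. (\<integral>x. f x \<partial>\<mu>) \<in> U} | (f :: torus \<Rightarrow> real) U. continuous_on UNIV f \<and> open U}"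
    using continuous_on_const open_UNIV by blast
  then show ?thesis unfolding weak_star_topology_def topology_generated_by_topspace by auto
qed

lemma openin_weak_star:
  "continuous_on UNIV (f :: torus \<Rightarrow> real) \<Longrightarrow> open U \<Longrightarrow>
    openin weak_star_topology {\<mu> \<in> borel_probs. (\<integral>x. f x \<partial>\<mu>) \<in> U}"
  unfolding weak_star_topology_def by (rule topology_generated_by_Basis) blast

text \<open>Subbasic neighbourhoods of \<open>\<mu>\<close> eventually contain the empirical
  measures, and this passes to finite intersections and to unions, hence to all open sets.
  Conversely, a limit point \<open>\<nu>\<close> other than \<open>\<mu>\<close> has a different
  integral for some continuous \<open>f\<close>, and a ball of half the gap around that integral
  excludes all late empirical measures.\<close>

lemma p_omega_eq_singleton:
  fixes \<Phi> :: "real \<Rightarrow> torus \<Rightarrow> torus"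
  assumes cont: "continuous_on UNIV (\<lambda>s. \<Phi> s x)" and \<mu>: "\<mu> \<in> borel_probs"
    and lim: "\<And>f :: torus \<Rightarrow> real. continuous_on UNIV f \<Longrightarrow>
      ((\<lambda>t. (1 / t) * integral {0..t} (\<lambda>s. f (\<Phi> s x))) \<longlongrightarrow> (\<integral>y. f y \<partial>\<mu>)) at_top"
  shows "p_omega \<Phi> x = {\<mu>}"
proof -
  define E where "E t = empirical_measure \<Phi> x t" for t
  have EP: "E t \<in> borel_probs" if "t > 0" for t unfolding E_def
      by (rule empirical_measure(1)[where \<Phi> = \<Phi> and x = x, OF cont that])
  have limE: "((\<lambda>t. \<integral>y. f y \<partial>E t) \<longlongrightarrow> (\<integral>y. f y \<partial>\<mu>)) at_top" if "continuous_on UNIV f" for f :: "torus \<Rightarrow> real"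
    using lim[OF that]
  proof (rule Lim_transform_eventually)
    show "\<forall>\<^sub>F t in at_top. (1 / t) * integral {0..t} (\<lambda>s. f (\<Phi> s x)) = (\<integral>y. f y \<partial>E t)"
      using eventually_gt_at_top[of 0]
      by eventually_elim (simp add: E_def empirical_measure(2)[where \<Phi> = \<Phi> and x = x, OF cont _ that])
  qed
  have nbhd: "eventually (\<lambda>t. E t \<in> V) at_top" if "openin weak_star_topology V" "\<mu> \<in> V" for V
  proof -
    have "generate_topology_on {{\<mu> \<in> borel_probs. (\<integral>x. f x \<partial>\<mu>)
        \<in> U} | (f :: torus \<Rightarrow> real) U. continuous_on UNIV f \<and> open U} V"
      using that(1) unfolding weak_star_topology_def by (rule openin_topology_generated_by)
    then show ?thesis using that(2)
    proof (induction V rule: generate_topology_on.induct)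
      case (Int a b)
      then show ?case by (auto intro: eventually_conj)
    next
      case (UN K)
      then obtain k where k: "k \<in> K" "\<mu> \<in> k" by blast
      then have "eventually (\<lambda>t. E t \<in> k) at_top" using UN by blast
      then show ?case by (rule eventually_mono) (use k in blast)
    next
      case (Basis s)
      then obtain f :: "torus \<Rightarrow> real" and U where s: "s = {\<mu> \<in> borel_probs. (\<integral>x. f x \<partial>\<mu>) \<in> U}"
        "continuous_on UNIV f" "open U" by blast
      have "eventually (\<lambda>t. (\<integral>x. f x \<partial>E t) \<in> U) at_top"
        using limE[OF s(2)] s(1,3) Basis by (intro topological_tendstoD) auto
      then show ?case using eventually_gt_at_top[of 0] unfolding s(1) by eventually_elim (auto simp: EP)
    qed simp
  qed
  show ?thesis
  proof (intro equalityI subsetI)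
    fix \<nu> assume "\<nu> \<in> p_omega \<Phi> x"
    then have cl: "\<nu> \<in> weak_star_topology closure_of {E t | t. t \<ge> T}" if "T > 0" for T
      using that unfolding p_omega_def E_def by blast
    from cl[of 1] have \<nu>: "\<nu> \<in> borel_probs" by (simp add: in_closure_of topspace_weak_star)
    have "(\<integral>y. f y \<partial>\<nu>) = (\<integral>y. f y \<partial>\<mu>)" if f: "continuous_on UNIV f" for f :: "torus \<Rightarrow> real"
    proof (rule ccontr)
      assume ne: "(\<integral>y. f y \<partial>\<nu>) \<noteq> (\<integral>y. f y \<partial>\<mu>)"
      define e where "e = dist (\<integral>y. f y \<partial>\<nu>) (\<integral>y. f y \<partial>\<mu>) / 2"
      have e: "e > 0" using ne by (simp add: e_def)
      have "\<forall>\<^sub>F t in at_top. dist (\<integral>y. f y \<partial>E t) (\<integral>y. f y \<partial>\<mu>) < e" using limE[OF f] e by (rule tendstoD)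
      then obtain T where T: "\<And>t. t \<ge> T \<Longrightarrow> dist (\<integral>y. f y \<partial>E t) (\<integral>y. f y \<partial>\<mu>) < e"
        unfolding eventually_at_top_linorder by blast
      define V where "V = {\<mu> \<in> borel_probs. (\<integral>x. f x \<partial>\<mu>) \<in> ball (\<integral>x. f x \<partial>\<nu>) e}"
      have "openin weak_star_topology V" unfolding V_def by (rule openin_weak_star[OF f open_ball])
      moreover have "\<nu> \<in> V" using \<nu> e by (simp add: V_def)
      moreover have "\<nu> \<in> weak_star_topology closure_of {E t | t. t \<ge> max T 1}" by (rule cl) simp
      ultimately obtain y where "y \<in> {E t | t. t \<ge> max T 1}" "y \<in> V" unfolding in_closure_of by blast
      then obtain t where "t \<ge> max T 1" "E t \<in> V" by blast
      then have "dist (\<integral>x. f x \<partial>\<nu>) (\<integral>x. f x \<partial>E t) < e" "dist (\<integral>y. f y \<partial>E t) (\<integral>y. f y \<partial>\<mu>) < e"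
        using T by (auto simp: V_def)
      then have "dist (\<integral>y. f y \<partial>\<nu>) (\<integral>y. f y \<partial>\<mu>) < 2 * e" unfolding dist_real_def by linarith
      then show False by (simp add: e_def)
    qed
    then show "\<nu> \<in> {\<mu>}" using borel_probs_eqI[OF \<nu> \<mu>] by simp
  next
    fix \<nu> assume "\<nu> \<in> {\<mu>}"
    then have \<nu>: "\<nu> = \<mu>" by simp
    have "\<mu> \<in> weak_star_topology closure_of {E t | t. t \<ge> T}" for T
      unfolding in_closure_of topspace_weak_star
    proof (intro conjI allI impI \<mu>)
      fix V assume "\<mu> \<in> V \<and> openin weak_star_topology V"
      then have "eventually (\<lambda>t. E t \<in> V \<and> t \<ge> T) at_top" using nbhd eventually_ge_at_top
          by (auto intro: eventually_conj)
      then obtain t where "E t \<in> V" "t \<ge> T" unfolding eventually_at_top_linorder by blast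
      then show "\<exists>y. y \<in> {E t |t. T \<le> t} \<and> y \<in> V" by blast
    qed
    then show "\<nu> \<in> p_omega \<Phi> x" unfolding p_omega_def \<nu> E_def by blast
  qed
qed

text \<open>\<open>measure_of\<close> takes the prescribed values only if the set function is a
  measure; the image of a Bernoulli law under the choice between \<open>p\<close> and
  \<open>q\<close> shows that it is one.\<close>

lemma measure_of_two_points:
  fixes p q :: "'a :: topological_space" and w :: real
  assumes w: "0 \<le> w" "w \<le> 1"
  defines "M \<equiv> measure_of UNIV (sets borel) (\<lambda>A. ennreal w * emeasure (return borel p) A + ennreal (1
      - w) * emeasure (return borel q) A)"
  shows "M \<in> borel_probs" "f \<in> borel_measurable borel \<Longrightarrow> (\<integral>x. f x \<partial>M) = w * f p + (1 - w) * (f q :: real)"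
proof -
  define N where "N = distr (measure_pmf (bernoulli_pmf w)) borel (\<lambda>b. if b then p else q)"
  have eN: "emeasure N A = ennreal w * emeasure (return borel p) A + ennreal (1
      - w) * emeasure (return borel q) A"
    if "A \<in> sets borel" for A
  proof -
    have "emeasure N A = (\<integral>\<^sup>+b. indicator A (if b then p else q) \<partial>measure_pmf (bernoulli_pmf w))"
      unfolding N_def using that
      by (subst emeasure_distr) (auto simp: nn_integral_indicator[symmetric] intro!: nn_integral_cong simp
          del: nn_integral_indicator split: split_indicator)
    also have "\<dots> = ennreal w * indicator A p + ennreal (1 - w) * indicator A q" using w
        by (simp add: nn_integral_bernoulli_pmf mult.commute)
    finally show ?thesis using that by simp
  qed
  have "M = measure_of UNIV (sets borel) (emeasure N)"
    unfolding M_def by (rule measure_of_eq) (use eN sets.space_closed[of borel] in \<open>auto simp: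
        sets.sigma_sets_eq[of borel, simplified]\<close>)
  also have "\<dots> = N" using measure_of_of_measure[of N] by (simp add: N_def)
  finally have M: "M = N" .
  show "M \<in> borel_probs"
    unfolding M borel_probs_def N_def by (auto intro!: measure_pmf.prob_space_distr)
  show "(\<integral>x. f x \<partial>M) = w * f p + (1 - w) * f q" if "f \<in> borel_measurable borel"
    unfolding M N_def using that w by (subst integral_distr) auto
qed

section \<open>Occupation times of the flow\<close>

lemma abs_torus_cong_diff:
  assumes "abs_torus x = abs_torus y"
  shows "abs_torus (x + v) = abs_torus (y + v)"
  using assms by (simp add: abs_torus_eq_iff)

lemma open_Compl_singleton_torus: "open (- {p :: torus})"
proof -
  have "abs_torus -` {p} = (\<Inter>i. (\<lambda>x. x $ i - rep_torus p $ i) -` \<int>)"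
    using abs_torus_eq_iff[of _ "rep_torus p"] by (auto simp del: abs_torus_eq_iff)
  moreover have "closed (\<Inter>i. (\<lambda>x :: real^2. x $ i - rep_torus p $ i) -` \<int>)"
    by (intro closed_INT ballI closed_vimage closed_Ints continuous_intros)
  ultimately have "closed (abs_torus -` {p})" by simp
  then show ?thesis by (simp add: open_torus_iff open_Compl vimage_Compl)
qed

lemma torus_bump:
  assumes "p \<noteq> (q :: torus)"
  obtains \<zeta> :: "torus \<Rightarrow> real" and U V :: "torus set" where "continuous_on UNIV \<zeta>" "\<And>y. 0 \<le> \<zeta> y" "\<And>y. \<zeta> y \<le> 1"
    "open U" "p \<in> U" "\<And>y. y \<in> U \<Longrightarrow> \<zeta> y = 1" "open V" "q \<in> V" "\<And>y. y \<in> V \<Longrightarrow> \<zeta> y = 0"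
proof -
  define D where "D y = infdist (rep_torus y) (abs_torus -` {p})" for y
  have cD: "continuous_on UNIV D" unfolding D_def by (rule continuous_infdist_torus)
  have "closed (abs_torus -` {p})"
    using open_Compl_singleton_torus[of p] by (simp add: open_torus_iff closed_def vimage_Compl)
  moreover have "abs_torus -` {p} \<noteq> {}" using abs_rep_torus[of p] by blast
  moreover have "rep_torus q \<notin> abs_torus -` {p}" using assms by simp
  ultimately have Dq: "D q > 0" unfolding D_def by (rule infdist_pos_not_in_closed)
  have Dp: "D p = 0" by (simp add: D_def)
  show ?thesis
  proof (rule that[of "\<lambda>y. max 0 (min 1 (2 - 3 * (D y / D q)))" "D -` {..<D q / 3}" "D -` {2 * D q / 3<..}"])
    show "continuous_on UNIV (\<lambda>y. max 0 (min 1 (2 - 3 * (D y / D q))))"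
      using Dq by (intro continuous_intros cD) auto
    show "open (D -` {..<D q / 3})" "open (D -` {2 * D q / 3<..})"
      using cD by (auto simp: continuous_on_open_vimage)
  qed (use Dq Dp in \<open>auto simp: field_simps\<close>)
qed

text \<open>Off both points \<open>\<phi>\<close> is positive. On \<open>V\<close> the quotient is
  identically 0, even at a zero of \<open>\<phi>\<close>, since \<open>0 / 0 = 0\<close>; the two
  open pieces cover everything but \<open>p\<close>.\<close>

lemma continuous_quotient_zero_near:
  fixes f \<phi> :: "torus \<Rightarrow> real"
  assumes "continuous_on UNIV f" "continuous_on UNIV \<phi>" "\<And>y. y \<noteq> p \<Longrightarrow> y \<noteq> q \<Longrightarrow> \<phi> y > 0"
    and "open V" "q \<in> V" "\<And>y. y \<in> V \<Longrightarrow> f y = 0"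
  shows "continuous_on (- {p}) (\<lambda>y. f y / \<phi> y)"
proof -
  have "open (- {p} \<inter> - {q})" by (intro open_Int open_Compl_singleton_torus)
  moreover have "continuous_on (- {p} \<inter> - {q}) (\<lambda>y. f y / \<phi> y)"
    using assms(3) by (intro continuous_on_divide continuous_on_subset[OF assms(1)] continuous_on_subset[OF
        assms(2)]) fastforce+
  moreover have "continuous_on V (\<lambda>y. f y / \<phi> y)"
    using assms(6) by (subst continuous_on_cong[OF refl, of _ _ "\<lambda>_. 0"]) auto
  ultimately have "continuous_on ((- {p} \<inter> - {q}) \<union> V) (\<lambda>y. f y / \<phi> y)"
    using assms(4) by (intro continuous_on_open_Un)
  then show ?thesis by (rule continuous_on_subset) (use assms(5) in auto)
qed

lemma antiderivative_ex:
  fixes h :: "real \<Rightarrow> real"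
  assumes "continuous_on UNIV h"
  obtains F where "\<And>v. (F has_real_derivative h v) (at v)"
proof -
  have "\<exists>F. \<forall>x::real. -\<infinity> < ereal x \<longrightarrow> ereal x < \<infinity> \<longrightarrow> (F has_vector_derivative h x) (at x)"
    using assms by (intro einterval_antiderivative) (auto simp: continuous_on_eq_continuous_at)
  then show ?thesis using that by (auto simp: has_real_derivative_iff_has_vector_derivative)
qed

lemma continuous_shear:
  assumes "continuous_on X f" "continuous_on X g"
  shows "continuous_on X (\<lambda>x. shear \<alpha> (f x) (g x))"
proof -
  have "continuous_on X (\<lambda>x. \<chi> i. shear \<alpha> (f x) (g x) $ i)"
  proof (rule continuous_on_vec_lambda)
    fix i :: 2
    show "continuous_on X (\<lambda>x. shear \<alpha> (f x) (g x) $ i)"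
    proof (cases "i = 1")
      case True
      show ?thesis unfolding True shear_nth by (rule assms)
    next
      case False
      then have i: "i = 2" using exhaust_2[of i] by blast
      show ?thesis unfolding i shear_nth by (intro continuous_intros assms)
    qed
  qed
  then show ?thesis unfolding vec_lambda_eta .
qed

text \<open>In flow coordinates around \<open>P\<close> the function \<open>\<phi>\<close> is
  asymptotic to half the Hessian form, so \<open>f / \<phi>\<close> times the form tends to twice
  the value of \<open>f\<close> at the stopping point; this is the 2 in the limit, and
  \<open>pi / sqrt (det ...)\<close> comes from integrating the reciprocal form.\<close>

lemma occupation_growth:
  fixes f \<phi> :: "torus \<Rightarrow> real" and \<alpha> b :: real and P :: "real^2" and F :: "real \<Rightarrow> real"
  assumes C3: "torus_class_C 3 \<phi>" and \<phi>0: "\<phi> (abs_torus P) = 0" and \<phi>pos: "\<And>y. \<phi> y \<ge> 0"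
    and pd: "positive_definite (torus_hessian \<phi> (abs_torus P))"
    and f: "continuous_on UNIV f" and fpos: "\<And>y. f y \<ge> 0"
    and quot: "continuous_on (- {abs_torus P}) (\<lambda>y. f y / \<phi> y)"
    and trimmed: "trimmed_shift \<alpha> (b + \<alpha> * P $ 1 - P $ 2)"
    and F: "\<And>v. (F has_real_derivative f (abs_torus (shear \<alpha> v b)) / \<phi> (abs_torus (shear \<alpha> v b))) (at v)"
  shows "((\<lambda>w. F w / recip_sum \<alpha> (b + \<alpha> * P $ 1 - P $ 2) (nat \<lfloor>w\<rfloor>)) \<longlongrightarrow>
    2 * pi * f (abs_torus P) / sqrt (det (torus_hessian \<phi> (abs_torus P)))) at_top"
proof -
  define \<beta> where "\<beta> = b + \<alpha> * P $ 1 - P $ 2"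
  \<comment> \<open>\<open>torus_hessian\<close> uses the representative chosen by
    \<open>rep_torus\<close>, which may differ from \<open>P\<close> by a lattice vector; equal
    displacements from either give the same torus point.\<close>
  define P' where "P' = rep_torus (abs_torus P)"
  have P': "abs_torus (P + v) = abs_torus (P' + v)" for v
    by (rule abs_torus_cong_diff) (simp add: P'_def)
  define g where "g x = \<phi> (abs_torus x)" for x
  have hess: "torus_hessian \<phi> (abs_torus P) = hessian g P'"
    by (simp add: torus_hessian_def g_def[abs_def] P'_def)
  have C2: "class_C 2 g"
  proof -
    have "class_C (Suc 2) g" using C3 by (simp add: torus_class_C_def g_def[abs_def])
    moreover have "class_C (Suc n) h \<Longrightarrow> class_C n h" for n and h :: "real^2 \<Rightarrow> real"
    proof (induction n arbitrary: h)
      case 0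
      then show ?case by (auto simp: differentiable_imp_continuous_on differentiable_on_def intro:
          differentiable_at_withinI)
    qed simp
    ultimately show ?thesis by blast
  qed
  obtain A B C where ABC: "definite_form A B C" "definite_form.root_disc A B C
      = sqrt (det (torus_hessian \<phi> (abs_torus P)))"
    "((\<lambda>(w, s). g (P' + shear \<alpha> w s) / definite_form.form A B C w s) \<longlongrightarrow> 1 / 2) (at (0, 0))"
    using hessian_asymptotics[OF C2, of P' \<alpha>] \<phi>0 \<phi>pos pd unfolding hess by (auto simp: g_def P'_def)
  interpret definite_form A B C by (rule ABC(1))
  define K where "K w s = f (abs_torus (P + shear \<alpha> w s)) / \<phi> (abs_torus (P + shear \<alpha> w s))" for w s
  have cont_shear: "continuous_on X (\<lambda>x. abs_torus (P + shear \<alpha> (fst x) (snd x)))" for X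
    by (rule continuous_on_compose2[OF continuous_abs_torus[of UNIV]]) (intro continuous_intros
        continuous_shear, simp)
  have contK: "continuous_on ({-1/2..1/2} \<times> {-1/2..1/2} - {(0, 0)}) (\<lambda>(w, s). K w s)"
    unfolding K_def case_prod_unfold
  proof (rule continuous_on_compose2[OF quot cont_shear], intro subsetI, elim imageE)
    fix y :: torus and x :: "real \<times> real"
    assume y: "y = abs_torus (P + shear \<alpha> (fst x) (snd x))" and x: "x \<in> {-1/2..1/2} \<times> {-1/2..1/2} - {(0, 0)}"
    \<comment> \<open>Only the origin of the square is mapped to the stopping point: otherwise
      \<open>w\<close>, and after it \<open>s\<close>, would be a nonzero integer of absolute value
      at most 1/2.\<close>
    have small: "r = 0" if "r \<in> \<int>" "\<bar>r\<bar> \<le> 1/2" for r :: real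
      using that Ints_nonzero_abs_less1[of r] by auto
    show "y \<in> - {abs_torus P}"
    proof
      assume "y \<in> {abs_torus P}"
      then have i: "\<And>i. shear \<alpha> (fst x) (snd x) $ i \<in> \<int>" unfolding y by (auto simp: abs_torus_eq_iff)
      have "fst x = 0" using i[of 1] x by (intro small) auto
      moreover from this have "snd x = 0" using i[of 2] x by (intro small) auto
      ultimately show False using x by (auto simp: prod_eq_iff)
    qed
  qed
  have limK: "((\<lambda>(w, s). K w s * form w s) \<longlongrightarrow> 2 * f (abs_torus P)) (at (0, 0))"
  proof -
    have "continuous_on UNIV (\<lambda>x. f (abs_torus (P + shear \<alpha> (fst x) (snd x))))"
      by (rule continuous_on_compose2[OF f cont_shear]) simp
    then have "isCont (\<lambda>x. f (abs_torus (P + shear \<alpha> (fst x) (snd x)))) (0, 0)"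
      by (simp add: continuous_on_eq_continuous_at)
    moreover have "P + shear \<alpha> 0 0 = P" by (simp add: vec_eq_iff forall_2)
    ultimately have l1: "((\<lambda>x. f (abs_torus (P + shear \<alpha> (fst x) (snd x)))) \<longlongrightarrow> f (abs_torus P)) (at (0, 0))"
      by (simp add: isCont_def)
    have l2: "((\<lambda>x. inverse (g (P' + shear \<alpha> (fst x) (snd x)) / form (fst x) (snd x)))
        \<longlongrightarrow> inverse (1 / 2)) (at (0, 0))"
      using ABC(3) unfolding case_prod_unfold by (intro tendsto_inverse) auto
    from tendsto_mult[OF l1 l2] show ?thesis
      unfolding case_prod_unfold K_def by (simp add: g_def P' mult.commute)
  qed
  define \<kappa> where "\<kappa> = 2 * f (abs_torus P) * pi / root_disc"
  define G where "G s = integral {-1/2..1/2} (\<lambda>w. K w s)" for s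
  have G: "\<exists>M. \<forall>s\<in>{-1/2..1/2}. s \<noteq> 0 \<longrightarrow> \<bar>G s - \<kappa> / \<bar>s\<bar>\<bar> \<le> e / \<bar>s\<bar> + M" if "e > 0" for e
    using passage_integral[OF contK limK that] unfolding G_def \<kappa>_def by metis
  have sec: "F (P $ 1 + real k + 1/2) - F (P $ 1 + real k - 1/2) = G (\<beta> + real k * \<alpha> - round (\<beta>
      + real k * \<alpha>))" for k
  proof -
    define s where "s = \<beta> + real k * \<alpha> - round (\<beta> + real k * \<alpha>)"
    \<comment> \<open>Advancing by \<open>k\<close> in the first coordinate is invisible on the
      torus and raises the second one by \<open>k * \<alpha>\<close>; subtracting the nearest
      integer brings the passage into the square around \<open>P\<close>, with transversal
      coordinate \<open>s\<close>.\<close>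
    have eq: "abs_torus (shear \<alpha> (w + (P $ 1 + real k)) b) = abs_torus (P + shear \<alpha> w s)" for w
      unfolding abs_torus_eq_iff forall_2 by (simp add: s_def \<beta>_def algebra_simps)
    have "((\<lambda>w. K w s) has_integral F (1/2 + (P $ 1 + real k)) - F (-1/2 + (P $ 1 + real k))) {-1/2..1/2}"
    proof (rule fundamental_theorem_of_calculus)
      fix w :: real
      have "((\<lambda>w. F (w + (P $ 1 + real k))) has_real_derivative K w s) (at w)"
        using F[of "w + (P $ 1 + real k)"] unfolding eq K_def[symmetric] DERIV_shift .
      then show "((\<lambda>w. F (w + (P $ 1 + real k))) has_vector_derivative K w s) (at w within {-1/2..1/2})"
        by (simp add: has_real_derivative_iff_has_vector_derivative has_vector_derivative_at_within)
    qed simp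
    then show ?thesis by (simp add: G_def s_def integral_unique algebra_simps)
  qed
  have "((\<lambda>w. F w / recip_sum \<alpha> \<beta> (nat \<lfloor>w\<rfloor>)) \<longlongrightarrow> \<kappa>) at_top"
    using trimmed[folded \<beta>_def] F _ sec G
        by (rule trimmed_orbit.line_growth[OF trimmed_orbit.intro]) (simp add: fpos \<phi>pos)
  then show ?thesis by (simp add: \<beta>_def \<kappa>_def ABC(2) mult_ac)
qed

lemma det_pos_definite:
  assumes "positive_definite (H :: real^2^2)"
  shows "det H > 0"
  using definite_form.root_disc_pos[OF sheared_hessian(1)[OF assms, of 0]]
  unfolding sheared_hessian(2)[OF assms, of 0] by simp

lemma line_avoids:
  assumes "trimmed_shift \<alpha> (b + \<alpha> * P $ 1 - P $ 2)"
  shows "abs_torus (shear \<alpha> v b) \<noteq> abs_torus P"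
proof
  assume "abs_torus (shear \<alpha> v b) = abs_torus P"
  then have "v - P $ 1 \<in> \<int>" "b + \<alpha> * v - P $ 2 \<in> \<int>" by (auto simp: abs_torus_eq_iff forall_2)
  then obtain k m where k: "v = P $ 1 + of_int k" "b + \<alpha> * v - P $ 2 = of_int m"
    by (auto elim!: Ints_cases simp: algebra_simps)
  then have "b + \<alpha> * P $ 1 - P $ 2 + of_int k * \<alpha> = of_int m" by (simp add: algebra_simps)
  then have "b + \<alpha> * P $ 1 - P $ 2 + of_int k * \<alpha> \<in> \<int>" by simp
  then show False using assms unfolding trimmed_shift_def dist_int_pos_iff by blast
qed

text \<open>The line consists of the points \<open>(v, b + \<alpha> * v)\<close>. The lifts
  \<open>P\<close> and \<open>Q\<close> are taken on one line in the plane, so the shifts belonging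
  to the two stopping points agree exactly and not merely modulo 1.\<close>

locale two_stop_line =
  fixes \<alpha> b :: real and \<phi> :: "torus \<Rightarrow> real" and P Q :: "real^2" and \<Phi> :: "real \<Rightarrow> torus \<Rightarrow> torus"
  assumes flow: "reparametrized_linear_flow \<alpha> \<phi> (abs_torus P) (abs_torus Q) \<Phi>"
    and trimmed: "trimmed_shift \<alpha> (b + \<alpha> * P $ 1 - P $ 2)"
    and orbit: "\<alpha> * Q $ 1 - Q $ 2 = \<alpha> * P $ 1 - P $ 2"
begin

abbreviation "dp \<equiv> det (torus_hessian \<phi> (abs_torus P))"
abbreviation "dq \<equiv> det (torus_hessian \<phi> (abs_torus Q))"
abbreviation "passages w \<equiv> recip_sum \<alpha> (b + \<alpha> * P $ 1 - P $ 2) (nat \<lfloor>w :: real\<rfloor>)"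

lemma orbit': "b + \<alpha> * Q $ 1 - Q $ 2 = b + \<alpha> * P $ 1 - P $ 2"
  using orbit by simp

lemma line_avoids_P: "abs_torus (shear \<alpha> v b) \<noteq> abs_torus P"
  by (rule line_avoids[OF trimmed])

lemma line_avoids_Q: "abs_torus (shear \<alpha> v b) \<noteq> abs_torus Q"
  using trimmed unfolding orbit'[symmetric] by (rule line_avoids)

lemma line_range_P: "range (\<lambda>v. abs_torus (shear \<alpha> v b)) \<subseteq> - {abs_torus P}"
proof (intro image_subsetI ComplI)
  fix v assume "abs_torus (shear \<alpha> v b) \<in> {abs_torus P}"
  then show False using line_avoids_P[of v] by simp
qed

lemma line_range_Q: "range (\<lambda>v. abs_torus (shear \<alpha> v b)) \<subseteq> - {abs_torus Q}"
proof (intro image_subsetI ComplI)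
  fix v assume "abs_torus (shear \<alpha> v b) \<in> {abs_torus Q}"
  then show False using line_avoids_Q[of v] by simp
qed

lemma \<phi>_facts:
  shows \<phi>_C3: "torus_class_C 3 \<phi>" and \<phi>_P: "\<phi> (abs_torus P) = 0" and \<phi>_Q: "\<phi> (abs_torus Q) = 0"
    and \<phi>_pos: "\<And>y. y \<noteq> abs_torus P \<Longrightarrow> y \<noteq> abs_torus Q \<Longrightarrow> \<phi> y > 0"
    and PQ: "abs_torus P \<noteq> abs_torus Q"
    and pdP: "positive_definite (torus_hessian \<phi> (abs_torus P))"
        and pdQ: "positive_definite (torus_hessian \<phi> (abs_torus Q))"
  using flow unfolding reparametrized_linear_flow_def by auto

lemma \<phi>_nonneg: "\<phi> y \<ge> 0"
  using \<phi>_P \<phi>_Q \<phi>_pos[of y] by force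

lemma \<phi>_cont: "continuous_on UNIV \<phi>"
  using \<phi>_C3 unfolding torus_class_C_def continuous_on_torus_iff
  by (auto simp: numeral_3_eq_3 intro!: differentiable_imp_continuous_on simp: differentiable_on_def intro:
      differentiable_at_withinI)

lemma line_cont: "continuous_on UNIV (\<lambda>v. abs_torus (shear \<alpha> v b))"
  by (rule continuous_on_compose2[OF continuous_abs_torus[of UNIV]]) (intro continuous_intros
      continuous_shear, simp)

lemma line_occupation_nonneg:
  assumes f: "continuous_on UNIV f" and fpos: "\<And>y. f y \<ge> 0"
  obtains F where "\<And>v. (F has_real_derivative f (abs_torus (shear \<alpha> v b)) / \<phi> (abs_torus (shear \<alpha> v b))) (at
      v)"
    "((\<lambda>w. F w / passages w) \<longlongrightarrow> 2 * pi * (f (abs_torus P) / sqrt dp + f (abs_torus Q) / sqrt dq)) at_top"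
proof -
  obtain \<zeta> U V where z: "continuous_on UNIV \<zeta>" "\<And>y. 0 \<le> \<zeta> y" "\<And>y. \<zeta> y \<le> (1::real)"
    "open U" "abs_torus P \<in> U" "\<And>y. y \<in> U \<Longrightarrow> \<zeta> y = 1" "open V" "abs_torus Q \<in> V" "\<And>y. y \<in> V \<Longrightarrow> \<zeta> y = 0"
    using torus_bump[OF PQ] by blast
  \<comment> \<open>Each summand of \<open>f\<close> sees only one of the two singularities of \<open>1 / \<phi>\<close>.\<close>
  define f1 f2 where "f1 y = f y * \<zeta> y" and "f2 y = f y * (1 - \<zeta> y)" for y
  have c1: "continuous_on UNIV f1" "continuous_on UNIV f2"
    unfolding f1_def f2_def by (intro continuous_intros f z(1))+
  have p1: "f1 y \<ge> 0" "f2 y \<ge> 0" for y using fpos[of y] z(2,3)[of y] by (auto simp: f1_def f2_def)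
  have q1: "continuous_on (- {abs_torus P}) (\<lambda>y. f1 y / \<phi> y)"
    by (rule continuous_quotient_zero_near[OF c1(1) \<phi>_cont \<phi>_pos z(7,8)]) (auto simp: f1_def z(9))
  have q2: "continuous_on (- {abs_torus Q}) (\<lambda>y. f2 y / \<phi> y)"
    by (rule continuous_quotient_zero_near[OF c1(2) \<phi>_cont \<phi>_pos z(4,5)]) (auto simp: f2_def z(6))
  have "continuous_on UNIV (\<lambda>v. f1 (abs_torus (shear \<alpha> v b)) / \<phi> (abs_torus (shear \<alpha> v b)))"
    by (rule continuous_on_compose2[OF q1 line_cont]) (rule line_range_P)
  from antiderivative_ex[OF this] obtain F1
      where F1: "\<And>v. (F1 has_real_derivative f1 (abs_torus (shear \<alpha> v b)) / \<phi> (abs_torus (shear \<alpha> v b))) (at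
          v)"
    by blast
  have "continuous_on UNIV (\<lambda>v. f2 (abs_torus (shear \<alpha> v b)) / \<phi> (abs_torus (shear \<alpha> v b)))"
    by (rule continuous_on_compose2[OF q2 line_cont]) (rule line_range_Q)
  from antiderivative_ex[OF this] obtain F2
      where F2: "\<And>v. (F2 has_real_derivative f2 (abs_torus (shear \<alpha> v b)) / \<phi> (abs_torus (shear \<alpha> v b))) (at
          v)"
    by blast
  have g1: "((\<lambda>w. F1 w / passages w) \<longlongrightarrow> 2 * pi * f1 (abs_torus P) / sqrt dp) at_top"
    by (rule occupation_growth[OF \<phi>_C3 \<phi>_P \<phi>_nonneg pdP c1(1) p1(1) q1 trimmed F1])
  have g2: "((\<lambda>w. F2 w / passages w) \<longlongrightarrow> 2 * pi * f2 (abs_torus Q) / sqrt dq) at_top"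
    using occupation_growth[OF \<phi>_C3 \<phi>_Q \<phi>_nonneg pdQ c1(2) p1(2) q2 trimmed[folded orbit'] F2] unfolding
        orbit' .
  show ?thesis
  proof (rule that[of "\<lambda>w. F1 w + F2 w"])
    show "((\<lambda>w. F1 w + F2 w) has_real_derivative f (abs_torus (shear \<alpha> v b)) / \<phi> (abs_torus (shear \<alpha> v b)))
        (at v)" for v
      using DERIV_add[OF F1[of v] F2[of v]]
          by (simp add: f1_def f2_def add_divide_distrib[symmetric] algebra_simps)
    show "((\<lambda>w. (F1 w + F2 w) / passages w) \<longlongrightarrow> 2 * pi * (f (abs_torus P) / sqrt dp
        + f (abs_torus Q) / sqrt dq)) at_top"
      using tendsto_add[OF g1 g2] by (simp add: f1_def f2_def z(5,6,8,9) add_divide_distrib distrib_left)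
  qed
qed

text \<open>The growth estimate rests on monotone occupation times and so covers nonnegative
  functions; adding a bound \<open>B\<close> to \<open>f\<close> and subtracting the result for the
  constant \<open>B\<close> extends it by linearity.\<close>

lemma line_occupation:
  assumes f: "continuous_on UNIV f"
  obtains F where "\<And>v. (F has_real_derivative f (abs_torus (shear \<alpha> v b)) / \<phi> (abs_torus (shear \<alpha> v b))) (at
      v)"
    "((\<lambda>w. F w / passages w) \<longlongrightarrow> 2 * pi * (f (abs_torus P) / sqrt dp + f (abs_torus Q) / sqrt dq)) at_top"
proof -
  obtain B where B: "B > 0" "\<And>y. \<bar>f y\<bar> \<le> B" using continuous_torus_bounded[OF f] by blast
  have c: "continuous_on UNIV (\<lambda>y. f y + B)" by (intro continuous_intros f)
  have "f y + B \<ge> 0" for y using B(2)[of y] by linarith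
  from line_occupation_nonneg[OF c this] obtain F1
    where F1: "\<And>v. (F1 has_real_derivative (f (abs_torus (shear \<alpha> v b))
        + B) / \<phi> (abs_torus (shear \<alpha> v b))) (at v)"
      "((\<lambda>w. F1 w / passages w) \<longlongrightarrow> 2 * pi * ((f (abs_torus P) + B) / sqrt dp + (f (abs_torus Q)
          + B) / sqrt dq)) at_top"
    by blast
  obtain F2
    where F2: "\<And>v. (F2 has_real_derivative B / \<phi> (abs_torus (shear \<alpha> v b))) (at v)"
      "((\<lambda>w. F2 w / passages w) \<longlongrightarrow> 2 * pi * (B / sqrt dp + B / sqrt dq)) at_top"
    using line_occupation_nonneg[of "\<lambda>_. B"] B(1) by (auto simp: less_imp_le)
  show ?thesis
  proof (rule that[of "\<lambda>w. F1 w - F2 w"])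
    show "((\<lambda>w. F1 w - F2 w) has_real_derivative f (abs_torus (shear \<alpha> v b)) / \<phi> (abs_torus (shear \<alpha> v b)))
        (at v)" for v
      using DERIV_diff[OF F1(1)[of v] F2(1)[of v]] by (simp add: diff_divide_distrib[symmetric])
    have e: "2 * pi * ((f (abs_torus P) + B) / sqrt dp + (f (abs_torus Q) + B) / sqrt dq)
        - 2 * pi * (B / sqrt dp + B / sqrt dq)
      = 2 * pi * (f (abs_torus P) / sqrt dp + f (abs_torus Q) / sqrt dq)"
      by (simp add: add_divide_distrib distrib_left)
    show "((\<lambda>w. (F1 w - F2 w) / passages w) \<longlongrightarrow> 2 * pi * (f (abs_torus P) / sqrt dp
        + f (abs_torus Q) / sqrt dq)) at_top"
      using tendsto_diff[OF F1(2) F2(2)] unfolding e by (simp add: diff_divide_distrib)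
  qed
qed

lemma passages_at_top: "filterlim passages at_top at_top"
  using filterlim_compose[OF trimmed_orbit.recip_sum_at_top[OF trimmed_orbit.intro[OF trimmed]]
      filterlim_nat_floor_diff[of 0]] by simp

text \<open>The first coordinate \<open>u\<close> of the lifted orbit has derivative
  \<open>\<phi>\<close>, so a time integral of \<open>f\<close> is an increment of the primitive of
  \<open>f / \<phi>\<close> along the line; for \<open>f = 1\<close> the increment is
  \<open>t\<close> itself. The time average is thus a quotient of two increments, and the common
  growth rate \<open>passages\<close> cancels.\<close>

lemma orbit_average:
  assumes x: "b = x $ 2 - \<alpha> * x $ 1"
  shows "continuous_on UNIV (\<lambda>t. \<Phi> t (abs_torus x))"
    and "continuous_on UNIV f \<Longrightarrow> ((\<lambda>t. (1 / t) * integral {0..t} (\<lambda>s. f (\<Phi> s (abs_torus x)))) \<longlongrightarrow>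
      (f (abs_torus P) / sqrt dp + f (abs_torus Q) / sqrt dq) / (1 / sqrt dp + 1 / sqrt dq)) at_top"
proof -
  have "flow_generated_by (\<lambda>x. \<phi> x *\<^sub>R linear_field \<alpha>) \<Phi>"
    using flow unfolding reparametrized_linear_flow_def by blast
  then obtain c where c: "c 0 = x" "\<And>t. (c has_vector_derivative \<phi> (abs_torus (c t)) *\<^sub>R linear_field \<alpha>) (at
      t)"
    "\<And>t. \<Phi> t (abs_torus x) = abs_torus (c t)"
    unfolding flow_generated_by_def by blast
  define u where "u t = c t $ 1" for t
  have c1: "(u has_real_derivative \<phi> (abs_torus (c t))) (at t)" for t
    using bounded_linear.has_vector_derivative[OF bounded_linear_vec_nth[of 1] c(2)[of t]]
    by (simp add: u_def[abs_def] linear_field_def has_real_derivative_iff_has_vector_derivative)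
  have c2: "((\<lambda>t. c t $ 2) has_real_derivative \<phi> (abs_torus (c t)) * \<alpha>) (at t)" for t
    using bounded_linear.has_vector_derivative[OF bounded_linear_vec_nth[of 2] c(2)[of t]]
    by (simp add: linear_field_def has_real_derivative_iff_has_vector_derivative)
  \<comment> \<open>The field has constant direction, so this quantity is a first integral and the
    orbit stays on its line.\<close>
  have "((\<lambda>t. c t $ 2 - \<alpha> * u t) has_real_derivative 0) (at t)" for t
    using DERIV_diff[OF c2[of t] DERIV_cmult[OF c1[of t], of \<alpha>]] by (simp add: mult.commute)
  then have "c t $ 2 - \<alpha> * u t = c 0 $ 2 - \<alpha> * u 0" for t
    using DERIV_isconst_all[of "\<lambda>t. c t $ 2 - \<alpha> * u t" t 0] by blast
  then have c_eq: "c t = shear \<alpha> (u t) b" for t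
    by (simp add: vec_eq_iff forall_2 u_def c(1) x algebra_simps)
  have "continuous_on UNIV c"
    by (intro continuous_at_imp_continuous_on ballI has_vector_derivative_continuous[OF c(2)])
  then show "continuous_on UNIV (\<lambda>t. \<Phi> t (abs_torus x))"
    unfolding c(3) by (rule continuous_on_compose2[OF continuous_abs_torus[of UNIV]]) simp
  have \<phi>_line: "\<phi> (abs_torus (shear \<alpha> v b)) > 0" for v by (intro \<phi>_pos line_avoids_P line_avoids_Q)
  have int: "integral {0..t} (\<lambda>s. g (\<Phi> s (abs_torus x))) = F (u t) - F (u 0)"
    if F: "\<And>v. (F has_real_derivative g (abs_torus (shear \<alpha> v b)) / \<phi> (abs_torus (shear \<alpha> v b))) (at v)"
      and t: "t \<ge> 0" for F g t
  proof (rule integral_unique, rule fundamental_theorem_of_calculus[OF t])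
    fix s
    have "((\<lambda>s. F (u s)) has_real_derivative
        (g (abs_torus (c s)) / \<phi> (abs_torus (c s))) * \<phi> (abs_torus (c s))) (at s)"
      using DERIV_chain2[OF F c1] unfolding c_eq[symmetric] .
    then have "((\<lambda>s. F (u s)) has_real_derivative g (\<Phi> s (abs_torus x))) (at s)"
      using \<phi>_line[of "u s"] by (simp add: c(3) c_eq)
    then show "((\<lambda>s. F (u s)) has_vector_derivative g (\<Phi> s (abs_torus x))) (at s within {0..t})"
      by (simp add: has_real_derivative_iff_has_vector_derivative has_vector_derivative_at_within)
  qed
  obtain T where T: "\<And>v. (T has_real_derivative 1 / \<phi> (abs_torus (shear \<alpha> v b))) (at v)"
    "((\<lambda>w. T w / passages w) \<longlongrightarrow> 2 * pi * (1 / sqrt dp + 1 / sqrt dq)) at_top"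
    using line_occupation[of "\<lambda>_. 1"] by auto
  have Tt: "T (u t) - T (u 0) = t" if "t \<ge> 0" for t
    using int[of T "\<lambda>_. 1" t] T(1) that by simp
  have Tmono: "T v \<le> T w" if "v \<le> w" for v w
    by (rule DERIV_nonneg_imp_nondecreasing[OF that]) (use T(1) \<phi>_line in \<open>metis divide_nonneg_pos
        zero_le_one\<close>)
  \<comment> \<open>The elapsed time \<open>T (u t) - T (u 0) = t\<close> is unbounded while
    \<open>T\<close> is nondecreasing, so \<open>u\<close> cannot stay below any
    \<open>Z\<close>.\<close>
  have utop: "filterlim u at_top at_top"
    unfolding filterlim_at_top
  proof
    fix Z
    show "\<forall>\<^sub>F t in at_top. Z \<le> u t"
      using eventually_gt_at_top[of "max 0 (T Z - T (u 0))"]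
    proof eventually_elim
      case (elim t)
      then show ?case using Tt[of t] Tmono[of "u t" Z] by linarith
    qed
  qed
  have pos: "dp > 0" "dq > 0" using pdP pdQ det_pos_definite by auto
  have const: "((\<lambda>w. a / passages w) \<longlongrightarrow> 0) at_top" for a :: real
    by (rule tendsto_divide_0[OF tendsto_const filterlim_at_top_imp_at_infinity[OF passages_at_top]])
  show "((\<lambda>t. (1 / t) * integral {0..t} (\<lambda>s. f (\<Phi> s (abs_torus x)))) \<longlongrightarrow>
      (f (abs_torus P) / sqrt dp + f (abs_torus Q) / sqrt dq) / (1 / sqrt dp + 1 / sqrt dq)) at_top"
    if f: "continuous_on UNIV f"
  proof -
    obtain F where F: "\<And>v. (F has_real_derivative f (abs_torus (shear \<alpha> v b)) / \<phi> (abs_torus (shear \<alpha> v b)))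
        (at v)"
      "((\<lambda>w. F w / passages w) \<longlongrightarrow> 2 * pi * (f (abs_torus P) / sqrt dp + f (abs_torus Q) / sqrt dq)) at_top"
      using line_occupation[OF f] by blast
    have s: "1 / sqrt dp + 1 / sqrt dq > 0" using pos by (simp add: add_pos_pos)
    have "((\<lambda>w. (F w / passages w - F (u 0) / passages w) / (T w / passages w - T (u 0) / passages w)) \<longlongrightarrow>
      (2 * pi * (f (abs_torus P) / sqrt dp + f (abs_torus Q) / sqrt dq) - 0) / (2 * pi * (1 / sqrt dp
          + 1 / sqrt dq) - 0)) at_top"
      using s by (intro tendsto_divide tendsto_diff F(2) T(2) const) auto
    moreover have "\<forall>\<^sub>F w in at_top. (F w / passages w - F (u 0) / passages w) / (T w / passages w
        - T (u 0) / passages w)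
       = (F w - F (u 0)) / (T w - T (u 0))"
    proof -
      have "\<forall>\<^sub>F w in at_top. passages w \<ge> 1" using passages_at_top unfolding filterlim_at_top by blast
      then show ?thesis by (rule eventually_mono) (simp add: diff_divide_distrib[symmetric])
    qed
    ultimately have "((\<lambda>w. (F w - F (u 0)) / (T w - T (u 0))) \<longlongrightarrow>
      (2 * pi * (f (abs_torus P) / sqrt dp + f (abs_torus Q) / sqrt dq) - 0) / (2 * pi * (1 / sqrt dp
          + 1 / sqrt dq) - 0)) at_top"
      by (rule Lim_transform_eventually)
    from filterlim_compose[OF this utop]
    have "((\<lambda>t. (F (u t) - F (u 0)) / (T (u t) - T (u 0))) \<longlongrightarrow>
      (f (abs_torus P) / sqrt dp + f (abs_torus Q) / sqrt dq) / (1 / sqrt dp + 1 / sqrt dq)) at_top"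
      by simp
    moreover have "\<forall>\<^sub>F t in at_top. (F (u t) - F (u 0)) / (T (u t) - T (u 0))
        = (1 / t) * integral {0..t} (\<lambda>s. f (\<Phi> s (abs_torus x)))"
      using eventually_ge_at_top[of 0]
    proof eventually_elim
      case (elim t)
      then show ?case using Tt[OF elim] int[of F f t] F(1) by simp
    qed
    ultimately show ?thesis by (rule Lim_transform_eventually)
  qed
qed

end

section \<open>Almost every point is attracted\<close>

lemma shear_measurable: "(\<lambda>(a, s). shear 0 a s) \<in> measurable (lborel \<Otimes>\<^sub>M lborel) borel"
proof -
  have "continuous_on UNIV (\<lambda>x :: real \<times> real. shear 0 (fst x) (snd x))"
    by (intro continuous_shear continuous_intros)
  from borel_measurable_continuous_onI[OF this] show ?thesis
    unfolding case_prod_unfold lborel_prod by simp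
qed

lemma lborel_vec2: "lborel = distr (lborel \<Otimes>\<^sub>M lborel) borel (\<lambda>(a, s). shear 0 a s)"
proof (rule lborel_eqI)
  fix l u :: "real^2" assume lu: "\<And>b. b \<in> Basis \<Longrightarrow> l \<bullet> b \<le> u \<bullet> b"
  have B: "(Basis :: (real^2) set) = {axis 1 1, axis 2 1}"
    by (auto simp: Basis_vec_def UNIV_2)
  have ne: "axis 1 1 \<noteq> (axis 2 1 :: real^2)" by (simp add: axis_eq_axis)
  have le: "l $ 1 \<le> u $ 1" "l $ 2 \<le> u $ 2" using lu[of "axis 1 1"] lu[of "axis 2 1"]
      by (auto simp: B inner_axis)
  have pre: "(\<lambda>(a, s). shear 0 a s) -` box l u \<inter> space (lborel \<Otimes>\<^sub>M lborel)
      = {l $ 1<..<u $ 1} \<times> {l $ 2<..<u $ 2}"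
    by (auto simp: space_pair_measure mem_box_cart forall_2)
  have "emeasure (distr (lborel \<Otimes>\<^sub>M lborel) borel (\<lambda>(a, s). shear 0 a s)) (box l u)
      = emeasure (lborel \<Otimes>\<^sub>M lborel) ({l $ 1<..<u $ 1} \<times> {l $ 2<..<u $ 2})"
    by (subst emeasure_distr[OF shear_measurable]) (simp_all only: pre borel_open open_box)
  also have "\<dots> = ennreal (u $ 1 - l $ 1) * ennreal (u $ 2 - l $ 2)"
    using le by (subst lborel.emeasure_pair_measure_Times) auto
  also have "\<dots> = (\<Prod>b\<in>Basis. (u - l) \<bullet> b)"
    unfolding B using ne le by (simp add: inner_axis ennreal_mult)
  finally show "emeasure (distr (lborel \<Otimes>\<^sub>M lborel) borel (\<lambda>(a, s). shear 0 a s)) (box l u) = (\<Prod>b\<in>Basis. (u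
      - l) \<bullet> b)" .
qed simp

lemma measurable_vec_nth [measurable]: "(\<lambda>x :: real^2. x $ i) \<in> borel_measurable borel"
  by (intro borel_measurable_continuous_onI continuous_intros)

lemma fundamental_square_measurable: "{x :: real^2. \<forall>i. 0 \<le> x $ i \<and> x $ i < 1} \<in> sets borel"
proof -
  have "{x \<in> space borel. (0 \<le> x $ 1 \<and> x $ 1 < 1) \<and> (0 \<le> x $ 2 \<and> x $ 2 < 1)}
      \<in> sets (borel :: (real^2) measure)"
    by measurable
  then show ?thesis by (simp add: forall_2)
qed

lemma abs_torus_measurable: "abs_torus \<in> measurable (restrict_space lborel X) borel"
  using borel_measurable_continuous_onI[OF continuous_abs_torus[of UNIV]]
  by (intro measurable_restrict_space1) (simp cong: measurable_cong_sets)

text \<open>For fixed first coordinate the argument of \<open>T\<close> is a translate of the second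
  coordinate, so each slice of the exceptional set is null and Fubini applies. Fractional parts
  select the representative in the unit square, whatever \<open>rep_torus\<close> returns.\<close>

lemma AE_torus_transversal:
  fixes T :: "real \<Rightarrow> bool" and \<alpha> c :: real
  assumes "AE s in lborel. T s"
  shows "AE y in torus_lebesgue. T (frac (rep_torus y $ 2) - \<alpha> * frac (rep_torus y $ 1) + c)"
proof -
  \<comment> \<open>Measurability of \<open>T\<close> is not assumed; a Borel null set containing
    the exceptions takes its place.\<close>
  obtain N where N: "N \<in> null_sets lborel" "{s. \<not> T s} \<subseteq> N"
    using assms unfolding eventually_ae_filter by auto
  have Nb [measurable]: "N \<in> sets borel" using N(1) by auto
  have N0: "AE s in lborel. s \<notin> N" using N(1) by (rule AE_not_in)
  define Sq where "Sq = {x :: real^2. \<forall>i. 0 \<le> x $ i \<and> x $ i < 1}"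
  have Sq: "Sq \<in> sets borel" unfolding Sq_def by (rule fundamental_square_measurable)
  have "AE x in (lborel :: (real^2) measure). x $ 2 - \<alpha> * x $ 1 + c \<notin> N"
  proof (subst lborel_vec2, subst AE_distr_iff)
    show "(\<lambda>(a, s). shear 0 a s) \<in> measurable (lborel \<Otimes>\<^sub>M lborel) borel" by (rule shear_measurable)
    show "{x \<in> space borel. x $ 2 - \<alpha> * x $ 1 + c \<notin> N} \<in> sets (borel :: (real^2) measure)" by measurable
    have "AE p in lborel \<Otimes>\<^sub>M lborel. snd p - \<alpha> * fst p + c \<notin> N"
    proof (rule lborel_pair.AE_pair_measure)
      show "{x \<in> space (lborel \<Otimes>\<^sub>M lborel). snd x - \<alpha> * fst x + c \<notin> N} \<in> sets (lborel \<Otimes>\<^sub>M lborel)"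
        by measurable
      have "AE s in lborel. s - \<alpha> * a + c \<notin> N" for a
        using AE_borel_affine[of 1 "\<lambda>s. s \<notin> N" "c - \<alpha> * a"] N0 by (simp add: algebra_simps)
      then show "AE x in lborel. AE y in lborel. snd (x, y) - \<alpha> * fst (x, y) + c \<notin> N" by simp
    qed
    then show "AE x in lborel \<Otimes>\<^sub>M lborel. (case x of (a, s) \<Rightarrow> shear 0 a s) $ 2
        - \<alpha> * (case x of (a, s) \<Rightarrow> shear 0 a s) $ 1 + c \<notin> N"
      by (simp add: case_prod_unfold)
  qed
  then have "AE x in restrict_space lborel Sq. frac (x $ 2) - \<alpha> * frac (x $ 1) + c \<notin> N"
    using Sq by (subst AE_restrict_space_iff) (auto simp: Sq_def frac_eq[THEN iffD2] elim!: eventually_mono)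
  then have "AE y in distr (restrict_space lborel Sq) borel abs_torus. frac (rep_torus y $ 2)
      - \<alpha> * frac (rep_torus y $ 1) + c \<notin> N"
    by (subst AE_distr_iff[OF abs_torus_measurable]) (simp_all, measurable)
  then have "AE y in torus_lebesgue. frac (rep_torus y $ 2) - \<alpha> * frac (rep_torus y $ 1) + c \<notin> N"
    unfolding torus_lebesgue_def Sq_def[symmetric] by (rule AE_completion)
  then show ?thesis by eventually_elim (use N(2) in blast)
qed

lemma space_torus_lebesgue: "space torus_lebesgue = UNIV"
  by (simp add: torus_lebesgue_def)

lemma emeasure_torus_lebesgue_UNIV: "emeasure torus_lebesgue UNIV \<noteq> 0"
proof
  define Sq where "Sq = {x :: real^2. \<forall>i. 0 \<le> x $ i \<and> x $ i < 1}"
  have Sq: "Sq \<in> sets borel" unfolding Sq_def by (rule fundamental_square_measurable)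
  assume "emeasure torus_lebesgue UNIV = 0"
  then have "UNIV \<in> null_sets torus_lebesgue" by (auto simp: null_sets_def torus_lebesgue_def)
  then have "UNIV \<in> null_sets (distr (restrict_space lborel Sq) borel abs_torus)"
    unfolding torus_lebesgue_def Sq_def[symmetric] by (subst (asm) null_sets_completion_iff) auto
  then have "emeasure (distr (restrict_space lborel Sq) borel abs_torus) UNIV = 0" by auto
  then have "emeasure lborel Sq = 0"
    using Sq abs_torus_measurable[of Sq] by (simp add: emeasure_distr space_restrict_space
        emeasure_restrict_space)
  moreover have "box (vector [0, 0]) (vector [1, 1]) \<subseteq> Sq" by (auto simp: Sq_def mem_box_cart forall_2)
  ultimately have "box (vector [0, 0]) (vector [1, 1] :: real^2) \<in> null_sets lborel"
    using Sq null_sets_subset[of Sq lborel] by (auto simp: null_sets_def)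
  then have "negligible (box (vector [0, 0]) (vector [1, 1] :: real^2))"
    by (simp add: negligible_iff_null_sets null_sets_completionI)
  moreover have "vector [1/2, 1/2] \<in> box (vector [0, 0]) (vector [1, 1] :: real^2)"
      by (simp add: mem_box_cart forall_2)
  ultimately show False by (metis empty_iff open_box open_not_negligible)
qed

text \<open>Division by \<open>a * b\<close> explains the crossed weights: the weight of
  \<open>p\<close> is \<open>(1 / a) / (1 / a + 1 / b)\<close>, its share of the occupation
  time.\<close>

lemma mu_infinity_props:
  assumes "det (torus_hessian \<phi> p) > 0" "det (torus_hessian \<phi> q) > 0"
  defines "a \<equiv> sqrt (det (torus_hessian \<phi> p))" and "b \<equiv> sqrt (det (torus_hessian \<phi> q))"
  shows "mu_infinity \<phi> p q \<in> borel_probs"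
    and "continuous_on UNIV f \<Longrightarrow> (\<integral>y. f y \<partial>mu_infinity \<phi> p q) = (f p / a + f q / b) / (1 / a + 1 / b)"
proof -
  have ab: "a > 0" "b > 0" using assms by (auto simp: a_def b_def)
  define w where "w = b / (a + b)"
  have w: "0 \<le> w" "w \<le> 1" "1 - w = a / (a + b)" using ab by (auto simp: w_def field_simps)
  have mu: "mu_infinity \<phi> p q = measure_of UNIV (sets borel) (\<lambda>A. ennreal w * emeasure (return borel p) A
      + ennreal (1 - w) * emeasure (return borel q) A)"
    unfolding w(3) by (simp add: mu_infinity_def Let_def w_def a_def b_def)
  show "mu_infinity \<phi> p q \<in> borel_probs" unfolding mu by (rule measure_of_two_points(1)[OF w(1,2)])
  assume "continuous_on UNIV f"
  then have "(\<integral>y. f y \<partial>mu_infinity \<phi> p q) = w * f p + (1 - w) * f q"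
    unfolding mu by (intro measure_of_two_points(2)[OF w(1,2)] borel_measurable_continuous_onI)
  also have "\<dots> = (b * f p + a * f q) / (a + b)" unfolding w(3) by (simp add: w_def add_divide_distrib)
  also have "\<dots> = ((b * f p + a * f q) / (a * b)) / ((a + b) / (a * b))" using ab by simp
  also have "(b * f p + a * f q) / (a * b) = f p / a + f q / b" using ab by (simp add: add_divide_distrib)
  also have "(a + b) / (a * b) = 1 / a + 1 / b" using ab by (simp add: add_divide_distrib)
  finally show "(\<integral>y. f y \<partial>mu_infinity \<phi> p q) = (f p / a + f q / b) / (1 / a + 1 / b)" .
qed

lemma AE_trimmed_shift:
  assumes "\<alpha> \<notin> \<rat>" "\<exists>C>0. \<exists>\<gamma>>0. \<forall>n::nat. real_of_int (convergent_denom \<alpha> n) \<ge> C * exp (real n powr (2 + \<gamma>))"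
  shows "AE \<beta> in lborel. trimmed_shift \<alpha> \<beta>"
proof -
  interpret irrational_cfrac \<alpha> by unfold_locales (rule assms(1))
  obtain C \<gamma> where C: "C > 0" "\<gamma> > 0" "\<And>n. convergent_denom \<alpha> n \<ge> C * exp (real n powr (2 + \<gamma>))"
    using assms(2) by blast
  define D where "D n = nat (convergent_denom \<alpha> n)" for n
  have D: "int (D n) = convergent_denom \<alpha> n" for n using convergent_denom_pos[of n] by (simp add: D_def)
  then have D': "real (D n) = convergent_denom \<alpha> n" for n by (metis of_int_of_nat_eq)
  show ?thesis
  proof (rule trimmed_shift_AE[where D = D and A = "\<lambda>n. cnum (Suc n)" and C = C and \<gamma> = \<gamma>])
    show "D n > 0" "D n \<le> D (Suc n)" for n
      using convergent_denom_pos[of n] convergent_denom_mono[of n] by (auto simp: D_def)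
  qed (use C convergent_coprime convergent_error in \<open>simp_all add: D D' del: cfrac_num.simps\<close>)
qed

theorem theorem8p2:
  fixes \<alpha> :: real and \<phi> :: "torus \<Rightarrow> real" and p q :: torus
    and \<Phi> :: "real \<Rightarrow> torus \<Rightarrow> torus"
  assumes "reparametrized_linear_flow \<alpha> \<phi> p q \<Phi>"
    and "same_linear_orbit \<alpha> p q"
    and "\<exists>C>0. \<exists>\<gamma>>0. \<forall>n::nat.
           real_of_int (convergent_denom \<alpha> n) \<ge> C * exp (real n powr (2 + \<gamma>))"
  shows "(\<exists>!\<mu>. physical_measure \<Phi> \<mu>)
       \<and> physical_measure \<Phi> (mu_infinity \<phi> p q)
       \<and> (AE x in torus_lebesgue. x \<in> basin \<Phi> (mu_infinity \<phi> p q))"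
proof -
  let ?\<mu> = "mu_infinity \<phi> p q"
  obtain P r where P: "p = abs_torus P" and q: "q = abs_torus (P + r *\<^sub>R linear_field \<alpha>)"
    using assms(2) unfolding same_linear_orbit_def by blast
  define Q where "Q = P + r *\<^sub>R linear_field \<alpha>"
  have Q: "q = abs_torus Q" by (simp add: q Q_def)
  have orbit: "\<alpha> * Q $ 1 - Q $ 2 = \<alpha> * P $ 1 - P $ 2" by (simp add: Q_def linear_field_def algebra_simps)
  have pd: "positive_definite (torus_hessian \<phi> p)" "positive_definite (torus_hessian \<phi> q)" and irr: "\<alpha> \<notin> \<rat>"
    using assms(1) by (auto simp: reparametrized_linear_flow_def)
  note \<mu> = mu_infinity_props[OF det_pos_definite[OF pd(1)] det_pos_definite[OF pd(2)]]
  have attract: "y \<in> basin \<Phi> ?\<mu>"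
    if y: "trimmed_shift \<alpha> (frac (rep_torus y $ 2) - \<alpha> * frac (rep_torus y $ 1) + (\<alpha> * P $ 1 - P $ 2))" for y
  proof -
    define x where "x = shear 0 (frac (rep_torus y $ 1)) (frac (rep_torus y $ 2))"
    have "abs_torus x = abs_torus (rep_torus y)" unfolding abs_torus_eq_iff
        by (simp add: x_def forall_2 frac_def)
    then have yx: "y = abs_torus x" by simp
    have tr: "trimmed_shift \<alpha> ((x $ 2 - \<alpha> * x $ 1) + \<alpha> * P $ 1 - P $ 2)"
      using y by (simp add: x_def algebra_simps)
    note avg = two_stop_line.orbit_average[OF two_stop_line.intro[OF assms(1)[unfolded P Q] tr orbit] refl]
    have "p_omega \<Phi> y = {?\<mu>}"
      unfolding yx
    proof (rule p_omega_eq_singleton[where \<Phi> = \<Phi> and x = "abs_torus x", OF avg(1) \<mu>(1)])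
      fix f :: "torus \<Rightarrow> real" assume f: "continuous_on UNIV f"
      show "((\<lambda>t. (1 / t) * integral {0..t} (\<lambda>s. f (\<Phi> s (abs_torus x)))) \<longlongrightarrow> (\<integral>y. f y \<partial>?\<mu>)) at_top"
        unfolding \<mu>(2)[OF f] unfolding P Q by (rule avg(2)[OF f])
    qed
    then show ?thesis by (simp add: basin_def)
  qed
  have AE: "AE y in torus_lebesgue. y \<in> basin \<Phi> ?\<mu>"
    using AE_torus_transversal[OF AE_trimmed_shift[OF irr assms(3)]] by (rule eventually_mono) (rule attract)
  then obtain N where N: "N \<in> null_sets torus_lebesgue" "- basin \<Phi> ?\<mu> \<subseteq> N"
    unfolding eventually_ae_filter space_torus_lebesgue by auto
  \<comment> \<open>Completeness of \<open>torus_lebesgue\<close> is used here: a subset of a null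
    set is measurable, and with it the basin.\<close>
  have null: "- basin \<Phi> ?\<mu> \<in> null_sets torus_lebesgue"
    using null_sets_completion_subset[OF N(2)] N(1) unfolding torus_lebesgue_def by blast
  \<comment> \<open>Applied to the basin of any physical measure, this produces a point common to
    two basins; as a point has only one limit set, the two measures coincide.\<close>
  have meets: "A \<inter> basin \<Phi> ?\<mu> \<noteq> {}" if "emeasure torus_lebesgue A > 0" for A
  proof
    assume "A \<inter> basin \<Phi> ?\<mu> = {}"
    then have "A \<subseteq> - basin \<Phi> ?\<mu>" by blast
    then have "emeasure torus_lebesgue A \<le> emeasure torus_lebesgue (- basin \<Phi> ?\<mu>)"
      using null by (intro emeasure_mono) auto
    also have "\<dots> = 0" using null by auto
    finally show False using that by simp
  qed
  have "emeasure torus_lebesgue (basin \<Phi> ?\<mu>) > 0"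
  proof (rule ccontr)
    assume "\<not> emeasure torus_lebesgue (basin \<Phi> ?\<mu>) > 0"
    moreover have "basin \<Phi> ?\<mu> \<in> sets torus_lebesgue"
      using null sets.compl_sets[of "- basin \<Phi> ?\<mu>" torus_lebesgue]
          by (auto simp: space_torus_lebesgue Compl_eq_Diff_UNIV[symmetric])
    ultimately have "basin \<Phi> ?\<mu> \<in> null_sets torus_lebesgue" by auto
    from null_sets.Un[OF this null] have "UNIV \<in> null_sets torus_lebesgue" by simp
    then show False using emeasure_torus_lebesgue_UNIV by auto
  qed
  then have phys: "physical_measure \<Phi> ?\<mu>" using \<mu>(1) by (simp add: physical_measure_def)
  moreover have "\<nu> = ?\<mu>" if "physical_measure \<Phi> \<nu>" for \<nu>
  proof -
    have "basin \<Phi> \<nu> \<inter> basin \<Phi> ?\<mu> \<noteq> {}" using that by (intro meets) (simp add: physical_measure_def)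
    then show ?thesis by (auto simp: basin_def)
  qed
  ultimately show ?thesis using AE by blast
qed

end
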